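(* Let $G$ be a discrete, finitely generated, residually finite group, fix a $G$ odometer on $\overleftarrow{G/\Gamma_n}$ with Haar probability measure $\mu$, and let $U$ be the induced unitary representation of $G$ on $L^2(\overleftarrow{G/\Gamma_n},\mu)$. Then $U$ admits a decomposition into finite dimensional irreducible representations of $G$ of the form $$U=\bigoplus_{k=1}^\infty U_k$$ with the property that there exists an increasing sequence $k_n\to\infty$ so that for all $n$, $\bigoplus_{k=1}^{k_n}U_k$ is equivalent to the unique irreducible decomposition of the regular representation of $G/\Gamma_n$.
   Context: A $G$ odometer is defined by a sequence $\Gamma_1\supset\Gamma_2\supset\cdots$ of finite index normal subgroups of $G$ with $\bigcap_n\Gamma_n=\{e\}$: $\overleftarrow{G/\Gamma_n}$ is the inverse limit of the finite groups $G/\Gamma_n$ under the maps $\pi_n:G/\Gamma_{n+1}\to G/\Gamma_n$ induced by the inclusions $\Gamma_{n+1}\subset\Gamma_n$, a compact metrizable group, on which $G$ acts by left multiplication; this action preserves Haar probability measure $\mu$. The induced unitary representation is $(U(g)f)(\mathbf x)=f(g^{-1}\mathbf x)$ for $g\in G$, $f\in L^2(\overleftarrow{G/\Gamma_n},\mu)$. The direct sum is the Hilbert space direct sum. The regular representation of $G/\Gamma_n$ is the (left) regular representation on $L^2(G/\Gamma_n)$, regarded as a representation of $G$ through the quotient map $G\to G/\Gamma_n$; equivalence is unitary equivalence of representations.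
   Formalization: G is assumed infinite (for finite G the space L² is finite dimensional, so no infinite sum with k_n→∞ exists); the inclusions of the Γ_n may be non-strict, and k_n increases strictly exactly where Γ_{n+1} is a proper subgroup of Γ_n. *)

theory Defs
  imports "HOL-Probability.Probability_Measure" "HOL-Algebra.Algebra"
begin

definition finitely_generated_group :: "('a, 'b) monoid_scheme \<Rightarrow> bool" where
  "finitely_generated_group G \<longleftrightarrow>
     (\<exists>S. finite S \<and> S \<subseteq> carrier G \<and> generate G S = carrier G)"

definition finite_index_normal :: "('a, 'b) monoid_scheme \<Rightarrow> 'a set \<Rightarrow> bool" where
  "finite_index_normal G N \<longleftrightarrow> N \<lhd> G \<and> finite (rcosets\<^bsub>G\<^esub> N)"

definition residually_finite_group :: "('a, 'b) monoid_scheme \<Rightarrow> bool" where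
  "residually_finite_group G \<longleftrightarrow>
     (\<forall>g\<in>carrier G. g \<noteq> \<one>\<^bsub>G\<^esub> \<longrightarrow> (\<exists>N. finite_index_normal G N \<and> g \<notin> N))"

text \<open>Sequences are indexed from \<open>0\<close>. The inclusions need not be strict.\<close>

definition odometer_sequence :: "('a, 'b) monoid_scheme \<Rightarrow> (nat \<Rightarrow> 'a set) \<Rightarrow> bool" where
  "odometer_sequence G \<Gamma> \<longleftrightarrow>
     (\<forall>n. finite_index_normal G (\<Gamma> n)) \<and> (\<forall>n. \<Gamma> (Suc n) \<subseteq> \<Gamma> n) \<and> (\<Inter>n. \<Gamma> n) = {\<one>\<^bsub>G\<^esub>}"

text \<open>The map \<open>G/\<Gamma>\<^sub>n\<^sub>+\<^sub>1 \<rightarrow> G/\<Gamma>\<^sub>n\<close> induced by the inclusion, written without choosing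
  representatives; see the lemma \<open>connecting_map_coset\<close>.\<close>

definition connecting_map ::
  "('a, 'b) monoid_scheme \<Rightarrow> (nat \<Rightarrow> 'a set) \<Rightarrow> nat \<Rightarrow> 'a set \<Rightarrow> 'a set" where
  "connecting_map G \<Gamma> n C = \<Gamma> n <#>\<^bsub>G\<^esub> C"

lemma connecting_map_coset:
  assumes "group G" "odometer_sequence G \<Gamma>" "g \<in> carrier G"
  shows "connecting_map G \<Gamma> n (\<Gamma> (Suc n) #>\<^bsub>G\<^esub> g) = \<Gamma> n #>\<^bsub>G\<^esub> g"
proof -
  interpret group G by fact
  have n: "\<Gamma> n \<lhd> G" and s: "\<Gamma> (Suc n) \<lhd> G" and le: "\<Gamma> (Suc n) \<subseteq> \<Gamma> n"
    using assms(2) by (auto simp: odometer_sequence_def finite_index_normal_def)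
  have sub: "subgroup (\<Gamma> n) G" "subgroup (\<Gamma> (Suc n)) G"
    using n s by (auto simp: normal_def)
  have "\<Gamma> n <#>\<^bsub>G\<^esub> \<Gamma> (Suc n) = \<Gamma> n"
  proof
    show "\<Gamma> n <#>\<^bsub>G\<^esub> \<Gamma> (Suc n) \<subseteq> \<Gamma> n"
      using le subgroup.m_closed[OF sub(1)] by (auto simp: set_mult_def)
    show "\<Gamma> n \<subseteq> \<Gamma> n <#>\<^bsub>G\<^esub> \<Gamma> (Suc n)"
    proof
      fix x assume x: "x \<in> \<Gamma> n"
      then have "x = x \<otimes>\<^bsub>G\<^esub> \<one>\<^bsub>G\<^esub>" using subgroup.mem_carrier[OF sub(1)] by simp
      then show "x \<in> \<Gamma> n <#>\<^bsub>G\<^esub> \<Gamma> (Suc n)"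
        using x subgroup.one_closed[OF sub(2)] unfolding set_mult_def by blast
    qed
  qed
  then show ?thesis
    unfolding connecting_map_def
    using setmult_rcos_assoc[OF subgroup.subset[OF sub(1)] subgroup.subset[OF sub(2)] assms(3)]
    by simp
qed

definition odometer :: "('a, 'b) monoid_scheme \<Rightarrow> (nat \<Rightarrow> 'a set) \<Rightarrow> (nat \<Rightarrow> 'a set) monoid" where
  "odometer G \<Gamma> = (product_group UNIV (\<lambda>n. G Mod \<Gamma> n))
     \<lparr>carrier := {x \<in> carrier (product_group UNIV (\<lambda>n. G Mod \<Gamma> n)).
                   \<forall>n. connecting_map G \<Gamma> n (x (Suc n)) = x n}\<rparr>"

definition odometer_topology ::
  "('a, 'b) monoid_scheme \<Rightarrow> (nat \<Rightarrow> 'a set) \<Rightarrow> (nat \<Rightarrow> 'a set) topology" where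
  "odometer_topology G \<Gamma> =
     subtopology (product_topology (\<lambda>n. discrete_topology (carrier (G Mod \<Gamma> n))) UNIV)
       (carrier (odometer G \<Gamma>))"

definition odometer_action ::
  "('a, 'b) monoid_scheme \<Rightarrow> (nat \<Rightarrow> 'a set) \<Rightarrow> 'a \<Rightarrow> (nat \<Rightarrow> 'a set) \<Rightarrow> (nat \<Rightarrow> 'a set)" where
  "odometer_action G \<Gamma> g x = (\<lambda>n. \<Gamma> n #>\<^bsub>G\<^esub> g) \<otimes>\<^bsub>odometer G \<Gamma>\<^esub> x"

text \<open>Haar probability measure of a compact group \<open>K\<close> with topology \<open>T\<close>: the left-invariant Borel
  probability measure. Regularity is not listed, being automatic in the metrizable case.\<close>

definition haar_probability :: "('x, 'c) monoid_scheme \<Rightarrow> 'x topology \<Rightarrow> 'x measure \<Rightarrow> bool" where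
  "haar_probability K T \<mu> \<longleftrightarrow>
     space \<mu> = topspace T \<and> sets \<mu> = sigma_sets (topspace T) {S. openin T S} \<and> prob_space \<mu> \<and>
     (\<forall>a\<in>carrier K. \<forall>A\<in>sets \<mu>. emeasure \<mu> ((\<lambda>x. a \<otimes>\<^bsub>K\<^esub> x) ` A) = emeasure \<mu> A)"

record 'v inner_space =
  vecs :: "'v set"
  vzero :: 'v
  vadd :: "'v \<Rightarrow> 'v \<Rightarrow> 'v"
  vscale :: "complex \<Rightarrow> 'v \<Rightarrow> 'v"
  vinner :: "'v \<Rightarrow> 'v \<Rightarrow> complex"

record ('g, 'v) rep = "'v inner_space" +
  act :: "'g \<Rightarrow> 'v \<Rightarrow> 'v"

definition vdist :: "('v, 'm) inner_space_scheme \<Rightarrow> 'v \<Rightarrow> 'v \<Rightarrow> real" where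
  "vdist H u v = (let d = vadd H u (vscale H (-1) v) in sqrt (Re (vinner H d d)))"

definition lin_subspace :: "('v, 'm) inner_space_scheme \<Rightarrow> 'v set \<Rightarrow> bool" where
  "lin_subspace H V \<longleftrightarrow> V \<subseteq> vecs H \<and> vzero H \<in> V \<and>
     (\<forall>u\<in>V. \<forall>v\<in>V. vadd H u v \<in> V) \<and> (\<forall>c. \<forall>v\<in>V. vscale H c v \<in> V)"

definition lin_span :: "('v, 'm) inner_space_scheme \<Rightarrow> 'v set \<Rightarrow> 'v set" where
  "lin_span H S = \<Inter>{V. lin_subspace H V \<and> S \<subseteq> V}"

definition norm_closure :: "('v, 'm) inner_space_scheme \<Rightarrow> 'v set \<Rightarrow> 'v set" where
  "norm_closure H S = {v \<in> vecs H. \<forall>e>0. \<exists>w\<in>S. vdist H v w < e}"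

definition closed_subspace :: "('v, 'm) inner_space_scheme \<Rightarrow> 'v set \<Rightarrow> bool" where
  "closed_subspace H V \<longleftrightarrow> lin_subspace H V \<and> norm_closure H V = V"

definition finite_dim :: "('v, 'm) inner_space_scheme \<Rightarrow> bool" where
  "finite_dim H \<longleftrightarrow> (\<exists>B. finite B \<and> B \<subseteq> vecs H \<and> lin_span H B = vecs H)"

definition invariant :: "('a, 'b) monoid_scheme \<Rightarrow> ('a, 'v) rep \<Rightarrow> 'v set \<Rightarrow> bool" where
  "invariant G R V \<longleftrightarrow> (\<forall>g\<in>carrier G. \<forall>v\<in>V. act R g v \<in> V)"

definition subrep :: "('a, 'v) rep \<Rightarrow> 'v set \<Rightarrow> ('a, 'v) rep" where
  "subrep R V = R\<lparr>vecs := V\<rparr>"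

definition irreducible_rep :: "('a, 'b) monoid_scheme \<Rightarrow> ('a, 'v) rep \<Rightarrow> bool" where
  "irreducible_rep G R \<longleftrightarrow> vecs R \<noteq> {vzero R} \<and>
     (\<forall>W. closed_subspace R W \<and> invariant G R W \<longrightarrow> W = {vzero R} \<or> W = vecs R)"

definition unitarily_equivalent ::
  "('a, 'b) monoid_scheme \<Rightarrow> ('a, 'v) rep \<Rightarrow> ('a, 'w) rep \<Rightarrow> bool" where
  "unitarily_equivalent G R S \<longleftrightarrow>
     (\<exists>T. bij_betw T (vecs R) (vecs S) \<and>
          (\<forall>u\<in>vecs R. \<forall>v\<in>vecs R. T (vadd R u v) = vadd S (T u) (T v)) \<and>
          (\<forall>c. \<forall>v\<in>vecs R. T (vscale R c v) = vscale S c (T v)) \<and>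
          (\<forall>u\<in>vecs R. \<forall>v\<in>vecs R. vinner S (T u) (T v) = vinner R u v) \<and>
          (\<forall>g\<in>carrier G. \<forall>v\<in>vecs R. T (act R g v) = act S g (T v)))"

text \<open>Direct sums are internal: for mutually orthogonal closed subspaces \<open>V i\<close>, their Hilbert direct
  sum is the closed linear span. For finitely many finite-dimensional \<open>V i\<close> this is the ordinary
  (algebraic) direct sum.\<close>

definition hilbert_sum :: "('v, 'm) inner_space_scheme \<Rightarrow> 'i set \<Rightarrow> ('i \<Rightarrow> 'v set) \<Rightarrow> 'v set" where
  "hilbert_sum H I V = norm_closure H (lin_span H (\<Union>i\<in>I. V i))"

definition irreducible_decomposition ::
  "('a, 'b) monoid_scheme \<Rightarrow> ('a, 'v) rep \<Rightarrow> 'i set \<Rightarrow> ('i \<Rightarrow> 'v set) \<Rightarrow> bool" where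
  "irreducible_decomposition G R I V \<longleftrightarrow>
     (\<forall>i\<in>I. closed_subspace R (V i) \<and> invariant G R (V i) \<and> irreducible_rep G (subrep R (V i))) \<and>
     (\<forall>i\<in>I. \<forall>j\<in>I. i \<noteq> j \<longrightarrow> (\<forall>u\<in>V i. \<forall>v\<in>V j. vinner R u v = 0)) \<and>
     hilbert_sum R I V = vecs R"

text \<open>Vectors of \<open>L\<^sup>2(M)\<close> are the classes of square-integrable functions modulo equality almost
  everywhere; the operations do not depend on the representative chosen.\<close>

definition sq_integrable :: "'x measure \<Rightarrow> ('x \<Rightarrow> complex) set" where
  "sq_integrable M = {f \<in> borel_measurable M. integrable M (\<lambda>x. (cmod (f x))\<^sup>2)}"

definition ae_class :: "'x measure \<Rightarrow> ('x \<Rightarrow> complex) \<Rightarrow> ('x \<Rightarrow> complex) set" where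
  "ae_class M f = {h \<in> sq_integrable M. AE x in M. h x = f x}"

definition some_rep :: "('x \<Rightarrow> complex) set \<Rightarrow> 'x \<Rightarrow> complex" where
  "some_rep u = (SOME f. f \<in> u)"

definition L2_rep ::
  "('a, 'b) monoid_scheme \<Rightarrow> 'x measure \<Rightarrow> ('a \<Rightarrow> 'x \<Rightarrow> 'x) \<Rightarrow> ('a, ('x \<Rightarrow> complex) set) rep" where
  "L2_rep G M \<alpha> =
     \<lparr>vecs = ae_class M ` sq_integrable M,
      vzero = ae_class M (\<lambda>x. 0),
      vadd = (\<lambda>u v. ae_class M (\<lambda>x. some_rep u x + some_rep v x)),
      vscale = (\<lambda>c u. ae_class M (\<lambda>x. c * some_rep u x)),
      vinner = (\<lambda>u v. \<integral>x. some_rep u x * cnj (some_rep v x) \<partial>M),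
      act = (\<lambda>g u. ae_class M (\<lambda>x. some_rep u (\<alpha> (inv\<^bsub>G\<^esub> g) x)))\<rparr>"

definition odometer_rep ::
  "('a, 'b) monoid_scheme \<Rightarrow> (nat \<Rightarrow> 'a set) \<Rightarrow> (nat \<Rightarrow> 'a set) measure
    \<Rightarrow> ('a, ((nat \<Rightarrow> 'a set) \<Rightarrow> complex) set) rep" where
  "odometer_rep G \<Gamma> \<mu> = L2_rep G \<mu> (odometer_action G \<Gamma>)"

definition left_regular_rep :: "('x, 'c) monoid_scheme \<Rightarrow> ('x, ('x \<Rightarrow> complex) set) rep" where
  "left_regular_rep K = L2_rep K (count_space (carrier K)) (\<lambda>a x. a \<otimes>\<^bsub>K\<^esub> x)"

definition pullback_rep :: "('a \<Rightarrow> 'q) \<Rightarrow> ('q, 'v) rep \<Rightarrow> ('a, 'v) rep" where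
  "pullback_rep \<phi> R =
     \<lparr>vecs = vecs R, vzero = vzero R, vadd = vadd R, vscale = vscale R, vinner = vinner R,
      act = (\<lambda>g. act R (\<phi> g))\<rparr>"

definition quotient_regular_rep ::
  "('a, 'b) monoid_scheme \<Rightarrow> 'a set \<Rightarrow> ('a, ('a set \<Rightarrow> complex) set) rep" where
  "quotient_regular_rep G N = pullback_rep (\<lambda>g. N #>\<^bsub>G\<^esub> g) (left_regular_rep (G Mod N))"

end

theory Submission
  imports Defs
begin

text \<open>
  Let \<open>E n\<close> be the space of (classes of) functions on the odometer that depend on the \<open>n\<close>-th
  coordinate only. The translations by elements of \<open>G\<close> permute the fibres of the \<open>n\<close>-th coordinate
  transitively, so Haar measure gives all these fibres the same mass \<open>1 / [G : \<Gamma> n]\<close>; up to this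
  normalization \<open>E n\<close> is the space of all functions on \<open>G/\<Gamma> n\<close>, and \<open>G\<close> acts on it by the regular
  representation (\<open>E_equivalent\<close>). The spaces \<open>E n\<close> are finite-dimensional and invariant, they
  increase with \<open>n\<close>, strictly so at each strict inclusion of the \<open>\<Gamma> n\<close> (\<open>E_grows\<close>), and their union
  is dense because the fibres of the coordinates generate the Borel sets (\<open>E_dense\<close>).

  The orthogonal complement of an invariant subspace is invariant. Hence a list of mutually orthogonal
  irreducible subspaces that spans \<open>E n\<close> extends to one that spans \<open>E (Suc n)\<close>
  (\<open>irreducible_list_complete\<close>). The lists obtained in this way are prefixes of each other, together
  they decompose the whole space (\<open>decomposition_along_exhaustion\<close>), and \<open>k n\<close> is the length of
  the \<open>n\<close>-th list. As \<open>G\<close> is infinite and the \<open>\<Gamma> n\<close> intersect in the trivial group, the sequence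
  \<open>\<Gamma>\<close> is not eventually constant, so that \<open>k\<close> tends to infinity.

  Uniqueness of the decomposition of the regular representation is an instance of
  \<open>decomposition_unique\<close>: an isomorphism between two orthogonal sums of irreducible subspaces can be
  corrected so as to match the complement of one summand with the complement of a summand isomorphic
  to it, and induction applies. The isomorphisms that occur on the way are not isometric; it is
  Schur's lemma (\<open>Schur\<close>) that turns a nonzero intertwiner of irreducible subspaces into a unitary
  equivalence. Its usual proof by eigenvalues is replaced by maximising \<open>\<parallel>T u\<parallel>\<close> over the unit sphere.

  Vectors live in the carrier of a record, not in a type. Identities between vectors are
  therefore checked by taking inner products with an arbitrary vector, and finite dimension is
  expressed as a bound on the size of orthonormal sets.
\<close>

section \<open>Inner product spaces and finite-dimensional subspaces\<close>

text \<open>The axioms speak of inner products only. Definiteness is postulated for differences, so that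
  \<open>vec_eqI\<close> holds; the laws of a complex vector space then follow from it.\<close>

locale ip_space =
  fixes H :: "('v, 'm) inner_space_scheme"
  assumes zero_in: "vzero H \<in> vecs H"
    and add_in: "\<lbrakk>u \<in> vecs H; v \<in> vecs H\<rbrakk> \<Longrightarrow> vadd H u v \<in> vecs H"
    and scale_in: "u \<in> vecs H \<Longrightarrow> vscale H c u \<in> vecs H"
    and ip_zero: "w \<in> vecs H \<Longrightarrow> vinner H (vzero H) w = 0"
    and ip_add: "\<lbrakk>u \<in> vecs H; v \<in> vecs H; w \<in> vecs H\<rbrakk>
      \<Longrightarrow> vinner H (vadd H u v) w = vinner H u w + vinner H v w"
    and ip_scale: "\<lbrakk>u \<in> vecs H; w \<in> vecs H\<rbrakk> \<Longrightarrow> vinner H (vscale H c u) w = c * vinner H u w"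
    and ip_cnj: "\<lbrakk>u \<in> vecs H; v \<in> vecs H\<rbrakk> \<Longrightarrow> vinner H v u = cnj (vinner H u v)"
    and ip_pos: "u \<in> vecs H \<Longrightarrow> 0 \<le> Re (vinner H u u)"
    and ip_definite: "\<lbrakk>u \<in> vecs H; v \<in> vecs H;
        vinner H (vadd H u (vscale H (-1) v)) (vadd H u (vscale H (-1) v)) = 0\<rbrakk> \<Longrightarrow> u = v"
begin

abbreviation ip where "ip \<equiv> vinner H"
abbreviation sub where "sub u v \<equiv> vadd H u (vscale H (-1) v)"

lemma sub_in: "\<lbrakk>u \<in> vecs H; v \<in> vecs H\<rbrakk> \<Longrightarrow> sub u v \<in> vecs H"
  by (simp add: add_in scale_in)

lemma ip_zero_right: "w \<in> vecs H \<Longrightarrow> ip w (vzero H) = 0"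
  using ip_cnj[of "vzero H" w] ip_zero zero_in by simp

lemma ip_add_right:
  "\<lbrakk>u \<in> vecs H; v \<in> vecs H; w \<in> vecs H\<rbrakk> \<Longrightarrow> ip w (vadd H u v) = ip w u + ip w v"
  using ip_cnj[of "vadd H u v" w] ip_cnj[of u w] ip_cnj[of v w] by (simp add: add_in ip_add)

lemma ip_scale_right:
  "\<lbrakk>u \<in> vecs H; w \<in> vecs H\<rbrakk> \<Longrightarrow> ip w (vscale H c u) = cnj c * ip w u"
  using ip_cnj[of "vscale H c u" w] ip_cnj[of u w] by (simp add: scale_in ip_scale)

lemmas ip_simps = zero_in add_in scale_in ip_zero ip_zero_right ip_add ip_add_right
  ip_scale ip_scale_right

lemma ip_self: "u \<in> vecs H \<Longrightarrow> ip u u = complex_of_real (Re (ip u u))"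
  using ip_cnj[of u u] by (simp add: complex_eq_iff)

lemma ip_sub_self_eq_0: "\<lbrakk>u \<in> vecs H; v \<in> vecs H; ip (sub u v) u = 0; ip (sub u v) v = 0\<rbrakk> \<Longrightarrow> u = v"
  by (rule ip_definite) (simp_all add: ip_simps)

lemma vec_eqI:
  assumes "u \<in> vecs H" "v \<in> vecs H" "\<And>w. w \<in> vecs H \<Longrightarrow> ip u w = ip v w"
  shows "u = v"
  by (rule ip_sub_self_eq_0) (use assms in \<open>simp_all add: ip_simps\<close>)

lemma zero_iff: "u \<in> vecs H \<Longrightarrow> u = vzero H \<longleftrightarrow> ip u u = 0"
  using ip_definite[of u "vzero H"] by (auto simp: ip_simps)

lemma sub_zeroD: "\<lbrakk>sub u v = vzero H; u \<in> vecs H; v \<in> vecs H\<rbrakk> \<Longrightarrow> u = v"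
  by (rule ip_definite) (simp_all add: ip_simps)

lemma scale_zero: "u \<in> vecs H \<Longrightarrow> vscale H 0 u = vzero H"
  by (rule vec_eqI) (simp_all add: ip_simps)

lemma subspace_vecs: "lin_subspace H (vecs H)"
  by (simp add: lin_subspace_def ip_simps)

lemma subspace_sub: "\<lbrakk>lin_subspace H V; u \<in> V; v \<in> V\<rbrakk> \<Longrightarrow> sub u v \<in> V"
  by (simp add: lin_subspace_def)

end

definition orthonormal :: "('v, 'm) inner_space_scheme \<Rightarrow> 'v set \<Rightarrow> bool" where
  "orthonormal H S \<longleftrightarrow> finite S \<and> S \<subseteq> vecs H \<and>
     (\<forall>e\<in>S. \<forall>f\<in>S. vinner H e f = (if e = f then 1 else 0))"

text \<open>In this form finite dimension is visibly inherited by subspaces (\<open>fin_dim_subset\<close>).\<close>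

definition fin_dim_subspace :: "('v, 'm) inner_space_scheme \<Rightarrow> 'v set \<Rightarrow> bool" where
  "fin_dim_subspace H F \<longleftrightarrow> lin_subspace H F \<and>
     (\<exists>d. \<forall>S. orthonormal H S \<and> S \<subseteq> F \<longrightarrow> card S \<le> d)"

definition linear_form :: "('v, 'm) inner_space_scheme \<Rightarrow> 'v set \<Rightarrow> ('v \<Rightarrow> complex) \<Rightarrow> bool" where
  "linear_form H V L \<longleftrightarrow> (\<forall>u\<in>V. \<forall>v\<in>V. L (vadd H u v) = L u + L v) \<and>
     (\<forall>c. \<forall>v\<in>V. L (vscale H c v) = c * L v)"

definition orthogonal_sets :: "('v, 'm) inner_space_scheme \<Rightarrow> 'v set \<Rightarrow> 'v set \<Rightarrow> bool" where
  "orthogonal_sets H A B \<longleftrightarrow> (\<forall>u\<in>A. \<forall>v\<in>B. vinner H u v = 0)"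

text \<open>For \<open>S\<close> contained in a finite-dimensional \<open>F\<close> this says that \<open>S\<close> spans \<open>F\<close>
  (\<open>lin_span_total\<close>); it is the form in which spanning is inherited by orthogonal complements.\<close>

definition total_in :: "('v, 'm) inner_space_scheme \<Rightarrow> 'v set \<Rightarrow> 'v set \<Rightarrow> bool" where
  "total_in H F S \<longleftrightarrow> (\<forall>u\<in>F. (\<forall>s\<in>S. vinner H u s = 0) \<longrightarrow> u = vzero H)"

definition orth_comp_in :: "('v, 'm) inner_space_scheme \<Rightarrow> 'v set \<Rightarrow> 'v set \<Rightarrow> 'v set" where
  "orth_comp_in H F S = {u \<in> F. \<forall>s\<in>S. vinner H u s = 0}"

definition proj_onto :: "('v, 'm) inner_space_scheme \<Rightarrow> 'v set \<Rightarrow> 'v \<Rightarrow> 'v" where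
  "proj_onto H F u = (SOME p. p \<in> F \<and> (\<forall>v\<in>F. vinner H p v = vinner H u v))"

definition dimension :: "('v, 'm) inner_space_scheme \<Rightarrow> 'v set \<Rightarrow> nat" where
  "dimension H F = (GREATEST n. \<exists>S. orthonormal H S \<and> S \<subseteq> F \<and> card S = n)"

lemma fin_dim_subspaceD: "fin_dim_subspace H F \<Longrightarrow> lin_subspace H F"
  by (simp add: fin_dim_subspace_def)

lemma fin_dim_subset: "\<lbrakk>fin_dim_subspace H F; lin_subspace H E; E \<subseteq> F\<rbrakk> \<Longrightarrow> fin_dim_subspace H E"
  unfolding fin_dim_subspace_def by (meson order_trans)

context ip_space
begin

text \<open>A finite linear combination is pinned down here by the value of every linear form on it, which
  spares a theory of sums in the carrier.\<close>

lemma lincomb_exists: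
  assumes V: "lin_subspace H V" and S: "finite S" "S \<subseteq> V"
  shows "\<exists>p\<in>V. \<forall>L. linear_form H V L \<longrightarrow> L p = (\<Sum>e\<in>S. c e * L e)"
  using S
proof (induction S rule: finite_induct)
  case empty
  have z: "vzero H \<in> V" using V by (simp add: lin_subspace_def)
  have "L (vzero H) = 0" if "linear_form H V L" for L
  proof -
    have "L (vscale H 0 (vzero H)) = 0 * L (vzero H)"
      using that z by (auto simp: linear_form_def)
    then show ?thesis by (simp add: scale_zero zero_in)
  qed
  with z show ?case by auto
next
  case (insert e S)
  then obtain p where p: "p \<in> V" "\<forall>L. linear_form H V L \<longrightarrow> L p = (\<Sum>e\<in>S. c e * L e)"
    by auto
  have e: "vscale H (c e) e \<in> V" "e \<in> V" using V insert by (auto simp: lin_subspace_def)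
  have "L (vadd H (vscale H (c e) e) p) = (\<Sum>e\<in>insert e S. c e * L e)"
    if "linear_form H V L" for L
    using that p e insert.hyps by (simp add: linear_form_def)
  moreover have "vadd H (vscale H (c e) e) p \<in> V" using V e p by (simp add: lin_subspace_def)
  ultimately show ?case by blast
qed

lemma linear_form_ip: "\<lbrakk>V \<subseteq> vecs H; w \<in> vecs H\<rbrakk> \<Longrightarrow> linear_form H V (\<lambda>u. ip u w)"
  by (auto simp: linear_form_def subset_iff ip_simps)

lemma subspace_subset: "lin_subspace H V \<Longrightarrow> V \<subseteq> vecs H"
  by (simp add: lin_subspace_def)

lemma lin_span_subspace: "S \<subseteq> vecs H \<Longrightarrow> lin_subspace H (lin_span H S)"
  using subspace_vecs unfolding lin_span_def lin_subspace_def by blast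

lemma lin_span_superset: "S \<subseteq> lin_span H S"
  by (auto simp: lin_span_def)

lemma lin_span_least: "\<lbrakk>lin_subspace H V; S \<subseteq> V\<rbrakk> \<Longrightarrow> lin_span H S \<subseteq> V"
  by (auto simp: lin_span_def)

text \<open>The Fourier expansion of \<open>x\<close> along \<open>S\<close>.\<close>

lemma orthonormal_combination:
  assumes S: "orthonormal H S"
  shows "\<exists>p\<in>lin_span H S. p \<in> vecs H \<and>
    (\<forall>w\<in>vecs H. ip p w = (\<Sum>e\<in>S. ip x e * ip e w)) \<and> (\<forall>f\<in>S. ip p f = ip x f)"
proof -
  have fin: "finite S" and Sv: "S \<subseteq> vecs H" using S by (auto simp: orthonormal_def)
  have L: "lin_subspace H (lin_span H S)" using Sv by (rule lin_span_subspace)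
  have Lv: "lin_span H S \<subseteq> vecs H" using L by (rule subspace_subset)
  obtain p where p: "p \<in> lin_span H S"
    "\<forall>L. linear_form H (lin_span H S) L \<longrightarrow> L p = (\<Sum>e\<in>S. ip x e * L e)"
    using lincomb_exists[OF L fin lin_span_superset, of "ip x"] by blast
  have pw: "ip p w = (\<Sum>e\<in>S. ip x e * ip e w)" if "w \<in> vecs H" for w
    using p(2) linear_form_ip[OF Lv that] by blast
  have "ip p f = ip x f" if f: "f \<in> S" for f
  proof -
    have "ip p f = (\<Sum>e\<in>S. ip x e * ip e f)" using pw f Sv by auto
    also have "\<dots> = (\<Sum>e\<in>S. if e = f then ip x f else 0)"
      by (rule sum.cong) (use S f in \<open>auto simp: orthonormal_def\<close>)
    finally show ?thesis using fin f by simp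
  qed
  with p(1) pw show ?thesis using Lv by blast
qed

text \<open>An orthonormal set of the largest possible size is complete: a nonzero vector orthogonal to it
  could be normalized and added.\<close>

lemma fin_dim_onb:
  assumes F: "fin_dim_subspace H F"
  obtains S where "orthonormal H S" "S \<subseteq> F" "total_in H F S" "card S = dimension H F"
proof -
  have sub: "lin_subspace H F" using F by (rule fin_dim_subspaceD)
  then have Fv: "F \<subseteq> vecs H" by (rule subspace_subset)
  obtain d where d: "\<And>S. orthonormal H S \<Longrightarrow> S \<subseteq> F \<Longrightarrow> card S \<le> d"
    using F by (auto simp: fin_dim_subspace_def)
  let ?P = "\<lambda>n. \<exists>S. orthonormal H S \<and> S \<subseteq> F \<and> card S = n"
  have "?P 0" by (rule exI[of _ "{}"]) (simp add: orthonormal_def)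
  then have P0: "?P 0" .
  have bound: "\<And>y. ?P y \<Longrightarrow> y \<le> d" using d by blast
  have "?P (dimension H F)" unfolding dimension_def by (rule GreatestI_nat[of ?P, OF P0 bound])
  then obtain S where S: "orthonormal H S" "S \<subseteq> F" "card S = dimension H F" by auto
  have max: "card S' \<le> card S" if "orthonormal H S'" "S' \<subseteq> F" for S'
    unfolding S(3) dimension_def
    by (rule Greatest_le_nat[of ?P, OF _ bound]) (use that in blast)
  have "u = vzero H" if u: "u \<in> F" "\<forall>s\<in>S. ip u s = 0" for u
  proof (rule ccontr)
    assume nz: "u \<noteq> vzero H"
    have uv: "u \<in> vecs H" using u Fv by auto
    define r where "r = Re (ip u u)"
    have r: "ip u u = complex_of_real r" using ip_self[OF uv] by (simp add: r_def)
    have "r \<noteq> 0" using nz zero_iff[OF uv] r by auto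
    then have rpos: "r > 0" using ip_pos[OF uv] by (simp add: r_def)
    define e where "e = vscale H (complex_of_real (1 / sqrt r)) u"
    have eF: "e \<in> F" using sub u by (simp add: e_def lin_subspace_def)
    have ee: "ip e e = 1"
      using rpos by (simp add: e_def ip_simps uv r flip: of_real_mult of_real_divide)
    have es: "ip e s = 0" "ip s e = 0" if "s \<in> S" for s
    proof -
      have "s \<in> vecs H" using that S Fv by auto
      then show "ip e s = 0" using u that by (simp add: e_def ip_simps uv)
      then show "ip s e = 0" using ip_cnj[of e s] \<open>s \<in> vecs H\<close> eF Fv by auto
    qed
    have "e \<notin> S" using es ee by auto
    moreover have "orthonormal H (insert e S)"
      using S eF Fv ee es by (auto simp: orthonormal_def)
    ultimately show False using max[of "insert e S"] S eF by (simp add: orthonormal_def)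
  qed
  then show ?thesis using that[of S] S by (auto simp: total_in_def)
qed

text \<open>The projection of \<open>u\<close> is its expansion \<open>p\<close> in a complete orthonormal set. A vector \<open>v\<close> of \<open>F\<close>
  equals its own expansion \<open>q\<close>, so inner products with \<open>v\<close> are determined by those with the basis.\<close>

lemma proj_exists:
  assumes F: "fin_dim_subspace H F" and u: "u \<in> vecs H"
  shows "\<exists>p\<in>F. \<forall>v\<in>F. ip p v = ip u v"
proof -
  have sub: "lin_subspace H F" using F by (rule fin_dim_subspaceD)
  then have Fv: "F \<subseteq> vecs H" by (rule subspace_subset)
  obtain S where S: "orthonormal H S" "S \<subseteq> F" "total_in H F S" by (rule fin_dim_onb[OF F])
  have LF: "lin_span H S \<subseteq> F" by (rule lin_span_least[OF sub S(2)])
  obtain p where p0: "p \<in> lin_span H S" and p: "p \<in> vecs H" "\<forall>f\<in>S. ip p f = ip u f"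
    using orthonormal_combination[OF S(1), of u] by blast
  have pv: "p \<in> vecs H" by fact
  have "ip p v = ip u v" if v: "v \<in> F" for v
  proof -
    have vv: "v \<in> vecs H" using v Fv by auto
    obtain q where q0: "q \<in> lin_span H S" and qv: "q \<in> vecs H"
      and q: "\<forall>w\<in>vecs H. ip q w = (\<Sum>e\<in>S. ip v e * ip e w)"
      "\<forall>f\<in>S. ip q f = ip v f"
      using orthonormal_combination[OF S(1), of v] by blast
    have "ip (sub v q) e = 0" if "e \<in> S" for e
      using bspec[OF q(2) that] S Fv that vv qv by (simp add: ip_simps subset_iff)
    moreover have "sub v q \<in> F" using sub v q0 LF by (intro subspace_sub) auto
    ultimately have "sub v q = vzero H" using S by (auto simp: total_in_def)
    then have "v = q" using sub_zeroD vv qv by blast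
    have comb: "ip x v = (\<Sum>e\<in>S. cnj (ip v e) * ip x e)" if x: "x \<in> vecs H" for x
    proof -
      have "ip x v = cnj (ip v x)" by (rule ip_cnj[OF vv x])
      also have "ip v x = (\<Sum>e\<in>S. ip v e * ip e x)" using bspec[OF q(1) x] unfolding \<open>v = q\<close> .
      finally have "ip x v = (\<Sum>e\<in>S. cnj (ip v e) * cnj (ip e x))" by simp
      also have "\<dots> = (\<Sum>e\<in>S. cnj (ip v e) * ip x e)"
      proof (intro sum.cong refl)
        fix e assume "e \<in> S"
        then have "e \<in> vecs H" using S Fv by auto
        then show "cnj (ip v e) * cnj (ip e x) = cnj (ip v e) * ip x e" using ip_cnj[of e x] x by simp
      qed
      finally show ?thesis .
    qed
    show ?thesis unfolding comb[OF pv] comb[OF u] using p(2) by simp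
  qed
  then show ?thesis using p0 LF by auto
qed

lemma
  assumes F: "fin_dim_subspace H F" and u: "u \<in> vecs H"
  shows proj_in: "proj_onto H F u \<in> F"
    and proj_ip: "v \<in> F \<Longrightarrow> ip (proj_onto H F u) v = ip u v"
proof -
  have "\<exists>p. p \<in> F \<and> (\<forall>v\<in>F. ip p v = ip u v)" using proj_exists[OF F u] by blast
  then have "proj_onto H F u \<in> F \<and> (\<forall>v\<in>F. ip (proj_onto H F u) v = ip u v)"
    unfolding proj_onto_def by (rule someI_ex)
  then show "proj_onto H F u \<in> F" "v \<in> F \<Longrightarrow> ip (proj_onto H F u) v = ip u v" by auto
qed

lemma proj_unique:
  assumes F: "fin_dim_subspace H F" and u: "u \<in> vecs H"
    and p: "p \<in> F" "\<And>v. v \<in> F \<Longrightarrow> ip p v = ip u v"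
  shows "proj_onto H F u = p"
proof -
  have Fv: "F \<subseteq> vecs H" "lin_subspace H F"
    using F by (auto dest: fin_dim_subspaceD subspace_subset)
  let ?q = "proj_onto H F u"
  have q: "?q \<in> F" "\<And>v. v \<in> F \<Longrightarrow> ip ?q v = ip u v" using proj_in[OF F u] proj_ip[OF F u] by blast+
  have vs: "p \<in> vecs H" "?q \<in> vecs H" using p q Fv by auto
  show ?thesis
    by (rule ip_sub_self_eq_0) (use vs p q in \<open>simp_all add: ip_simps\<close>)
qed

text \<open>By Pythagoras no point of \<open>F\<close> is closer to \<open>v\<close> than the projection of \<open>v\<close>. If \<open>v\<close> is a limit of
  points of \<open>F\<close>, it therefore coincides with its projection.\<close>

lemma fin_dim_closed:
  assumes F: "fin_dim_subspace H F" shows "norm_closure H F = F"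
proof
  have Fv: "F \<subseteq> vecs H" "lin_subspace H F"
    using F by (auto dest: fin_dim_subspaceD subspace_subset)
  show "F \<subseteq> norm_closure H F"
  proof
    fix v assume v: "v \<in> F"
    then have "v \<in> vecs H" using Fv by auto
    then have "vdist H v v = 0" by (simp add: vdist_def Let_def ip_simps)
    then show "v \<in> norm_closure H F" using v \<open>v \<in> vecs H\<close> by (force simp: norm_closure_def)
  qed
  show "norm_closure H F \<subseteq> F"
  proof
    fix v assume "v \<in> norm_closure H F"
    then have v: "v \<in> vecs H" "\<And>e. e > 0 \<Longrightarrow> \<exists>w\<in>F. vdist H v w < e"
      by (auto simp: norm_closure_def)
    define p where "p = proj_onto H F v"
    have p: "p \<in> F" "\<And>w. w \<in> F \<Longrightarrow> ip p w = ip v w"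
      using proj_in[OF F v(1)] proj_ip[OF F v(1)] unfolding p_def by blast+
    have pv: "p \<in> vecs H" using p Fv by auto
    have le: "Re (ip (sub v p) (sub v p)) \<le> (vdist H v w)\<^sup>2" if w: "w \<in> F" for w
    proof -
      have wv: "w \<in> vecs H" using w Fv by auto
      obtain a where a: "ip p p = complex_of_real a" using ip_self[OF pv] by blast
      have vp: "ip v p = complex_of_real a" using p(2)[OF p(1)] a by simp
      have pv': "ip p v = complex_of_real a" unfolding ip_cnj[OF v(1) pv] vp by simp
      have wp: "ip w p = cnj (ip v w)" unfolding ip_cnj[OF pv wv] p(2)[OF w] ..
      have wv': "ip w v = cnj (ip v w)" by (rule ip_cnj[OF v(1) wv])
      note 1 = a vp pv' wp wv' p(2)[OF w]
      have "Re (ip (sub v w) (sub v w))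
          = Re (ip (sub v p) (sub v p)) + Re (ip (sub p w) (sub p w))"
        using wv v pv by (simp add: ip_simps 1)
      then show ?thesis
        using ip_pos[of "sub p w"] ip_pos[of "sub v w"] wv v pv
        by (simp add: vdist_def Let_def sub_in)
    qed
    have "Re (ip (sub v p) (sub v p)) \<le> 0"
    proof (rule field_le_epsilon)
      fix e :: real assume "e > 0"
      then obtain w where w: "w \<in> F" "vdist H v w < sqrt e" using v(2)[of "sqrt e"] by auto
      moreover have "vdist H v w \<ge> 0"
        using ip_pos[of "sub v w"] w Fv v by (auto simp: vdist_def Let_def sub_in)
      ultimately have "(vdist H v w)\<^sup>2 < (sqrt e)\<^sup>2" by (intro power_strict_mono) auto
      then show "Re (ip (sub v p) (sub v p)) \<le> 0 + e" using le[OF w(1)] \<open>e > 0\<close> by simp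
    qed
    then have "ip (sub v p) (sub v p) = 0"
      using ip_self[of "sub v p"] ip_pos[of "sub v p"] v pv by (simp add: sub_in)
    then have "v = p" using ip_definite v pv by blast
    then show "v \<in> F" using p by simp
  qed
qed

lemma closed_fin_dim: "fin_dim_subspace H F \<Longrightarrow> closed_subspace H F"
  by (simp add: closed_subspace_def fin_dim_closed fin_dim_subspaceD)

lemma orth_comp_subspace:
  "\<lbrakk>lin_subspace H F; S \<subseteq> vecs H\<rbrakk> \<Longrightarrow> lin_subspace H (orth_comp_in H F S)"
  by (auto simp: lin_subspace_def orth_comp_in_def subset_iff ip_simps)

lemma orth_comp_fin_dim:
  "\<lbrakk>fin_dim_subspace H F; S \<subseteq> vecs H\<rbrakk> \<Longrightarrow> fin_dim_subspace H (orth_comp_in H F S)"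
  by (rule fin_dim_subset[of H F], assumption, rule orth_comp_subspace[OF fin_dim_subspaceD])
     (auto simp: orth_comp_in_def)

text \<open>The residual of a vector of \<open>F\<close> after projection to the span of \<open>S\<close> is orthogonal to \<open>S\<close>.\<close>

lemma lin_span_total:
  assumes F: "fin_dim_subspace H F" and S: "S \<subseteq> F" "total_in H F S"
  shows "lin_span H S = F"
proof
  have Fv: "F \<subseteq> vecs H" "lin_subspace H F"
    using F by (auto dest: fin_dim_subspaceD subspace_subset)
  show le: "lin_span H S \<subseteq> F" using Fv S by (simp add: lin_span_least)
  have L: "fin_dim_subspace H (lin_span H S)"
    using fin_dim_subset[OF F _ le] lin_span_subspace S Fv by auto
  show "F \<subseteq> lin_span H S"
  proof
    fix u assume u: "u \<in> F"
    then have uv: "u \<in> vecs H" using Fv by auto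
    define p where "p = proj_onto H (lin_span H S) u"
    have p: "p \<in> lin_span H S" "\<And>w. w \<in> lin_span H S \<Longrightarrow> ip p w = ip u w"
      using proj_in[OF L uv] proj_ip[OF L uv] unfolding p_def by blast+
    have pv: "p \<in> F" "p \<in> vecs H" using p le Fv by auto
    have "ip (sub u p) s = 0" if "s \<in> S" for s
      using that p(2)[of s] lin_span_superset[of S] uv pv S Fv by (auto simp: ip_simps subset_iff)
    then have "sub u p = vzero H"
      using S subspace_sub[OF Fv(2) u pv(1)] by (auto simp: total_in_def)
    then have "u = p" using sub_zeroD uv pv(2) by blast
    then show "u \<in> lin_span H S" using p by simp
  qed
qed

lemma hilbert_sum_total:
  assumes "fin_dim_subspace H F" "(\<Union>i\<in>I. V i) \<subseteq> F" "total_in H F (\<Union>i\<in>I. V i)"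
  shows "hilbert_sum H I V = F"
  using lin_span_total[OF assms] fin_dim_closed[OF assms(1)] by (simp add: hilbert_sum_def)

lemma total_if_hilbert_sum:
  assumes F: "fin_dim_subspace H (vecs H)" and V: "(\<Union>i\<in>I. V i) \<subseteq> vecs H"
    and sum: "hilbert_sum H I V = vecs H"
  shows "total_in H (vecs H) (\<Union>i\<in>I. V i)"
  unfolding total_in_def
proof (intro ballI impI)
  fix u assume u: "u \<in> vecs H" "\<forall>s\<in>\<Union>i\<in>I. V i. ip u s = 0"
  let ?L = "lin_span H (\<Union>i\<in>I. V i)"
  have L: "lin_subspace H ?L" using V by (rule lin_span_subspace)
  then have "fin_dim_subspace H ?L" using F fin_dim_subset subspace_subset by blast
  then have "?L = vecs H" using sum fin_dim_closed by (simp add: hilbert_sum_def)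
  moreover have "?L \<subseteq> orth_comp_in H (vecs H) {u}"
  proof (rule lin_span_least)
    show "lin_subspace H (orth_comp_in H (vecs H) {u})"
      using orth_comp_subspace subspace_vecs u by simp
    have "ip s u = 0" if "s \<in> (\<Union>i\<in>I. V i)" for s
      using ip_cnj[of u s] that u V by auto
    then show "(\<Union>i\<in>I. V i) \<subseteq> orth_comp_in H (vecs H) {u}"
      using V by (auto simp: orth_comp_in_def)
  qed
  ultimately have "ip u u = 0" using u by (auto simp: orth_comp_in_def)
  then show "u = vzero H" using zero_iff u by simp
qed

text \<open>A complete orthonormal set of \<open>W\<close> is not complete in \<open>V\<close>, so it can be enlarged there.\<close>

lemma dimension_strict:
  assumes V: "fin_dim_subspace H V" and W: "lin_subspace H W" "W \<subset> V"
  shows "dimension H W < dimension H V"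
proof -
  have Vs: "V \<subseteq> vecs H" "lin_subspace H V"
    using V by (auto dest: fin_dim_subspaceD subspace_subset)
  have Wf: "fin_dim_subspace H W" using fin_dim_subset[OF V W(1)] W(2) by auto
  obtain S where S: "orthonormal H S" "S \<subseteq> W" "total_in H W S" "card S = dimension H W"
    by (rule fin_dim_onb[OF Wf])
  have nt: "\<not> total_in H V S"
    using lin_span_total[OF V, of S] lin_span_total[OF Wf, of S] S W by auto
  have Sv: "S \<subseteq> vecs H" using S W Vs by auto
  let ?K = "orth_comp_in H V S"
  obtain u where u: "u \<in> ?K" "u \<noteq> vzero H" using nt by (auto simp: total_in_def orth_comp_in_def)
  have Kf: "fin_dim_subspace H ?K" using V Sv by (rule orth_comp_fin_dim)
  obtain B where B: "orthonormal H B" "B \<subseteq> ?K" "total_in H ?K B" by (rule fin_dim_onb[OF Kf])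
  have "B \<noteq> {}" using B u by (auto simp: total_in_def)
  then obtain e where e: "e \<in> B" by auto
  have eV: "e \<in> V" "\<forall>s\<in>S. ip e s = 0" "ip e e = 1" "e \<in> vecs H"
    using e B Vs by (auto simp: orth_comp_in_def orthonormal_def)
  have "e \<notin> S" using eV by auto
  moreover have "\<forall>s\<in>S. ip s e = 0"
  proof
    fix s assume s: "s \<in> S"
    then have "ip s e = cnj (ip e s)" using Sv eV(4) by (intro ip_cnj) auto
    then show "ip s e = 0" using eV s by simp
  qed
  ultimately have on: "orthonormal H (insert e S)" "card (insert e S) = Suc (card S)"
    using eV S by (auto simp: orthonormal_def)
  let ?P = "\<lambda>n. \<exists>S. orthonormal H S \<and> S \<subseteq> V \<and> card S = n"
  obtain d where d: "\<And>y. ?P y \<Longrightarrow> y \<le> d" using V by (auto simp: fin_dim_subspace_def)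
  have P: "?P (Suc (card S))" using on eV S W by (intro exI[of _ "insert e S"]) auto
  have "Suc (card S) \<le> dimension H V"
    unfolding dimension_def by (rule Greatest_le_nat[of ?P, OF P d])
  then show ?thesis using S by simp
qed

text \<open>Double counting: the sum of \<open>\<bar>\<langle>s, e\<rangle>\<bar>\<^sup>2\<close> over \<open>s \<in> S\<close> and \<open>e \<in> E\<close> is \<open>card S\<close> by Parseval's
  identity for each \<open>s\<close>, and at most \<open>card E\<close> by Bessel's inequality for each \<open>e\<close>.\<close>

lemma fin_dim_if_onb:
  assumes F: "lin_subspace H F" and E: "orthonormal H E" "E \<subseteq> F" "total_in H F E"
  shows "fin_dim_subspace H F"
proof -
  have Fv: "F \<subseteq> vecs H" using F by (rule subspace_subset)
  have finE: "finite E" and Ev: "E \<subseteq> vecs H" using E by (auto simp: orthonormal_def)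
  \<comment> \<open>The norm of the residual of an expansion: it vanishes in Parseval's identity, and its positivity
    is Bessel's inequality.\<close>
  have ex: "\<exists>p\<in>lin_span H S. (\<forall>s\<in>S. ip p s = ip x s) \<and>
      Re (ip (sub x p) (sub x p)) = Re (ip x x) - (\<Sum>e\<in>S. (cmod (ip x e))\<^sup>2)"
    if S: "orthonormal H S" and x: "x \<in> vecs H" for S x
  proof -
    have fin: "finite S" and Sv: "S \<subseteq> vecs H" using S by (auto simp: orthonormal_def)
    obtain p where p: "p \<in> lin_span H S" "p \<in> vecs H"
      "\<forall>w\<in>vecs H. ip p w = (\<Sum>e\<in>S. ip x e * ip e w)"
      and pf: "\<forall>f\<in>S. ip p f = ip x f"
      using orthonormal_combination[OF S, of x] by blast
    have sq: "ip x e * ip e y = complex_of_real ((cmod (ip x e))\<^sup>2)"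
      if "e \<in> S" "ip y e = ip x e" "y \<in> vecs H" for e y
    proof -
      have "e \<in> vecs H" using that(1) Sv by auto
      then have "ip e y = cnj (ip x e)" using ip_cnj[OF that(3), of e] that(2) by simp
      then show ?thesis by (simp only: complex_norm_square)
    qed
    have pp: "ip p p = complex_of_real (\<Sum>e\<in>S. (cmod (ip x e))\<^sup>2)"
      using p(2,3) sq pf by (simp cong: sum.cong)
    have px: "ip p x = complex_of_real (\<Sum>e\<in>S. (cmod (ip x e))\<^sup>2)"
      using p(2,3) sq x by (simp cong: sum.cong)
    then have xp: "ip x p = complex_of_real (\<Sum>e\<in>S. (cmod (ip x e))\<^sup>2)"
      using ip_cnj[of p x] p x by simp
    show ?thesis
      using p pf x by (intro bexI[of _ p]) (auto simp: ip_simps pp px xp)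
  qed
  have "card S \<le> card E" if S: "orthonormal H S" "S \<subseteq> F" for S
  proof -
    have fin: "finite S" and Sv: "S \<subseteq> vecs H" using S by (auto simp: orthonormal_def)
    have parseval: "(\<Sum>e\<in>E. (cmod (ip s e))\<^sup>2) = 1" if s: "s \<in> S" for s
    proof -
      have sv: "s \<in> vecs H" "s \<in> F" "ip s s = 1" using s S by (auto simp: orthonormal_def)
      obtain p where p: "p \<in> lin_span H E" "\<forall>e\<in>E. ip p e = ip s e"
        "Re (ip (sub s p) (sub s p)) = Re (ip s s) - (\<Sum>e\<in>E. (cmod (ip s e))\<^sup>2)"
        using ex[OF E(1) sv(1)] by blast
      have pF: "p \<in> F" "p \<in> vecs H" using p lin_span_least[OF F E(2)] Fv by auto
      have "ip (sub s p) e = 0" if "e \<in> E" for e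
        using that p pF sv Ev by (auto simp: ip_simps subset_iff)
      then have "sub s p = vzero H"
        using subspace_sub[OF F sv(2) pF(1)] E by (auto simp: total_in_def)
      then have "ip (sub s p) (sub s p) = 0" using ip_zero zero_in by simp
      then show ?thesis using p(3) sv by simp
    qed
    have bessel: "(\<Sum>s\<in>S. (cmod (ip e s))\<^sup>2) \<le> 1" if e: "e \<in> E" for e
    proof -
      have ev: "e \<in> vecs H" "ip e e = 1" using e E by (auto simp: orthonormal_def)
      obtain p where p: "p \<in> lin_span H S"
        "Re (ip (sub e p) (sub e p)) = Re (ip e e) - (\<Sum>s\<in>S. (cmod (ip e s))\<^sup>2)"
        using ex[OF S(1) ev(1)] by blast
      have "p \<in> vecs H" using p lin_span_subspace[OF Sv] subspace_subset by blast
      then show ?thesis using p(2) ip_pos[of "sub e p"] ev sub_in by simp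
    qed
    have "real (card S) = (\<Sum>s\<in>S. \<Sum>e\<in>E. (cmod (ip s e))\<^sup>2)" by (simp add: parseval)
    also have "\<dots> = (\<Sum>e\<in>E. \<Sum>s\<in>S. (cmod (ip s e))\<^sup>2)" by (rule sum.swap)
    also have "\<dots> = (\<Sum>e\<in>E. \<Sum>s\<in>S. (cmod (ip e s))\<^sup>2)"
    proof (intro sum.cong refl)
      fix e s assume "e \<in> E" "s \<in> S"
      then have "ip s e = cnj (ip e s)" using Sv Ev by (intro ip_cnj) auto
      then show "(cmod (ip s e))\<^sup>2 = (cmod (ip e s))\<^sup>2" by simp
    qed
    also have "\<dots> \<le> (\<Sum>e\<in>E. 1)" by (intro sum_mono bessel)
    finally show ?thesis by simp
  qed
  then show ?thesis using F by (auto simp: fin_dim_subspace_def)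
qed

lemma fin_dim_subset_vecs: "fin_dim_subspace H F \<Longrightarrow> F \<subseteq> vecs H"
  by (simp add: fin_dim_subspace_def lin_subspace_def)

lemma orthogonal_sets_sym:
  assumes "A \<subseteq> vecs H" "B \<subseteq> vecs H" "orthogonal_sets H A B"
  shows "orthogonal_sets H B A"
  unfolding orthogonal_sets_def
proof (intro ballI)
  fix u v assume "u \<in> B" "v \<in> A"
  then have "ip v u = 0" "u \<in> vecs H" "v \<in> vecs H"
    using assms by (auto simp: orthogonal_sets_def)
  with ip_cnj[of v u] show "ip u v = 0" by simp
qed

lemma proj_linear:
  assumes F: "fin_dim_subspace H F"
  shows "\<lbrakk>u \<in> vecs H; v \<in> vecs H\<rbrakk> \<Longrightarrow> proj_onto H F (vadd H u v) = vadd H (proj_onto H F u) (proj_onto H F v)"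
    and "u \<in> vecs H \<Longrightarrow> proj_onto H F (vscale H c u) = vscale H c (proj_onto H F u)"
proof -
  have Fv: "F \<subseteq> vecs H" "lin_subspace H F"
    using F by (auto dest: fin_dim_subspaceD subspace_subset)
  have pin: "x \<in> vecs H \<Longrightarrow> proj_onto H F x \<in> vecs H" for x using proj_in[OF F] Fv by auto
  have vv: "v \<in> F \<Longrightarrow> v \<in> vecs H" for v using Fv by auto
  show "proj_onto H F (vadd H u v) = vadd H (proj_onto H F u) (proj_onto H F v)"
    if "u \<in> vecs H" "v \<in> vecs H"
  proof (rule proj_unique[OF F])
    show "vadd H (proj_onto H F u) (proj_onto H F v) \<in> F"
      using that Fv(2) proj_in[OF F] by (simp add: lin_subspace_def)
  qed (use that in \<open>simp_all add: ip_simps pin vv proj_ip[OF F]\<close>)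
  show "proj_onto H F (vscale H c u) = vscale H c (proj_onto H F u)" if "u \<in> vecs H"
  proof (rule proj_unique[OF F])
    show "vscale H c (proj_onto H F u) \<in> F"
      using that Fv(2) proj_in[OF F] by (simp add: lin_subspace_def)
  qed (use that in \<open>simp_all add: ip_simps pin vv proj_ip[OF F]\<close>)
qed

text \<open>The degenerate case of the Cauchy-Schwarz inequality. With \<open>z = Q u v\<close>, the value of the form at
  \<open>v + t * cnj z * u\<close> is \<open>Q v v + 2 * t * \<bar>z\<bar>\<^sup>2\<close>, which is nonnegative for all real \<open>t\<close> only if \<open>z = 0\<close>.\<close>

lemma psd_null:
  assumes V: "lin_subspace H V"
    and lin: "\<And>v. v \<in> V \<Longrightarrow> linear_form H V (\<lambda>u. Q u v)"
    and herm: "\<And>u v. \<lbrakk>u \<in> V; v \<in> V\<rbrakk> \<Longrightarrow> Q v u = cnj (Q u v)"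
    and pos: "\<And>u. u \<in> V \<Longrightarrow> 0 \<le> Re (Q u u)"
    and u: "u \<in> V" "Q u u = 0" and v: "v \<in> V"
  shows "Q u v = 0"
proof (rule ccontr)
  assume z: "Q u v \<noteq> 0"
  define z where "z = Q u v"
  have zpos: "(cmod z)\<^sup>2 > 0" using z by (simp add: z_def)
  \<comment> \<open>The value of \<open>t\<close> that makes the form equal to \<open>-1\<close>.\<close>
  define t where "t = - (Re (Q v v) + 1) / (2 * (cmod z)\<^sup>2)"
  define s where "s = complex_of_real t * cnj z"
  have su: "vscale H s u \<in> V" using V u by (simp add: lin_subspace_def)
  have w: "vadd H v (vscale H s u) \<in> V" using V v su by (simp add: lin_subspace_def)
  have addl: "Q (vadd H a b) c = Q a c + Q b c" and scl: "Q (vscale H d a) c = d * Q a c"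
    if "a \<in> V" "b \<in> V" "c \<in> V" for a b c d
    using lin[OF that(3)] that by (auto simp: linear_form_def)
  have Qvu: "Q v u = cnj z" using herm[OF u(1) v] by (simp add: z_def)
  have Qsv: "Q (vscale H s u) v = s * z" using scl[OF u(1) u(1) v] by (simp add: z_def)
  have Qsu: "Q (vscale H s u) u = 0" using scl[OF u(1) u(1) u(1)] u by simp
  have Qvs: "Q v (vscale H s u) = cnj (s * z)" using herm[OF su v] Qsv by simp
  have Quss: "Q u (vscale H s u) = 0" using herm[OF su u(1)] Qsu by simp
  have Qss: "Q (vscale H s u) (vscale H s u) = 0" using scl[OF u(1) u(1) su] Quss by simp
  have Qw: "Q (vadd H v (vscale H s u)) (vadd H v (vscale H s u)) = Q v v + s * z + cnj (s * z)"
  proof -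
    have 1: "Q (vadd H v (vscale H s u)) v = Q v v + s * z" using addl[OF v su v] Qsv by simp
    have 2: "Q (vadd H v (vscale H s u)) (vscale H s u) = cnj (s * z)"
      using addl[OF v su su] Qvs Qss by simp
    have 3: "Q v (vadd H v (vscale H s u)) = cnj (Q v v + s * z)" using herm[OF w v] 1 by simp
    have 4: "Q (vscale H s u) (vadd H v (vscale H s u)) = s * z" using herm[OF w su] 2 by simp
    have 5: "cnj (Q v v) = Q v v" using herm[OF v v] by simp
    show ?thesis using addl[OF v su w] 3 4 5 by simp
  qed
  have sz: "s * z = complex_of_real (t * (cmod z)\<^sup>2)"
    unfolding s_def of_real_mult complex_norm_square by simp
  have "Re (Q v v) + 2 * (t * (cmod z)\<^sup>2) \<ge> 0"
    using pos[OF w] unfolding Qw sz by simp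
  moreover have "2 * (t * (cmod z)\<^sup>2) = - (Re (Q v v) + 1)"
    unfolding t_def using zpos by (simp add: field_simps)
  ultimately show False by linarith
qed

text \<open>A Hermitian form on a finite-dimensional space attains its maximum over the unit sphere, by
  compactness of the sphere in coordinates.\<close>

lemma sphere_max:
  assumes V: "fin_dim_subspace H V" and nz: "V \<noteq> {vzero H}"
    and lin: "\<And>v. v \<in> V \<Longrightarrow> linear_form H V (\<lambda>u. Q u v)"
    and herm: "\<And>u v. \<lbrakk>u \<in> V; v \<in> V\<rbrakk> \<Longrightarrow> Q v u = cnj (Q u v)"
  shows "\<exists>x\<in>V. ip x x = 1 \<and> (\<forall>u\<in>V. Re (Q u u) \<le> Re (Q x x) * Re (ip u u))"
proof -
  have Vs: "V \<subseteq> vecs H" "lin_subspace H V"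
    using V by (auto dest: fin_dim_subspaceD subspace_subset)
  obtain E where E: "orthonormal H E" "E \<subseteq> V" "total_in H V E" by (rule fin_dim_onb[OF V])
  have fin: "finite E" and Ev: "E \<subseteq> vecs H" using E by (auto simp: orthonormal_def)
  have "E \<noteq> {}" using E(3) nz Vs by (auto simp: total_in_def lin_subspace_def)
  then obtain e0 where e0: "e0 \<in> E" by auto
  define f where "f P c = (\<Sum>e\<in>E. \<Sum>e'\<in>E. c e * cnj (c e') * P e e')"
    for P :: "'v \<Rightarrow> 'v \<Rightarrow> complex" and c :: "'v \<Rightarrow> complex"
  have form: "P p p = f P c"
    if p: "p \<in> V" "\<forall>L. linear_form H V L \<longrightarrow> L p = (\<Sum>e\<in>E. c e * L e)"
      and P: "\<And>v. v \<in> V \<Longrightarrow> linear_form H V (\<lambda>u. P u v)"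
        "\<And>u v. \<lbrakk>u \<in> V; v \<in> V\<rbrakk> \<Longrightarrow> P v u = cnj (P u v)" for P p c
  proof -
    have Pp: "P p v = (\<Sum>e\<in>E. c e * P e v)" if "v \<in> V" for v
      using p(2) P(1)[OF that] by auto
    have "P p p = (\<Sum>e\<in>E. c e * P e p)" by (rule Pp[OF p(1)])
    also have "\<dots> = (\<Sum>e\<in>E. \<Sum>e'\<in>E. c e * cnj (c e') * P e e')"
    proof (intro sum.cong refl)
      fix e assume "e \<in> E"
      then have e: "e \<in> V" using E by auto
      have "P e p = cnj (\<Sum>e'\<in>E. c e' * P e' e)" using P(2)[OF p(1) e] Pp[OF e] by simp
      also have "\<dots> = (\<Sum>e'\<in>E. cnj (c e') * P e e')"
        unfolding cnj_sum complex_cnj_mult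
      proof (intro sum.cong refl)
        fix e' assume "e' \<in> E"
        then have e': "e' \<in> V" using E by auto
        show "cnj (c e') * cnj (P e' e) = cnj (c e') * P e e'" using P(2)[OF e' e] by simp
      qed
      finally show "c e * P e p = (\<Sum>e'\<in>E. c e * cnj (c e') * P e e')"
        by (simp add: sum_distrib_left mult.assoc)
    qed
    finally show ?thesis by (simp add: f_def)
  qed
  have ip_lin: "v \<in> V \<Longrightarrow> linear_form H V (\<lambda>u. ip u v)"
    and ip_herm: "\<lbrakk>u \<in> V; v \<in> V\<rbrakk> \<Longrightarrow> ip v u = cnj (ip u v)" for u v
    using linear_form_ip[OF Vs(1)] Vs(1) by (blast intro: ip_cnj)+
  have f_ip: "f ip c = complex_of_real (\<Sum>e\<in>E. (cmod (c e))\<^sup>2)" for c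
  proof -
    have "f ip c = (\<Sum>e\<in>E. \<Sum>e'\<in>E. if e = e' then c e * cnj (c e) else 0)"
      unfolding f_def by (intro sum.cong refl) (use E(1) in \<open>auto simp: orthonormal_def\<close>)
    also have "\<dots> = (\<Sum>e\<in>E. c e * cnj (c e))" using fin by simp
    finally show ?thesis by (simp only: of_real_sum complex_norm_square)
  qed
  \<comment> \<open>The coordinates of unit vectors, inside a product of discs indexed by all of \<open>'v\<close>; confining
    the coordinates outside \<open>E\<close> to the disc as well makes Tychonoff's theorem applicable.\<close>
  define K where "K = {c :: 'v \<Rightarrow> complex. \<forall>e. c e \<in> cball 0 1} \<inter>
    {c. (\<Sum>e\<in>E. (cmod (c e))\<^sup>2) = 1}"
  have "compact (Pi\<^sub>E UNIV (\<lambda>_::'v. cball (0::complex) 1))"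
    by (metis compactin_euclidean_iff compactin_PiE compact_cball euclidean_product_topology)
  moreover have "Pi\<^sub>E UNIV (\<lambda>_::'v. cball (0::complex) 1) = {c. \<forall>e. c e \<in> cball 0 1}" by auto
  moreover have "closed {c :: 'v \<Rightarrow> complex. (\<Sum>e\<in>E. (cmod (c e))\<^sup>2) = 1}"
    by (intro closed_Collect_eq continuous_intros continuous_on_product_coordinates)
  ultimately have "compact K" unfolding K_def by (simp add: compact_Int_closed)
  moreover have "(\<lambda>e. if e = e0 then 1 else 0) \<in> K"
    using e0 fin by (simp add: K_def if_distrib[of cmod] if_distrib[of "\<lambda>x. x\<^sup>2"] cong: if_cong)
  moreover have "continuous_on UNIV (\<lambda>c. Re (f Q c))"
    unfolding f_def by (intro continuous_intros continuous_on_product_coordinates)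
  then have "continuous_on K (\<lambda>c. Re (f Q c))" by (rule continuous_on_subset) simp
  ultimately obtain c0 where c0: "c0 \<in> K" "\<And>c. c \<in> K \<Longrightarrow> Re (f Q c) \<le> Re (f Q c0)"
    using continuous_attains_sup[of K "\<lambda>c. Re (f Q c)"] by blast
  obtain x where x: "x \<in> V" "\<forall>L. linear_form H V L \<longrightarrow> L x = (\<Sum>e\<in>E. c0 e * L e)"
    using lincomb_exists[OF Vs(2) fin E(2)] by blast
  have s0: "(\<Sum>e\<in>E. (cmod (c0 e))\<^sup>2) = 1" using c0(1) by (simp add: K_def)
  have x1: "ip x x = 1" using form[OF x ip_lin ip_herm] unfolding f_ip s0 by simp
  have Qx: "Q x x = f Q c0" by (rule form[OF x lin herm])
  have unit: "Re (Q u u) \<le> Re (Q x x)" if u: "u \<in> V" "ip u u = 1" for u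
  proof -
    define c where "c e = (if e \<in> E then ip u e else 0)" for e
    obtain p where p: "p \<in> V" "\<forall>L. linear_form H V L \<longrightarrow> L p = (\<Sum>e\<in>E. c e * L e)"
      using lincomb_exists[OF Vs(2) fin E(2)] by blast
    have uv: "u \<in> vecs H" "p \<in> vecs H" using u p Vs by auto
    have "ip p e = ip u e" if e: "e \<in> E" for e
    proof -
      have "linear_form H V (\<lambda>u. ip u e)" using ip_lin e E(2) by blast
      then have "ip p e = (\<Sum>e'\<in>E. c e' * ip e' e)" using p(2) by blast
      also have "\<dots> = (\<Sum>e'\<in>E. if e' = e then ip u e else 0)"
        by (rule sum.cong) (use E(1) e in \<open>auto simp: c_def orthonormal_def\<close>)
      finally show ?thesis using fin e by simp
    qed
    then have "ip (sub u p) e = 0" if "e \<in> E" for e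
      using that uv Ev by (simp add: ip_simps subset_iff)
    then have "sub u p = vzero H"
      using E(3) subspace_sub[OF Vs(2) u(1) p(1)] by (auto simp: total_in_def)
    then have up: "u = p" using uv by (rule sub_zeroD)
    have "f ip c = 1" using form[OF p ip_lin ip_herm] u(2) up by simp
    then have s1: "(\<Sum>e\<in>E. (cmod (c e))\<^sup>2) = 1" unfolding f_ip by (simp flip: of_real_sum)
    have "cmod (c e) \<le> 1" for e
    proof (cases "e \<in> E")
      case True
      then have "(cmod (c e))\<^sup>2 \<le> (\<Sum>e\<in>E. (cmod (c e))\<^sup>2)" using fin by (intro member_le_sum) auto
      then show ?thesis unfolding s1 by (simp add: power_le_one_iff abs_square_le_1)
    qed (simp add: c_def)
    then have "c \<in> K" using s1 by (simp add: K_def)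
    then show ?thesis using c0(2) form[OF p lin herm] Qx up by simp
  qed
  have "Re (Q u u) \<le> Re (Q x x) * Re (ip u u)" if u: "u \<in> V" for u
  proof (cases "u = vzero H")
    case True
    have "Q (vscale H 0 u) u = 0" using lin[OF u] u by (simp add: linear_form_def)
    then show ?thesis using True u Vs by (simp add: scale_zero zero_in ip_zero)
  next
    case False
    have uv: "u \<in> vecs H" using u Vs by auto
    define r where "r = Re (ip u u)"
    have r: "ip u u = complex_of_real r" using ip_self[OF uv] by (simp add: r_def)
    have "r \<noteq> 0" using False zero_iff[OF uv] r by auto
    then have rpos: "r > 0" using ip_pos[OF uv] by (simp add: r_def)
    define d where "d = complex_of_real (1 / sqrt r)"
    have dd: "d * d = complex_of_real (1 / r)"
      unfolding d_def of_real_mult[symmetric] using rpos by simp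
    have dV: "vscale H d u \<in> V" using Vs u by (simp add: lin_subspace_def)
    have scl: "P (vscale H d u) (vscale H d u) = d * d * P u u"
      if P: "\<And>v. v \<in> V \<Longrightarrow> linear_form H V (\<lambda>u. P u v)"
        "\<And>u v. \<lbrakk>u \<in> V; v \<in> V\<rbrakk> \<Longrightarrow> P v u = cnj (P u v)" for P
    proof -
      have 1: "P (vscale H d u) v = d * P u v" if "v \<in> V" for v
        using P(1)[OF that] u by (simp add: linear_form_def)
      have 2: "cnj (P u u) = P u u" using P(2)[OF u u] by simp
      have "P u (vscale H d u) = d * P u u"
        using P(2)[OF dV u] 1[OF u] 2 by (simp add: d_def)
      then show ?thesis using 1[OF dV] by simp
    qed
    have "ip (vscale H d u) (vscale H d u) = 1"
      using scl[OF ip_lin ip_herm] rpos by (simp add: dd r flip: of_real_mult)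
    then have "Re (d * d * Q u u) \<le> Re (Q x x)" using unit[OF dV] scl[OF lin herm] by simp
    then show ?thesis using rpos unfolding dd r_def[symmetric] by (simp add: field_simps)
  qed
  then show ?thesis using x(1) x1 by blast
qed

end

section \<open>Unitary representations and their irreducible subspaces\<close>

text \<open>Since \<open>act R g\<close> is isometric and has \<open>act R (inv g)\<close> as a right inverse, the latter is its adjoint
  (\<open>act_adjoint\<close>); linearity of the action follows from this.\<close>

locale unitary_rep = group G + ip_space R
  for G :: "('a, 'b) monoid_scheme" (structure) and R :: "('a, 'v) rep" +
  assumes act_in: "\<lbrakk>g \<in> carrier G; u \<in> vecs R\<rbrakk> \<Longrightarrow> act R g u \<in> vecs R"
    and act_ip: "\<lbrakk>g \<in> carrier G; u \<in> vecs R; v \<in> vecs R\<rbrakk>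
      \<Longrightarrow> vinner R (act R g u) (act R g v) = vinner R u v"
    and act_inv: "\<lbrakk>g \<in> carrier G; u \<in> vecs R\<rbrakk> \<Longrightarrow> act R g (act R (inv g) u) = u"

text \<open>All subspaces of a finite-dimensional space are closed, so for finite-dimensional \<open>V\<close> this is
  irreducibility of the representation on \<open>V\<close> (\<open>irreducible_subspaceI\<close>, \<open>irreducible_subspaceD\<close>).\<close>

definition irreducible_subspace :: "('a, 'b) monoid_scheme \<Rightarrow> ('a, 'v) rep \<Rightarrow> 'v set \<Rightarrow> bool" where
  "irreducible_subspace G R V \<longleftrightarrow> fin_dim_subspace R V \<and> invariant G R V \<and> V \<noteq> {vzero R} \<and>
     (\<forall>W. lin_subspace R W \<and> W \<subseteq> V \<and> invariant G R W \<longrightarrow> W = {vzero R} \<or> W = V)"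

definition intertwiner ::
  "('a, 'b) monoid_scheme \<Rightarrow> ('a, 'v) rep \<Rightarrow> 'v set \<Rightarrow> ('a, 'w) rep \<Rightarrow> 'w set \<Rightarrow> ('v \<Rightarrow> 'w) \<Rightarrow> bool"
where
  "intertwiner G R A S B T \<longleftrightarrow> (\<forall>u\<in>A. T u \<in> B) \<and>
     (\<forall>u\<in>A. \<forall>v\<in>A. T (vadd R u v) = vadd S (T u) (T v)) \<and>
     (\<forall>c. \<forall>u\<in>A. T (vscale R c u) = vscale S c (T u)) \<and>
     (\<forall>g\<in>carrier G. \<forall>u\<in>A. T (act R g u) = act S g (T u))"

definition orthogonal_irreducibles ::
  "('a, 'b) monoid_scheme \<Rightarrow> ('a, 'v) rep \<Rightarrow> 'v set \<Rightarrow> 'i set \<Rightarrow> ('i \<Rightarrow> 'v set) \<Rightarrow> bool" where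
  "orthogonal_irreducibles G R A I V \<longleftrightarrow> fin_dim_subspace R A \<and> invariant G R A \<and> finite I \<and>
     (\<forall>i\<in>I. irreducible_subspace G R (V i) \<and> V i \<subseteq> A) \<and>
     (\<forall>i\<in>I. \<forall>j\<in>I. i \<noteq> j \<longrightarrow> orthogonal_sets R (V i) (V j)) \<and>
     total_in R A (\<Union>i\<in>I. V i)"

text \<open>The summands found so far in an orthogonal decomposition of \<open>F\<close>, in the order of their choice.
  Lists are used because they can be extended at the end.\<close>

definition irreducible_list ::
  "('a, 'b) monoid_scheme \<Rightarrow> ('a, 'v) rep \<Rightarrow> 'v set \<Rightarrow> 'v set list \<Rightarrow> bool" where
  "irreducible_list G R F xs \<longleftrightarrow> (\<forall>V\<in>set xs. irreducible_subspace G R V \<and> V \<subseteq> F) \<and>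
     sorted_wrt (orthogonal_sets R) xs"

lemma subrep_simps [simp]:
  "vecs (subrep R V) = V" "vzero (subrep R V) = vzero R" "vadd (subrep R V) = vadd R"
  "vscale (subrep R V) = vscale R" "vinner (subrep R V) = vinner R" "act (subrep R V) = act R"
  by (simp_all add: subrep_def)

lemma lin_subspace_subrep:
  "V \<subseteq> vecs R \<Longrightarrow> lin_subspace (subrep R V) W \<longleftrightarrow> lin_subspace R W \<and> W \<subseteq> V"
  by (auto simp: lin_subspace_def)

lemma norm_closure_subrep:
  "V \<subseteq> vecs R \<Longrightarrow> norm_closure (subrep R V) W = norm_closure R W \<inter> V"
  by (auto simp: norm_closure_def vdist_def)

lemma invariant_subrep: "invariant G (subrep R V) W \<longleftrightarrow> invariant G R W"
  by (simp add: invariant_def)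

context unitary_rep
begin

lemma act_adjoint:
  assumes "g \<in> carrier G" "u \<in> vecs R" "w \<in> vecs R"
  shows "ip (act R g u) w = ip u (act R (inv g) w)"
  using act_ip[of g u "act R (inv g) w"] act_inv[of g w] assms by (simp add: act_in)

lemma act_add: "\<lbrakk>g \<in> carrier G; u \<in> vecs R; v \<in> vecs R\<rbrakk>
    \<Longrightarrow> act R g (vadd R u v) = vadd R (act R g u) (act R g v)"
  by (rule vec_eqI) (simp_all add: act_in ip_simps act_adjoint)

lemma act_scale: "\<lbrakk>g \<in> carrier G; u \<in> vecs R\<rbrakk> \<Longrightarrow> act R g (vscale R c u) = vscale R c (act R g u)"
  by (rule vec_eqI) (simp_all add: act_in ip_simps act_adjoint)

lemma invariant_vecs: "invariant G R (vecs R)"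
  by (simp add: invariant_def act_in)

lemma invariant_orth_comp:
  assumes "invariant G R F" "F \<subseteq> vecs R" "invariant G R S" "S \<subseteq> vecs R"
  shows "invariant G R (orth_comp_in R F S)"
  using assms by (auto simp: invariant_def orth_comp_in_def subset_iff act_adjoint)

lemma proj_act:
  assumes F: "fin_dim_subspace R F" and inv: "invariant G R F"
    and g: "g \<in> carrier G" and u: "u \<in> vecs R"
  shows "proj_onto R F (act R g u) = act R g (proj_onto R F u)"
proof (rule proj_unique[OF F])
  have Fv: "F \<subseteq> vecs R" using F by (rule fin_dim_subset_vecs)
  have p: "proj_onto R F u \<in> F" using proj_in[OF F u] .
  show "act R g u \<in> vecs R" using g u by (rule act_in)
  show "act R g (proj_onto R F u) \<in> F" using inv g p by (simp add: invariant_def)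
  fix v assume v: "v \<in> F"
  then have "act R (inv g) v \<in> F" using inv g by (simp add: invariant_def)
  then show "ip (act R g (proj_onto R F u)) v = ip (act R g u) v"
    using v p Fv g u by (simp add: act_adjoint subset_iff proj_ip[OF F u])
qed

lemma irreducible_subspaceI:
  assumes V: "fin_dim_subspace R V" and inv: "invariant G R V" and irr: "irreducible_rep G (subrep R V)"
  shows "irreducible_subspace G R V"
proof -
  have Vv: "V \<subseteq> vecs R" using V by (rule fin_dim_subset_vecs)
  have "W = {vzero R} \<or> W = V" if W: "lin_subspace R W" "W \<subseteq> V" "invariant G R W" for W
  proof -
    have "norm_closure R W = W" using fin_dim_closed fin_dim_subset[OF V W(1,2)] by blast
    then have "closed_subspace (subrep R V) W"
      using W by (auto simp: closed_subspace_def lin_subspace_subrep[OF Vv] norm_closure_subrep[OF Vv])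
    then show ?thesis using irr W by (auto simp: irreducible_rep_def invariant_subrep)
  qed
  then show ?thesis using V inv irr by (simp add: irreducible_subspace_def irreducible_rep_def)
qed

lemma irreducible_subspaceD:
  assumes "irreducible_subspace G R V"
  shows "closed_subspace R V" "invariant G R V" "irreducible_rep G (subrep R V)"
proof -
  have V: "fin_dim_subspace R V" "V \<subseteq> vecs R"
    using assms fin_dim_subset_vecs by (auto simp: irreducible_subspace_def)
  show "closed_subspace R V" using V(1) by (rule closed_fin_dim)
  show "invariant G R V" using assms by (simp add: irreducible_subspace_def)
  show "irreducible_rep G (subrep R V)"
    using assms unfolding irreducible_rep_def irreducible_subspace_def
    by (simp add: closed_subspace_def lin_subspace_subrep[OF V(2)] invariant_subrep)
qed

lemma finite_dim_subrep:
  assumes V: "fin_dim_subspace R V" shows "finite_dim (subrep R V)"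
proof -
  have Vs: "V \<subseteq> vecs R" "lin_subspace R V"
    using V by (auto dest: fin_dim_subspaceD subspace_subset)
  obtain E where E: "orthonormal R E" "E \<subseteq> V" "total_in R V E" by (rule fin_dim_onb[OF V])
  have span: "lin_span R E = V" using lin_span_total[OF V E(2,3)] .
  have "lin_span (subrep R V) E = V"
  proof
    show "lin_span (subrep R V) E \<subseteq> V"
      unfolding lin_span_def using E(2) Vs lin_subspace_subrep[OF Vs(1)] by auto
    show "V \<subseteq> lin_span (subrep R V) E"
      unfolding lin_span_def lin_subspace_subrep[OF Vs(1)]
      using span unfolding lin_span_def by blast
  qed
  then show ?thesis using E by (auto simp: finite_dim_def orthonormal_def)
qed

text \<open>A nonzero invariant subspace of least dimension is irreducible.\<close>

lemma irreducible_exists: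
  assumes F: "fin_dim_subspace R F" and inv: "invariant G R F" and nz: "F \<noteq> {vzero R}"
  obtains V where "irreducible_subspace G R V" "V \<subseteq> F"
proof -
  let ?P = "\<lambda>V. lin_subspace R V \<and> V \<subseteq> F \<and> invariant G R V \<and> V \<noteq> {vzero R}"
  have "?P F" using F inv nz by (simp add: fin_dim_subspace_def)
  then have "\<exists>V. ?P V \<and> (\<forall>W. ?P W \<longrightarrow> dimension R V \<le> dimension R W)"
    by (rule ex_has_least_nat[where P = ?P and m = "dimension R"])
  then obtain V where V: "?P V" and min: "\<forall>W. ?P W \<longrightarrow> dimension R V \<le> dimension R W"
    by blast
  have Vf: "fin_dim_subspace R V" using fin_dim_subset[OF F] V by blast
  have "W = {vzero R} \<or> W = V" if "lin_subspace R W" "W \<subseteq> V" "invariant G R W" for W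
  proof (rule ccontr)
    assume "\<not> (W = {vzero R} \<or> W = V)"
    then have "?P W" "W \<subset> V" using that V by auto
    then show False using min dimension_strict[OF Vf that(1)] by auto
  qed
  then have "irreducible_subspace G R V" using V Vf by (simp add: irreducible_subspace_def)
  then show ?thesis using that V by blast
qed

text \<open>As long as the summands found so far do not span \<open>F\<close>, their orthogonal complement in \<open>F\<close> contains a
  further irreducible subspace; adding it lowers the dimension of the complement.\<close>

lemma irreducible_list_complete:
  assumes F: "fin_dim_subspace R F" and inv: "invariant G R F" and xs: "irreducible_list G R F xs"
  shows "\<exists>ys. irreducible_list G R F (xs @ ys) \<and> total_in R F (\<Union>(set (xs @ ys)))"
  using xs
proof (induction "dimension R (orth_comp_in R F (\<Union>(set xs)))" arbitrary: xs rule: less_induct)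
  case less
  have Fv: "F \<subseteq> vecs R" "lin_subspace R F"
    using F by (auto dest: fin_dim_subspaceD subspace_subset)
  let ?S = "\<Union>(set xs)" and ?K = "orth_comp_in R F (\<Union>(set xs))"
  have S: "?S \<subseteq> vecs R" "invariant G R ?S"
  proof -
    have "V \<subseteq> F \<and> invariant G R V" if "V \<in> set xs" for V
      using less.prems that by (simp add: irreducible_list_def irreducible_subspace_def)
    then show "?S \<subseteq> vecs R" "invariant G R ?S" using Fv(1) unfolding invariant_def by blast+
  qed
  have K: "fin_dim_subspace R ?K" using F S(1) by (rule orth_comp_fin_dim)
  have Kinv: "invariant G R ?K" using invariant_orth_comp inv Fv S by blast
  show ?case
  proof (cases "?K = {vzero R}")
    case True
    then have "total_in R F ?S" by (auto simp: orth_comp_in_def total_in_def)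
    then show ?thesis using less.prems by (intro exI[of _ "[]"]) simp
  next
    case False
    obtain V where V: "irreducible_subspace G R V" "V \<subseteq> ?K" by (rule irreducible_exists[OF K Kinv False])
    have VF: "V \<subseteq> F" "V \<subseteq> vecs R" using V(2) Fv by (auto simp: orth_comp_in_def)
    have "orthogonal_sets R U V" if "U \<in> set xs" for U
    proof (rule orthogonal_sets_sym[OF VF(2)])
      show "U \<subseteq> vecs R" using S that by auto
      show "orthogonal_sets R V U" using V(2) that by (auto simp: orthogonal_sets_def orth_comp_in_def)
    qed
    then have xsV: "irreducible_list G R F (xs @ [V])"
      using less.prems V VF by (auto simp: irreducible_list_def sorted_wrt_append)
    let ?K' = "orth_comp_in R F (\<Union>(set (xs @ [V])))"
    have "\<Union>(set (xs @ [V])) \<subseteq> vecs R" using S VF by auto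
    then have K': "lin_subspace R ?K'" using Fv by (intro orth_comp_subspace)
    have "lin_subspace R V" using V by (simp add: irreducible_subspace_def fin_dim_subspace_def)
    then obtain v where v: "v \<in> V" "v \<noteq> vzero R"
      using V(1) by (auto simp: irreducible_subspace_def lin_subspace_def)
    then have "ip v v \<noteq> 0" using zero_iff VF by auto
    then have "v \<notin> ?K'" using v by (auto simp: orth_comp_in_def)
    moreover have "v \<in> ?K" using v V by auto
    moreover have "?K' \<subseteq> ?K" by (auto simp: orth_comp_in_def)
    ultimately have "dimension R ?K' < dimension R ?K" using dimension_strict[OF K K'] by blast
    then obtain ys where "irreducible_list G R F ((xs @ [V]) @ ys)"
      "total_in R F (\<Union>(set ((xs @ [V]) @ ys)))" using less.hyps xsV by blast
    then show ?thesis by (intro exI[of _ "V # ys"]) simp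
  qed
qed

lemma orthogonal_irreducibles_remove:
  assumes D: "orthogonal_irreducibles G R A I V" and i: "i \<in> I"
  shows "orthogonal_irreducibles G R (orth_comp_in R A (V i)) (I - {i}) V"
proof -
  have A: "fin_dim_subspace R A" "invariant G R A" "A \<subseteq> vecs R"
    and Vi: "irreducible_subspace G R (V i)" "V i \<subseteq> A"
    using D i fin_dim_subset_vecs by (auto simp: orthogonal_irreducibles_def)
  have Vv: "V i \<subseteq> vecs R" "invariant G R (V i)" using Vi A by (auto simp: irreducible_subspace_def)
  have "fin_dim_subspace R (orth_comp_in R A (V i))" using A(1) Vv(1) by (rule orth_comp_fin_dim)
  moreover have "invariant G R (orth_comp_in R A (V i))" using invariant_orth_comp A Vv by blast
  moreover have "V j \<subseteq> orth_comp_in R A (V i)" if "j \<in> I - {i}" for j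
  proof -
    have "V j \<subseteq> A" "orthogonal_sets R (V j) (V i)"
      using D i that by (auto simp: orthogonal_irreducibles_def)
    then show ?thesis by (auto simp: orth_comp_in_def orthogonal_sets_def)
  qed
  moreover have "total_in R (orth_comp_in R A (V i)) (\<Union>j\<in>I - {i}. V j)"
    using D i unfolding orthogonal_irreducibles_def total_in_def orth_comp_in_def by blast
  ultimately show ?thesis using D by (simp add: orthogonal_irreducibles_def)
qed

lemma orthogonal_irreducibles_empty:
  assumes "orthogonal_irreducibles G R A {} V" shows "A = {vzero R}"
  using assms by (auto simp: orthogonal_irreducibles_def total_in_def fin_dim_subspace_def lin_subspace_def)

lemma orthogonal_irreducibles_zero:
  assumes D: "orthogonal_irreducibles G R {vzero R} I V" shows "I = {}"
proof (rule ccontr)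
  assume "I \<noteq> {}"
  then obtain i where "i \<in> I" by auto
  then have "irreducible_subspace G R (V i)" "V i \<subseteq> {vzero R}"
    using D by (auto simp: orthogonal_irreducibles_def)
  then show False by (auto simp: irreducible_subspace_def fin_dim_subspace_def lin_subspace_def)
qed

lemma intertwiner_proj:
  assumes "fin_dim_subspace R F" "invariant G R F"
  shows "intertwiner G R (vecs R) R F (proj_onto R F)"
  using assms by (simp add: intertwiner_def proj_in proj_linear proj_act)

lemma intertwiner_id: "A \<subseteq> B \<Longrightarrow> intertwiner G R A R B (\<lambda>u. u)"
  by (auto simp: intertwiner_def)

lemma intertwiner_diff:
  assumes A: "unitary_rep G S" "A \<subseteq> vecs S" and B: "lin_subspace R B"
    and T: "intertwiner G S A R B T" and U: "intertwiner G S A R B U"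
  shows "intertwiner G S A R B (\<lambda>u. sub (T u) (U u))"
proof -
  have Bv: "B \<subseteq> vecs R" using B by (rule subspace_subset)
  have in1: "T u \<in> B" "U u \<in> B" "T u \<in> vecs R" "U u \<in> vecs R" if "u \<in> A" for u
    using T U that Bv by (auto simp: intertwiner_def)
  show ?thesis
    unfolding intertwiner_def
  proof (intro conjI ballI allI)
    show "sub (T u) (U u) \<in> B" if "u \<in> A" for u using subspace_sub[OF B] in1 that by simp
    show "sub (T (vadd S u v)) (U (vadd S u v)) = vadd R (sub (T u) (U u)) (sub (T v) (U v))"
      if uv: "u \<in> A" "v \<in> A" for u v
    proof -
      have e: "T (vadd S u v) = vadd R (T u) (T v)" "U (vadd S u v) = vadd R (U u) (U v)"
        using T U uv by (auto simp: intertwiner_def)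
      show ?thesis unfolding e by (rule vec_eqI) (use in1 uv in \<open>simp_all add: ip_simps\<close>)
    qed
    show "sub (T (vscale S c u)) (U (vscale S c u)) = vscale R c (sub (T u) (U u))"
      if u: "u \<in> A" for u c
    proof -
      have e: "T (vscale S c u) = vscale R c (T u)" "U (vscale S c u) = vscale R c (U u)"
        using T U u by (auto simp: intertwiner_def)
      show ?thesis unfolding e
        by (rule vec_eqI) (use in1 u in \<open>simp_all add: ip_simps algebra_simps\<close>)
    qed
    show "sub (T (act S g u)) (U (act S g u)) = act R g (sub (T u) (U u))"
      if g: "g \<in> carrier G" and u: "u \<in> A" for u g
    proof -
      have "T (act S g u) = act R g (T u)" "U (act S g u) = act R g (U u)"
        using T U u g by (auto simp: intertwiner_def)
      then show ?thesis using in1 u g by (simp add: act_add act_scale scale_in)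
    qed
  qed
qed

end

section \<open>Schur's lemma and the uniqueness of decompositions\<close>

lemma intertwiner_comp:
  "\<lbrakk>intertwiner G R A S B T; intertwiner G S B Q C U\<rbrakk> \<Longrightarrow> intertwiner G R A Q C (\<lambda>u. U (T u))"
  by (auto simp: intertwiner_def)

lemma intertwiner_restrict:
  "\<lbrakk>intertwiner G R A S B T; A' \<subseteq> A; \<And>u. u \<in> A' \<Longrightarrow> T u \<in> B'\<rbrakk> \<Longrightarrow> intertwiner G R A' S B' T"
  unfolding intertwiner_def by blast

lemma intertwiner_inv:
  assumes A: "lin_subspace R A" "invariant G R A"
    and T: "intertwiner G R A S B T" and bij: "bij_betw T A B"
  shows "intertwiner G S B R A (inv_into A T)"
proof -
  have inv_in: "inv_into A T b \<in> A" and T_inv: "T (inv_into A T b) = b" if "b \<in> B" for b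
    using bij that by (auto simp: bij_betw_def inv_into_into f_inv_into_f)
  have eq: "inv_into A T b = a" if "a \<in> A" "T a = b" for a b
    using bij that by (auto simp: bij_betw_def)
  have "\<lbrakk>u \<in> A; v \<in> A\<rbrakk> \<Longrightarrow> vadd R u v \<in> A" "u \<in> A \<Longrightarrow> vscale R c u \<in> A"
    "\<lbrakk>g \<in> carrier G; u \<in> A\<rbrakk> \<Longrightarrow> act R g u \<in> A" for u v c g
    using A by (auto simp: lin_subspace_def invariant_def)
  note cl = this
  show ?thesis
    using T unfolding intertwiner_def by (intro conjI ballI allI) (auto simp: inv_in T_inv cl intro!: eq)
qed

lemma intertwiner_sub:
  assumes T: "intertwiner G R A S B T" and A: "lin_subspace R A" and u: "u \<in> A" and v: "v \<in> A"
  shows "T (vadd R u (vscale R (-1) v)) = vadd S (T u) (vscale S (-1) (T v))"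
  using assms by (simp add: intertwiner_def lin_subspace_def)

lemma intertwiner_zero:
  assumes R: "unitary_rep G R" and S: "unitary_rep G S" and T: "intertwiner G R A S B T"
    and A: "lin_subspace R A" and B: "B \<subseteq> vecs S"
  shows "T (vzero R) = vzero S"
proof -
  interpret R: unitary_rep G R by fact
  interpret S: unitary_rep G S by fact
  have z: "vzero R \<in> A" using A by (simp add: lin_subspace_def)
  have "T (vscale R 0 (vzero R)) = vscale S 0 (T (vzero R))" using T z by (simp add: intertwiner_def)
  moreover have "T (vzero R) \<in> vecs S" using T z B by (auto simp: intertwiner_def)
  ultimately show ?thesis by (simp add: R.scale_zero R.zero_in S.scale_zero)
qed

text \<open>The image is a nonzero invariant subspace of \<open>W\<close>, and a nonzero multiple of an isometry is
  injective.\<close>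

lemma similarity_onto_irreducible:
  assumes R: "unitary_rep G R" and S: "unitary_rep G S"
    and V: "lin_subspace R V" "invariant G R V" "V \<noteq> {vzero R}" and W: "irreducible_subspace G S W"
    and T: "intertwiner G R V S W T" and c: "c \<noteq> 0"
    and sim: "\<And>u v. \<lbrakk>u \<in> V; v \<in> V\<rbrakk> \<Longrightarrow> vinner S (T u) (T v) = c * vinner R u v"
  shows "bij_betw T V W"
proof -
  interpret R: unitary_rep G R by fact
  interpret S: unitary_rep G S by fact
  have Vv: "V \<subseteq> vecs R" using V(1) by (rule R.subspace_subset)
  have Wv: "W \<subseteq> vecs S" "lin_subspace S W"
    using W by (auto simp: irreducible_subspace_def fin_dim_subspace_def lin_subspace_def)
  have TW: "T u \<in> W" if "u \<in> V" for u using T that by (simp add: intertwiner_def)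
  have Tv: "T u \<in> vecs S" if "u \<in> V" for u using TW that Wv by auto
  have inj: "inj_on T V"
  proof (rule inj_onI)
    fix u v assume uv: "u \<in> V" "v \<in> V" "T u = T v"
    have d: "R.sub u v \<in> V" using R.subspace_sub[OF V(1) uv(1,2)] .
    have "T (R.sub u v) = S.sub (T v) (T v)" using intertwiner_sub[OF T V(1) uv(1,2)] uv(3) by simp
    then have "S.ip (T (R.sub u v)) (T (R.sub u v)) = 0"
      using Tv[OF uv(2)] by (simp add: S.ip_simps)
    then have "R.ip (R.sub u v) (R.sub u v) = 0" using sim[OF d d] c by simp
    then show "u = v" using R.ip_definite uv Vv by blast
  qed
  have z: "T (vzero R) = vzero S" by (rule intertwiner_zero[OF R S T V(1) Wv(1)])
  have "lin_subspace S (T ` V)"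
    unfolding lin_subspace_def
  proof (intro conjI ballI allI)
    show "T ` V \<subseteq> vecs S" using Tv by auto
    show "vzero S \<in> T ` V" using z V(1) by (force simp: lin_subspace_def)
    show "vadd S x y \<in> T ` V" if "x \<in> T ` V" "y \<in> T ` V" for x y
    proof -
      obtain u v where "u \<in> V" "v \<in> V" "x = T u" "y = T v" using \<open>x \<in> T ` V\<close> \<open>y \<in> T ` V\<close> by auto
      then show ?thesis using T V(1) by (intro image_eqI[of _ _ "vadd R u v"]) (auto simp: intertwiner_def lin_subspace_def)
    qed
    show "vscale S d x \<in> T ` V" if "x \<in> T ` V" for x d
    proof -
      obtain u where "u \<in> V" "x = T u" using \<open>x \<in> T ` V\<close> by auto
      then show ?thesis using T V(1) by (intro image_eqI[of _ _ "vscale R d u"]) (auto simp: intertwiner_def lin_subspace_def)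
    qed
  qed
  moreover have "invariant G S (T ` V)"
    unfolding invariant_def
  proof (intro ballI)
    fix g x assume "g \<in> carrier G" "x \<in> T ` V"
    then obtain u where "u \<in> V" "x = T u" by auto
    then show "act S g x \<in> T ` V" using T V(2) \<open>g \<in> carrier G\<close>
      by (intro image_eqI[of _ _ "act R g u"]) (auto simp: intertwiner_def invariant_def)
  qed
  moreover have "T ` V \<noteq> {vzero S}"
  proof
    assume eq: "T ` V = {vzero S}"
    obtain v where v: "v \<in> V" "v \<noteq> vzero R" using V by (auto simp: lin_subspace_def)
    then have "T v = T (vzero R)" using eq z by auto
    then show False using inj v V(1) by (auto simp: inj_on_def lin_subspace_def)
  qed
  moreover have "T ` V \<subseteq> W" using TW by auto
  ultimately have "T ` V = W" using W unfolding irreducible_subspace_def by blast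
  then show ?thesis using inj by (simp add: bij_betw_def)
qed

text \<open>Let \<open>l\<close> be the maximum of \<open>\<parallel>T u\<parallel>\<^sup>2\<close> over the unit sphere of \<open>V\<close>, attained at \<open>x\<close>. The form
  \<open>P u v = l * \<langle>u, v\<rangle> - \<langle>T u, T v\<rangle>\<close> is positive semidefinite and vanishes at \<open>x\<close>, so \<open>x\<close> lies in its null
  space \<open>N\<close> by \<open>psd_null\<close>. As \<open>N\<close> is invariant and \<open>V\<close> is irreducible, \<open>N = V\<close>; that is, \<open>T\<close> scales all
  inner products by \<open>l\<close>, and \<open>T / sqrt l\<close> is a unitary equivalence.\<close>

theorem Schur:
  assumes R: "unitary_rep G R" and S: "unitary_rep G S"
    and V: "irreducible_subspace G R V" and W: "irreducible_subspace G S W"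
    and T: "intertwiner G R V S W T" and nz: "v0 \<in> V" "T v0 \<noteq> vzero S"
  shows "bij_betw T V W" "unitarily_equivalent G (subrep R V) (subrep S W)"
proof -
  interpret R: unitary_rep G R by fact
  interpret S: unitary_rep G S by fact
  have Vf: "fin_dim_subspace R V" "invariant G R V" "lin_subspace R V" "V \<noteq> {vzero R}"
    using V by (auto simp: irreducible_subspace_def fin_dim_subspace_def)
  have Vv: "V \<subseteq> vecs R" using Vf(3) by (rule R.subspace_subset)
  have Wv: "W \<subseteq> vecs S" "lin_subspace S W"
    using W by (auto simp: irreducible_subspace_def fin_dim_subspace_def lin_subspace_def)
  have TW: "T u \<in> W" if "u \<in> V" for u using T that by (simp add: intertwiner_def)
  have Tv: "T u \<in> vecs S" if "u \<in> V" for u using TW that Wv by auto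
  have Tadd: "T (vadd R u v) = vadd S (T u) (T v)" and Tscale: "T (vscale R c u) = vscale S c (T u)"
    if "u \<in> V" "v \<in> V" for u v c using T that by (auto simp: intertwiner_def)
  have Tact: "T (act R g u) = act S g (T u)" if "g \<in> carrier G" "u \<in> V" for g u
    using T that by (auto simp: intertwiner_def)
  have "\<lbrakk>u \<in> V; v \<in> V\<rbrakk> \<Longrightarrow> vadd R u v \<in> V" "u \<in> V \<Longrightarrow> vscale R c u \<in> V"
    "\<lbrakk>g \<in> carrier G; u \<in> V\<rbrakk> \<Longrightarrow> act R g u \<in> V" for u v c g
    using Vf by (auto simp: lin_subspace_def invariant_def)
  note cl = this
  define Q where "Q u v = S.ip (T u) (T v)" for u v
  have Qlin: "linear_form R V (\<lambda>u. Q u v)" if "v \<in> V" for v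
    using that by (simp add: linear_form_def Q_def Tadd Tscale Tv S.ip_simps)
  have Qherm: "Q v u = cnj (Q u v)" if "u \<in> V" "v \<in> V" for u v
    unfolding Q_def using Tv that by (intro S.ip_cnj) auto
  obtain x where x: "x \<in> V" "R.ip x x = 1"
    and max: "\<And>u. u \<in> V \<Longrightarrow> Re (Q u u) \<le> Re (Q x x) * Re (R.ip u u)"
    using R.sphere_max[OF Vf(1,4) Qlin Qherm] by blast
  define l where "l = Re (Q x x)"
  have Qx: "Q x x = complex_of_real l" using S.ip_self[OF Tv[OF x(1)]] by (simp add: l_def Q_def)
  define P where "P u v = complex_of_real l * R.ip u v - Q u v" for u v
  have null: "P x v = 0" if "v \<in> V" for v
  proof (rule R.psd_null[OF Vf(3)])
    show "linear_form R V (\<lambda>u. P u v)" if "v \<in> V" for v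
      using that Qlin[OF that] Vv
      by (auto simp: linear_form_def P_def R.ip_simps subset_iff algebra_simps)
    show "P v u = cnj (P u v)" if "u \<in> V" "v \<in> V" for u v
    proof -
      have "u \<in> vecs R" "v \<in> vecs R" using that Vv by auto
      then show ?thesis using R.ip_cnj[of u v] Qherm[OF that] by (simp add: P_def)
    qed
    show "0 \<le> Re (P u u)" if "u \<in> V" for u using max[OF that] by (simp add: P_def l_def)
    show "P x x = 0" by (simp add: P_def Qx x)
  qed (use x that in auto)
  define N where "N = {u \<in> V. \<forall>v\<in>V. Q u v = complex_of_real l * R.ip u v}"
  have zV: "vzero R \<in> V" using Vf(3) by (simp add: lin_subspace_def)
  have Tz: "T (vzero R) = vzero S" by (rule intertwiner_zero[OF R S T Vf(3) Wv(1)])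
  have Vin: "u \<in> vecs R" if "u \<in> V" for u using that Vv by auto
  have "lin_subspace R N"
    unfolding lin_subspace_def N_def using Vv
    by (auto simp: zV Q_def Tz S.ip_zero Tv R.ip_zero Vin cl Tadd Tscale S.ip_add R.ip_add
      S.ip_scale R.ip_scale algebra_simps)
  moreover have "invariant G R N"
    unfolding invariant_def
  proof (intro ballI)
    fix g u assume g: "g \<in> carrier G" and "u \<in> N"
    then have u: "u \<in> V" "\<And>v. v \<in> V \<Longrightarrow> Q u v = complex_of_real l * R.ip u v"
      by (auto simp: N_def)
    have "Q (act R g u) v = complex_of_real l * R.ip (act R g u) v" if v: "v \<in> V" for v
    proof -
      have ig: "inv\<^bsub>G\<^esub> g \<in> carrier G" using g by simp
      have gv: "act R (inv\<^bsub>G\<^esub> g) v \<in> V" using cl(3)[OF ig v] .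
      have "Q (act R g u) v = S.ip (T u) (act S (inv\<^bsub>G\<^esub> g) (T v))"
        unfolding Q_def Tact[OF g u(1)] by (rule S.act_adjoint[OF g Tv[OF u(1)] Tv[OF v]])
      also have "\<dots> = Q u (act R (inv\<^bsub>G\<^esub> g) v)" by (simp add: Q_def Tact[OF ig v])
      also have "\<dots> = complex_of_real l * R.ip (act R g u) v"
        using u(2)[OF gv] R.act_adjoint[OF g Vin[OF u(1)] Vin[OF v]] by simp
      finally show ?thesis .
    qed
    then show "act R g u \<in> N" using cl(3)[OF g u(1)] by (simp add: N_def)
  qed
  moreover have "x \<in> N" using x null by (simp add: N_def P_def)
  moreover have "x \<noteq> vzero R" using x R.zero_iff Vin by force
  ultimately have "N = V" using V unfolding irreducible_subspace_def by (metis (no_types, lifting) N_def mem_Collect_eq singletonD subsetI)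
  then have sim: "S.ip (T u) (T v) = complex_of_real l * R.ip u v" if "u \<in> V" "v \<in> V" for u v
    using that by (auto simp: N_def Q_def)
  have lpos: "l > 0"
  proof -
    have "S.ip (T v0) (T v0) \<noteq> 0" using nz Tv S.zero_iff by auto
    then have "l \<noteq> 0" using sim[OF nz(1) nz(1)] by auto
    moreover have "l \<ge> 0" using S.ip_pos[OF Tv[OF x(1)]] by (simp add: l_def Q_def)
    ultimately show ?thesis by simp
  qed
  show "bij_betw T V W"
    by (rule similarity_onto_irreducible[OF R S Vf(3,2,4) W T _ sim]) (use lpos in auto)
  define d where "d = complex_of_real (1 / sqrt l)"
  have dd: "d * cnj d * complex_of_real l = 1"
    unfolding d_def using lpos by (simp flip: of_real_mult of_real_divide)
  define U where "U u = vscale S d (T u)" for u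
  have U: "intertwiner G R V S W U"
    unfolding intertwiner_def
  proof (intro conjI ballI allI)
    show "U u \<in> W" if "u \<in> V" for u using TW[OF that] Wv(2) by (simp add: U_def lin_subspace_def)
    show "U (vadd R u v) = vadd S (U u) (U v)" if "u \<in> V" "v \<in> V" for u v
      unfolding U_def Tadd[OF that]
      by (rule S.vec_eqI) (use Tv that in \<open>simp_all add: S.ip_simps algebra_simps\<close>)
    show "U (vscale R c u) = vscale S c (U u)" if "u \<in> V" for u c
      unfolding U_def Tscale[OF that that]
      by (rule S.vec_eqI) (use Tv that in \<open>simp_all add: S.ip_simps algebra_simps\<close>)
    show "U (act R g u) = act S g (U u)" if "g \<in> carrier G" "u \<in> V" for g u
      using that by (simp add: U_def Tact S.act_scale Tv)
  qed
  have iso: "S.ip (U u) (U v) = 1 * R.ip u v" if "u \<in> V" "v \<in> V" for u v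
  proof -
    have "S.ip (U u) (U v) = (d * cnj d * complex_of_real l) * R.ip u v"
      using that by (simp add: U_def S.ip_simps Tv sim)
    then show ?thesis unfolding dd .
  qed
  have "bij_betw U V W"
    by (rule similarity_onto_irreducible[OF R S Vf(3,2,4) W U _ iso]) auto
  then show "unitarily_equivalent G (subrep R V) (subrep S W)"
    unfolding unitarily_equivalent_def
    using U iso by (intro exI[of _ U]) (auto simp: intertwiner_def)
qed

text \<open>The induction removes one summand \<open>V i\<close> at a time. Since \<open>T\<close> does not vanish on \<open>V i\<close>, some
  component \<open>\<theta>\<close> of \<open>T\<close>, namely \<open>T\<close> followed by the projection to some \<open>W j\<close>, is nonzero on \<open>V i\<close>. By
  Schur's lemma \<open>\<theta>\<close> restricts to an isomorphism from \<open>V i\<close> to \<open>W j\<close>. Every \<open>a\<close> orthogonal to \<open>V i\<close>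
  can therefore be corrected by a unique element of \<open>V i\<close> so that \<open>T\<close> maps it into the orthogonal
  complement of \<open>W j\<close>, and this corrected map \<open>T'\<close> is an isomorphism between the two complements.\<close>

theorem decomposition_unique:
  assumes R: "unitary_rep G R" and S: "unitary_rep G S"
    and "orthogonal_irreducibles G R A I V" and "orthogonal_irreducibles G S B J W"
    and "intertwiner G R A S B T" and "bij_betw T A B"
  shows "\<exists>\<sigma>. bij_betw \<sigma> I J \<and>
    (\<forall>i\<in>I. unitarily_equivalent G (subrep R (V i)) (subrep S (W (\<sigma> i))))"
proof -
  interpret R: unitary_rep G R by fact
  interpret S: unitary_rep G S by fact
  have "finite I" using assms(3) by (simp add: orthogonal_irreducibles_def)
  then show ?thesis
    using assms(3-6)
  proof (induction I arbitrary: A B J T rule: finite_induct)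
    case empty
    have A: "A = {vzero R}" using empty(1) by (rule R.orthogonal_irreducibles_empty)
    have "B \<subseteq> vecs S" using empty(2) S.fin_dim_subset_vecs by (auto simp: orthogonal_irreducibles_def)
    moreover have "lin_subspace R A"
      using empty(1) by (simp add: orthogonal_irreducibles_def fin_dim_subspace_def)
    ultimately have "T (vzero R) = vzero S" using intertwiner_zero[OF R S empty(3)] by blast
    then have "B = {vzero S}" using empty(4) A by (auto simp: bij_betw_def)
    then have "J = {}" using empty(2) S.orthogonal_irreducibles_zero by blast
    then show ?case by (auto simp: bij_betw_def)
  next
    case (insert i I)
    have A: "fin_dim_subspace R A" "invariant G R A" "A \<subseteq> vecs R" "lin_subspace R A"
      using insert.prems(1) R.fin_dim_subset_vecs
      by (auto simp: orthogonal_irreducibles_def fin_dim_subspace_def)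
    have B: "fin_dim_subspace S B" "invariant G S B" "B \<subseteq> vecs S" "lin_subspace S B"
      using insert.prems(2) S.fin_dim_subset_vecs
      by (auto simp: orthogonal_irreducibles_def fin_dim_subspace_def)
    have Vi: "irreducible_subspace G R (V i)" "V i \<subseteq> A"
      using insert.prems(1) by (auto simp: orthogonal_irreducibles_def)
    have Vif: "fin_dim_subspace R (V i)" "invariant G R (V i)" "lin_subspace R (V i)" "V i \<noteq> {vzero R}"
      using Vi by (auto simp: irreducible_subspace_def fin_dim_subspace_def)
    note T = insert.prems(3) and bij = insert.prems(4)
    have TB: "T u \<in> B" if "u \<in> A" for u using T that by (simp add: intertwiner_def)
    have Tinj: "u = v" if "T u = T v" "u \<in> A" "v \<in> A" for u v
      using bij that by (auto simp: bij_betw_def inj_on_def)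
    obtain v where v: "v \<in> V i" "v \<noteq> vzero R" using Vif(3,4) by (auto simp: lin_subspace_def)
    have Tz: "T (vzero R) = vzero S" by (rule intertwiner_zero[OF R S T A(4) B(3)])
    have "T v \<noteq> vzero S"
    proof
      assume "T v = vzero S"
      then have "v = vzero R" using Tinj[of v "vzero R"] Tz v(1) Vi(2) A(4) by (auto simp: lin_subspace_def)
      then show False using v by simp
    qed
    moreover have "T v \<in> B" using TB v Vi by auto
    moreover have "total_in S B (\<Union>j\<in>J. W j)" using insert.prems(2) by (simp add: orthogonal_irreducibles_def)
    ultimately obtain j w where j: "j \<in> J" and w: "w \<in> W j" "S.ip (T v) w \<noteq> 0"
      unfolding total_in_def by blast
    have Wj: "irreducible_subspace G S (W j)" "W j \<subseteq> B"
      using insert.prems(2) j by (auto simp: orthogonal_irreducibles_def)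
    have Wjf: "fin_dim_subspace S (W j)" "invariant G S (W j)"
      using Wj by (auto simp: irreducible_subspace_def)
    define P where "P = proj_onto S (W j)"
    have P: "intertwiner G S B S (W j) P"
      unfolding P_def by (rule intertwiner_restrict[OF S.intertwiner_proj[OF Wjf] B(3)])
        (use S.proj_in[OF Wjf(1)] B(3) in blast)
    define \<theta> where "\<theta> u = P (T u)" for u
    have PT: "intertwiner G R A S (W j) \<theta>" unfolding \<theta>_def by (rule intertwiner_comp[OF T P])
    have th: "intertwiner G R (V i) S (W j) \<theta>"
      by (rule intertwiner_restrict[OF PT Vi(2)]) (use PT Vi(2) in \<open>auto simp: intertwiner_def\<close>)
    have Pip: "S.ip (P b) y = S.ip b y" if "b \<in> B" "y \<in> W j" for b y
      unfolding P_def using S.proj_ip[OF Wjf(1)] that B(3) by blast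
    have "\<theta> v \<noteq> vzero S"
    proof
      assume "\<theta> v = vzero S"
      then have "S.ip (\<theta> v) w = 0" using w(1) Wj(2) B(3) by (auto simp: S.ip_zero)
      then show False using Pip[of "T v" w] TB v(1) Vi(2) w by (auto simp: \<theta>_def)
    qed
    then have thbij: "bij_betw \<theta> (V i) (W j)"
      and equiv: "unitarily_equivalent G (subrep R (V i)) (subrep S (W j))"
      using Schur[OF R S Vi(1) Wj(1) th v(1)] by auto
    let ?A = "orth_comp_in R A (V i)" and ?B = "orth_comp_in S B (W j)"
    have AA: "?A \<subseteq> A" "?B \<subseteq> B" by (auto simp: orth_comp_in_def)
    \<comment> \<open>The correction of \<open>a\<close> in \<open>V i\<close>: the vector \<open>T (a - corr a)\<close> is orthogonal to \<open>W j\<close>.\<close>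
    define corr where "corr a = inv_into (V i) \<theta> (\<theta> a)" for a
    have thA: "\<theta> a \<in> W j" if "a \<in> A" for a using PT that by (simp add: intertwiner_def)
    have corr: "corr a \<in> V i" "\<theta> (corr a) = \<theta> a" if "a \<in> A" for a
      using thbij thA[OF that] by (auto simp: corr_def bij_betw_def inv_into_into f_inv_into_f)
    have corr_int: "intertwiner G R A R A corr"
    proof -
      have "intertwiner G R A R (V i) corr"
        unfolding corr_def by (rule intertwiner_comp[OF PT intertwiner_inv[OF Vif(3,2) th thbij]])
      then show ?thesis by (rule intertwiner_restrict) (use corr(1) Vi(2) in auto)
    qed
    define D where "D a = R.sub a (corr a)" for a
    have Dint: "intertwiner G R A R A D"
      unfolding D_def by (rule R.intertwiner_diff[OF R A(3,4) R.intertwiner_id corr_int]) simp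
    define T' where "T' a = T (D a)" for a
    have T'int: "intertwiner G R A S B T'" unfolding T'_def by (rule intertwiner_comp[OF Dint T])
    have DA: "D a \<in> A" if "a \<in> A" for a using Dint that by (simp add: intertwiner_def)
    have T'B: "T' a \<in> ?B" if a: "a \<in> A" for a
    proof -
      have Xa: "corr a \<in> A" using corr(1)[OF a] Vi(2) by auto
      have "S.ip (T' a) y = 0" if y: "y \<in> W j" for y
      proof -
        have yv: "y \<in> vecs S" using y Wj B by auto
        have TT: "T a \<in> vecs S" "T (corr a) \<in> vecs S" using TB a Xa B(3) by auto
        have "T' a = S.sub (T a) (T (corr a))"
          unfolding T'_def D_def by (rule intertwiner_sub[OF T A(4) a Xa])
        then have "S.ip (T' a) y = S.ip (T a) y - S.ip (T (corr a)) y"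
          using TT yv by (simp add: S.ip_simps)
        also have "\<dots> = S.ip (\<theta> a) y - S.ip (\<theta> (corr a)) y"
          unfolding \<theta>_def using Pip TB a Xa y by simp
        finally show ?thesis using corr(2)[OF a] by simp
      qed
      moreover have "T' a \<in> B" using T'int a by (simp add: intertwiner_def)
      ultimately show ?thesis by (simp add: orth_comp_in_def)
    qed
    have int': "intertwiner G R ?A S ?B T'"
      by (rule intertwiner_restrict[OF T'int AA(1)]) (use T'B AA in auto)
    have "inj_on T' ?A"
    proof (rule inj_onI)
      fix a b assume ab: "a \<in> ?A" "b \<in> ?A" "T' a = T' b"
      have abA: "a \<in> A" "b \<in> A" using ab AA by auto
      then have DD: "D a = D b" using ab(3) Tinj DA by (simp add: T'_def)
      have vs: "a \<in> vecs R" "b \<in> vecs R" "corr a \<in> vecs R" "corr b \<in> vecs R"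
        using abA corr(1) Vi(2) A(3) by blast+
      have orth: "R.ip (corr c) d = 0" if "c \<in> A" "d \<in> ?A" for c d
      proof -
        have "R.ip d (corr c) = 0" using corr(1)[OF that(1)] that(2) by (auto simp: orth_comp_in_def)
        moreover have "d \<in> vecs R" "corr c \<in> vecs R" using that AA corr(1) Vi(2) A(3) by blast+
        ultimately show ?thesis using R.ip_cnj[of d "corr c"] by simp
      qed
      have "R.ip (D c) d = R.ip c d" if "c \<in> A" "d \<in> ?A" for c d
      proof -
        have "d \<in> vecs R" "corr c \<in> vecs R" "c \<in> vecs R" using that AA corr(1) Vi(2) A(3) by blast+
        then show ?thesis using orth[OF that] by (simp add: D_def R.ip_simps)
      qed
      then have "R.ip a c = R.ip b c" if "c \<in> ?A" for c using that DD abA by metis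
      then show "a = b" using ab vs by (intro R.ip_sub_self_eq_0) (simp_all add: R.ip_simps)
    qed
    moreover have "T' ` ?A = ?B"
    proof
      show "T' ` ?A \<subseteq> ?B" using T'B AA by auto
      show "?B \<subseteq> T' ` ?A"
      proof
        fix b assume b: "b \<in> ?B"
        then have bB: "b \<in> B" using AA by auto
        then obtain a0 where a0: "a0 \<in> A" "T a0 = b" using bij by (auto simp: bij_betw_def)
        \<comment> \<open>The part of \<open>a0\<close> orthogonal to \<open>V i\<close> is a preimage under \<open>T'\<close>, since its correction restores
          the part \<open>x\<close> that was removed.\<close>
        define x where "x = proj_onto R (V i) a0"
        have a0v: "a0 \<in> vecs R" using a0 A by auto
        have x: "x \<in> V i" "\<And>y. y \<in> V i \<Longrightarrow> R.ip x y = R.ip a0 y"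
          unfolding x_def using R.proj_in[OF Vif(1) a0v] R.proj_ip[OF Vif(1) a0v] by blast+
        have xA: "x \<in> A" "x \<in> vecs R" using x(1) Vi(2) A(3) by auto
        define a where "a = R.sub a0 x"
        have aA: "a \<in> A" unfolding a_def by (rule R.subspace_sub[OF A(4) a0(1) xA(1)])
        have av: "a \<in> vecs R" using aA A(3) by auto
        have "R.ip a y = 0" if "y \<in> V i" for y
        proof -
          have "y \<in> vecs R" using that Vi A by auto
          then show ?thesis using x(2)[OF that] xA a0v by (simp add: a_def R.ip_simps)
        qed
        then have "a \<in> ?A" using aA by (simp add: orth_comp_in_def)
        moreover have "T' a = b"
        proof -
          have mx: "vscale R (-1) x \<in> V i" using Vif(3) x(1) by (simp add: lin_subspace_def)
          have "\<theta> a0 = vzero S"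
            unfolding \<theta>_def P_def
          proof (rule S.proj_unique[OF Wjf(1)])
            show "T a0 \<in> vecs S" using a0 bB B(3) by auto
            show "vzero S \<in> W j" using Wjf(1) by (simp add: fin_dim_subspace_def lin_subspace_def)
            fix y assume y: "y \<in> W j"
            then have "y \<in> vecs S" using Wj B by auto
            moreover have "S.ip b y = 0" using b y by (simp add: orth_comp_in_def)
            ultimately show "S.ip (vzero S) y = S.ip (T a0) y" using a0(2) by (simp add: S.ip_zero)
          qed
          then have "\<theta> a = vadd S (vzero S) (vscale S (-1) (\<theta> x))"
            using intertwiner_sub[OF PT A(4) a0(1) xA(1)] by (simp add: a_def)
          also have "\<dots> = vscale S (-1) (\<theta> x)"
          proof -
            have "\<theta> x \<in> vecs S" using thA[OF xA(1)] Wj(2) B(3) by auto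
            then show ?thesis by (intro S.vec_eqI) (simp_all add: S.ip_simps)
          qed
          also have "\<dots> = \<theta> (vscale R (-1) x)" using PT xA(1) by (simp add: intertwiner_def)
          finally have "corr a = vscale R (-1) x"
            using thbij mx unfolding corr_def by (simp add: bij_betw_def)
          then have "D a = a0"
            unfolding D_def a_def by (intro R.vec_eqI) (use a0v xA in \<open>simp_all add: R.ip_simps\<close>)
          then show ?thesis using a0(2) by (simp add: T'_def)
        qed
        ultimately show "b \<in> T' ` ?A" by blast
      qed
    qed
    ultimately have bij': "bij_betw T' ?A ?B" by (simp add: bij_betw_def)
    have "orthogonal_irreducibles G R ?A (insert i I - {i}) V"
      by (rule R.orthogonal_irreducibles_remove[OF insert.prems(1)]) simp
    then have dA: "orthogonal_irreducibles G R ?A I V" using insert.hyps by simp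
    have dB: "orthogonal_irreducibles G S ?B (J - {j}) W"
      by (rule S.orthogonal_irreducibles_remove[OF insert.prems(2) j])
    obtain \<sigma> where \<sigma>: "bij_betw \<sigma> I (J - {j})"
      "\<forall>i\<in>I. unitarily_equivalent G (subrep R (V i)) (subrep S (W (\<sigma> i)))"
      using insert.IH[OF dA dB int' bij'] by blast
    have "bij_betw (\<sigma>(i := j)) I (J - {j})"
      using \<sigma>(1) insert.hyps by (subst bij_betw_cong[of I _ \<sigma>]) auto
    then have "bij_betw (\<sigma>(i := j)) (insert i I) (insert j (J - {j}))"
      using insert.hyps notIn_Un_bij_betw3[of i I "\<sigma>(i := j)" "J - {j}"] by simp
    then have "bij_betw (\<sigma>(i := j)) (insert i I) J" using j by (simp add: insert_absorb)
    moreover have "\<forall>i'\<in>insert i I. unitarily_equivalent G (subrep R (V i')) (subrep S (W ((\<sigma>(i := j)) i')))"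
      using \<sigma>(2) equiv insert.hyps by auto
    ultimately show ?case by blast
  qed
qed

section \<open>Decomposition along an exhaustion by finite-dimensional subspaces\<close>

context unitary_rep
begin

lemma irreducible_list_family:
  assumes F: "fin_dim_subspace R F" "invariant G R F" and xs: "irreducible_list G R F xs"
    and tot: "total_in R F (\<Union>(set xs))"
  shows "orthogonal_irreducibles G R F {..<length xs} ((!) xs)"
proof -
  have Fv: "F \<subseteq> vecs R" using F(1) by (rule fin_dim_subset_vecs)
  have sub: "xs ! i \<subseteq> vecs R" if "i < length xs" for i
    using xs Fv that by (fastforce simp: irreducible_list_def)
  have lt: "orthogonal_sets R (xs ! i) (xs ! j)" if "i < j" "j < length xs" for i j
    using xs that by (auto simp: irreducible_list_def intro: sorted_wrt_nth_less)
  have "orthogonal_sets R (xs ! i) (xs ! j)" if "i < length xs" "j < length xs" "i \<noteq> j" for i j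
    using lt[of i j] orthogonal_sets_sym[OF _ _ lt[of j i]] sub that by (cases "i < j") auto
  moreover have "(\<Union>i<length xs. xs ! i) = \<Union>(set xs)" by (auto simp: set_conv_nth)
  ultimately show ?thesis
    using F xs tot by (auto simp: orthogonal_irreducibles_def irreducible_list_def)
qed

text \<open>The lists of summands of the \<open>E n\<close> are chosen successively, each extending the one before; \<open>V\<close>
  enumerates their common extension, which is infinite because infinitely many steps are proper.\<close>

theorem decomposition_along_exhaustion:
  fixes E :: "nat \<Rightarrow> 'v set"
  assumes E: "\<And>n. fin_dim_subspace R (E n)" "\<And>n. invariant G R (E n)" "\<And>n. E n \<subseteq> E (Suc n)"
    and dense: "norm_closure R (\<Union>n. E n) = vecs R"
    and grows: "\<And>N. \<exists>n\<ge>N. E (Suc n) \<noteq> E n"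
  shows "\<exists>V k. irreducible_decomposition G R (UNIV :: nat set) V \<and>
     (\<forall>i. finite_dim (subrep R (V i))) \<and> mono k \<and> filterlim k at_top sequentially \<and>
     (\<forall>n. E (Suc n) \<noteq> E n \<longrightarrow> k n < k (Suc n)) \<and>
     (\<forall>n. orthogonal_irreducibles G R (E n) {..<k n} V)"
proof -
  let ?P = "\<lambda>n xs. irreducible_list G R (E n) xs \<and> total_in R (E n) (\<Union>(set xs))"
  have "\<exists>f. \<forall>n. ?P n (f n) \<and> (\<exists>zs. f (Suc n) = f n @ zs)"
  proof (rule dependent_nat_choice)
    have "irreducible_list G R (E 0) []" by (simp add: irreducible_list_def)
    from irreducible_list_complete[OF E(1,2) this] show "\<exists>xs. ?P 0 xs" by auto
  next
    fix xs n assume "?P n xs"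
    then have "irreducible_list G R (E (Suc n)) xs"
      using E(3)[of n] by (auto simp: irreducible_list_def)
    from irreducible_list_complete[OF E(1,2) this]
    show "\<exists>ys. ?P (Suc n) ys \<and> (\<exists>zs. ys = xs @ zs)" by blast
  qed
  then obtain f where f: "\<And>n. irreducible_list G R (E n) (f n)" "\<And>n. total_in R (E n) (\<Union>(set (f n)))"
    and step: "\<And>n. \<exists>zs. f (Suc n) = f n @ zs" by blast
  have prefix: "\<exists>zs. f n = f m @ zs" if "m \<le> n" for m n
    using that
  proof (induction n rule: dec_induct)
    case (step n)
    then show ?case using \<open>\<And>n. \<exists>zs. f (Suc n) = f n @ zs\<close>[of n] by auto
  qed simp
  define k where "k n = length (f n)" for n
  define V where "V i = f (LEAST n. i < k n) ! i" for i
  have V: "V i = f n ! i" if "i < k n" for i n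
  proof -
    let ?m = "LEAST n. i < k n"
    have "i < k ?m" using that by (rule LeastI)
    moreover have "?m \<le> n" using that by (rule Least_le)
    ultimately show ?thesis using prefix[of ?m n] by (auto simp: V_def k_def nth_append)
  qed
  have mono: "mono k"
  proof (rule monoI)
    fix m n :: nat assume "m \<le> n"
    then show "k m \<le> k n" using prefix[of m n] by (auto simp: k_def)
  qed
  have fam: "orthogonal_irreducibles G R (E n) {..<k n} V" for n
  proof -
    have "orthogonal_irreducibles G R (E n) {..<k n} ((!) (f n))"
      unfolding k_def by (rule irreducible_list_family[OF E(1,2) f])
    then show ?thesis using V[of _ n] unfolding orthogonal_irreducibles_def by auto
  qed
  have span: "lin_span R (\<Union>i<k n. V i) = E n" for n
    using fam[of n] by (intro lin_span_total) (auto simp: orthogonal_irreducibles_def)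
  have strict: "k n < k (Suc n)" if "E (Suc n) \<noteq> E n" for n
  proof -
    have "k n \<noteq> k (Suc n)" using that span[of n] span[of "Suc n"] by metis
    then show ?thesis using monoD[OF mono, of n "Suc n"] by simp
  qed
  have unbounded: "\<exists>n. M \<le> k n" for M
  proof (induction M)
    case (Suc M)
    then obtain m where m: "M \<le> k m" by blast
    obtain n where n: "n \<ge> m" "E (Suc n) \<noteq> E n" using grows by blast
    have "k m \<le> k n" using mono n(1) by (rule monoD)
    then show ?case using strict[OF n(2)] m by (intro exI[of _ "Suc n"]) simp
  qed simp
  have lim: "filterlim k at_top sequentially"
    unfolding filterlim_at_top eventually_sequentially
    using unbounded monoD[OF mono] by (meson order_trans)
  have ex: "\<exists>n. i < k n" for i using unbounded[of "Suc i"] by (auto simp: Suc_le_eq)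
  have irr: "irreducible_subspace G R (V i)" for i
    using ex[of i] fam by (auto simp: orthogonal_irreducibles_def)
  have "irreducible_decomposition G R (UNIV :: nat set) V"
    unfolding irreducible_decomposition_def
  proof (intro conjI ballI impI)
    fix i j :: nat and u v assume ij: "i \<noteq> j" "u \<in> V i" "v \<in> V j"
    obtain n where n: "i < k n" "j < k n"
      using unbounded[of "Suc (max i j)"] by (auto simp: Suc_le_eq)
    then have "orthogonal_sets R (V i) (V j)" using fam[of n] ij by (auto simp: orthogonal_irreducibles_def)
    then show "ip u v = 0" using ij by (simp add: orthogonal_sets_def)
  next
    have "(\<Union>n. E n) \<subseteq> lin_span R (\<Union>i. V i)"
    proof
      fix u assume "u \<in> (\<Union>n. E n)"
      then obtain n where "u \<in> lin_span R (\<Union>i<k n. V i)" using span by auto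
      then show "u \<in> lin_span R (\<Union>i. V i)" by (auto simp: lin_span_def)
    qed
    then have "norm_closure R (\<Union>n. E n) \<subseteq> hilbert_sum R UNIV V"
      unfolding hilbert_sum_def norm_closure_def by blast
    then show "hilbert_sum R UNIV V = vecs R"
      using dense by (auto simp: hilbert_sum_def norm_closure_def)
  qed (use irreducible_subspaceD irr in auto)
  moreover have "finite_dim (subrep R (V i))" for i
    using irr[of i] by (auto simp: irreducible_subspace_def intro: finite_dim_subrep)
  ultimately show ?thesis using mono lim strict fam by blast
qed

end

lemma (in unitary_rep) orthogonal_irreducibles_if_decomposition:
  assumes fd: "fin_dim_subspace R (vecs R)" and W: "irreducible_decomposition G R I W" and fin: "finite I"
  shows "orthogonal_irreducibles G R (vecs R) I W"
proof -
  have W1: "W i \<subseteq> vecs R" "irreducible_subspace G R (W i)" if "i \<in> I" for i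
  proof -
    have w: "closed_subspace R (W i)" "invariant G R (W i)" "irreducible_rep G (subrep R (W i))"
      using W that by (auto simp: irreducible_decomposition_def)
    then show sub: "W i \<subseteq> vecs R" by (simp add: closed_subspace_def lin_subspace_def)
    have "fin_dim_subspace R (W i)"
      using fin_dim_subset[OF fd _ sub] w(1) by (simp add: closed_subspace_def)
    then show "irreducible_subspace G R (W i)" using irreducible_subspaceI w by blast
  qed
  have "total_in R (vecs R) (\<Union>i\<in>I. W i)"
    using W W1(1) by (intro total_if_hilbert_sum[OF fd]) (auto simp: irreducible_decomposition_def)
  then show ?thesis
    using W W1 fd fin invariant_vecs
    by (auto simp: orthogonal_irreducibles_def irreducible_decomposition_def orthogonal_sets_def)
qed

text \<open>Both parametrizations identify \<open>p\<close> and \<open>q\<close> precisely when the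
  image of \<open>p - q\<close> has norm zero, a condition common to \<open>J\<close> and \<open>J'\<close>, so \<open>J p \<mapsto> J' p\<close> is well defined and
  injective.\<close>

lemma unitarily_equivalent_parametrized:
  fixes J :: "'p \<Rightarrow> 'v" and J' :: "'p \<Rightarrow> 'w"
  assumes R: "ip_space R" and S: "ip_space S"
    and A: "range J = A" "A \<subseteq> vecs R" and B: "range J' = vecs S"
    and add: "\<And>p q. J (padd p q) = vadd R (J p) (J q)" "\<And>p q. J' (padd p q) = vadd S (J' p) (J' q)"
    and scale: "\<And>c p. J (pscale c p) = vscale R c (J p)" "\<And>c p. J' (pscale c p) = vscale S c (J' p)"
    and act: "\<And>g p. g \<in> carrier G \<Longrightarrow> J (\<tau> g p) = act R g (J p)"
      "\<And>g p. g \<in> carrier G \<Longrightarrow> J' (\<tau> g p) = act S g (J' p)"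
    and iso: "\<And>p q. vinner S (J' p) (J' q) = vinner R (J p) (J q)"
  shows "unitarily_equivalent G (subrep R A) S"
proof -
  interpret R: ip_space R by fact
  interpret S: ip_space S by fact
  have Jv: "J p \<in> vecs R" "J' p \<in> vecs S" for p using A B by auto
  have eq: "J p = J q \<longleftrightarrow> J' p = J' q" for p q
  proof -
    let ?d = "padd p (pscale (-1) q)"
    have "J p = J q \<longleftrightarrow> R.ip (J ?d) (J ?d) = 0"
      using R.ip_definite[OF Jv(1) Jv(1), of p q] Jv by (auto simp: add scale R.ip_simps)
    also have "\<dots> \<longleftrightarrow> S.ip (J' ?d) (J' ?d) = 0" by (simp add: iso)
    also have "\<dots> \<longleftrightarrow> J' p = J' q"
      using S.ip_definite[OF Jv(2) Jv(2), of p q] Jv by (auto simp: add scale S.ip_simps)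
    finally show ?thesis .
  qed
  define T where "T u = J' (inv_into UNIV J u)" for u
  have T: "T (J p) = J' p" for p
    unfolding T_def using eq[of "inv_into UNIV J (J p)" p] by (simp add: f_inv_into_f)
  have "T ` A = vecs S" unfolding A(1)[symmetric] B[symmetric] image_image T ..
  moreover have "inj_on T A" unfolding A(1)[symmetric] by (auto simp: inj_on_def T eq)
  ultimately have "bij_betw T A (vecs S)" by (simp add: bij_betw_def)
  then show ?thesis
    unfolding unitarily_equivalent_def using A(1)
    by (intro exI[of _ T]) (auto simp: T iso simp flip: add scale act)
qed

text \<open>The preimage of an orthonormal set under a unitary equivalence is orthonormal.\<close>

lemma fin_dim_transfer:
  assumes S: "ip_space S" and fd: "fin_dim_subspace R A"
    and eq: "unitarily_equivalent G (subrep R A) S"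
  shows "fin_dim_subspace S (vecs S)"
proof -
  interpret S: ip_space S by fact
  obtain d where d: "\<And>E. orthonormal R E \<Longrightarrow> E \<subseteq> A \<Longrightarrow> card E \<le> d"
    using fd by (auto simp: fin_dim_subspace_def)
  have Av: "A \<subseteq> vecs R" using fd by (simp add: fin_dim_subspace_def lin_subspace_def)
  obtain T where bij: "bij_betw T A (vecs S)"
    and iso: "\<And>u v. \<lbrakk>u \<in> A; v \<in> A\<rbrakk> \<Longrightarrow> vinner S (T u) (T v) = vinner R u v"
    using eq by (auto simp: unitarily_equivalent_def)
  have "card E \<le> d" if E: "orthonormal S E" for E
  proof -
    let ?g = "inv_into A T"
    have g: "?g e \<in> A" "T (?g e) = e" if "e \<in> E" for e
    proof -
      have "e \<in> T ` A" using E that bij by (auto simp: orthonormal_def bij_betw_def)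
      then show "?g e \<in> A" "T (?g e) = e" by (auto intro: inv_into_into f_inv_into_f)
    qed
    have inj: "inj_on ?g E" by (metis g(2) inj_onI)
    have "vinner R (?g e) (?g e') = (if ?g e = ?g e' then 1 else 0)" if "e \<in> E" "e' \<in> E" for e e'
    proof -
      have "vinner R (?g e) (?g e') = vinner S e e'" using iso[of "?g e" "?g e'"] g that by simp
      moreover have "?g e = ?g e' \<longleftrightarrow> e = e'" using inj that by (auto simp: inj_on_def)
      ultimately show ?thesis using E that by (simp add: orthonormal_def)
    qed
    then have "orthonormal R (?g ` E)" using E g Av by (auto simp: orthonormal_def)
    then have "card (?g ` E) \<le> d" using g by (intro d) auto
    then show ?thesis using card_image[OF inj] by simp
  qed
  then show ?thesis using S.subspace_vecs by (auto simp: fin_dim_subspace_def)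
qed

section \<open>Square-integrable functions\<close>

lemma sq_integrable_dominated:
  assumes "f \<in> borel_measurable M" "integrable M w" "\<And>x. x \<in> space M \<Longrightarrow> (cmod (f x))\<^sup>2 \<le> w x"
  shows "f \<in> sq_integrable M"
proof -
  have "integrable M (\<lambda>x. (cmod (f x))\<^sup>2)"
  proof (rule Bochner_Integration.integrable_bound[OF assms(2)])
    show "(\<lambda>x. (cmod (f x))\<^sup>2) \<in> borel_measurable M" using assms(1) by measurable
    show "AE x in M. norm ((cmod (f x))\<^sup>2) \<le> norm (w x)"
      using assms(3) by (intro AE_I2) (smt (verit) real_norm_def zero_le_power2)
  qed
  then show ?thesis using assms(1) by (simp add: sq_integrable_def)
qed

lemma cmod_add_sq: "(cmod (a + b))\<^sup>2 \<le> 2 * (cmod a)\<^sup>2 + 2 * (cmod b)\<^sup>2"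
proof -
  have "(cmod (a + b))\<^sup>2 \<le> (cmod a + cmod b)\<^sup>2" by (intro power_mono norm_triangle_ineq) simp
  also have "\<dots> \<le> 2 * (cmod a)\<^sup>2 + 2 * (cmod b)\<^sup>2"
    using sum_squares_bound[of "cmod a" "cmod b"] by (simp add: power2_sum)
  finally show ?thesis .
qed

lemma sq_integrable_add:
  assumes "f \<in> sq_integrable M" "g \<in> sq_integrable M"
  shows "(\<lambda>x. f x + g x) \<in> sq_integrable M"
proof (rule sq_integrable_dominated[where w = "\<lambda>x. 2 * (cmod (f x))\<^sup>2 + 2 * (cmod (g x))\<^sup>2"])
  have [measurable]: "f \<in> borel_measurable M" "g \<in> borel_measurable M"
    using assms by (simp_all add: sq_integrable_def)
  show "(\<lambda>x. f x + g x) \<in> borel_measurable M" by measurable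
  show "integrable M (\<lambda>x. 2 * (cmod (f x))\<^sup>2 + 2 * (cmod (g x))\<^sup>2)"
    using assms by (auto simp: sq_integrable_def)
qed (rule cmod_add_sq)

lemma sq_integrable_scale:
  assumes "f \<in> sq_integrable M" shows "(\<lambda>x. c * f x) \<in> sq_integrable M"
proof (rule sq_integrable_dominated[where w = "\<lambda>x. (cmod c)\<^sup>2 * (cmod (f x))\<^sup>2"])
  have [measurable]: "f \<in> borel_measurable M" using assms by (simp add: sq_integrable_def)
  show "(\<lambda>x. c * f x) \<in> borel_measurable M" by measurable
  show "integrable M (\<lambda>x. (cmod c)\<^sup>2 * (cmod (f x))\<^sup>2)" using assms by (auto simp: sq_integrable_def)
qed (simp add: norm_mult power_mult_distrib)

lemma sq_integrable_zero: "(\<lambda>x. 0) \<in> sq_integrable M"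
  by (simp add: sq_integrable_def)

lemma borel_measurable_cnj [measurable (raw)]:
  "f \<in> borel_measurable M \<Longrightarrow> (\<lambda>x. cnj (f x)) \<in> borel_measurable M"
  by (rule measurable_compose[OF _ borel_measurable_continuous_onI]) (auto intro: continuous_intros)

lemma integrable_mult_cnj:
  assumes f: "f \<in> sq_integrable M" and g: "g \<in> sq_integrable M"
  shows "integrable M (\<lambda>x. f x * cnj (g x))"
proof (rule Bochner_Integration.integrable_bound)
  have [measurable]: "f \<in> borel_measurable M" "g \<in> borel_measurable M"
    using f g by (simp_all add: sq_integrable_def)
  show "integrable M (\<lambda>x. (cmod (f x))\<^sup>2 + (cmod (g x))\<^sup>2)" using f g by (auto simp: sq_integrable_def)
  show "(\<lambda>x. f x * cnj (g x)) \<in> borel_measurable M"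
    by measurable
  have "cmod (a * cnj b) \<le> (cmod a)\<^sup>2 + (cmod b)\<^sup>2" for a b
    using sum_squares_bound[of "cmod a" "cmod b"]
      mult_nonneg_nonneg[OF norm_ge_zero norm_ge_zero, of a b]
    unfolding norm_mult complex_mod_cnj by linarith
  then show "AE x in M. norm (f x * cnj (g x)) \<le> norm ((cmod (f x))\<^sup>2 + (cmod (g x))\<^sup>2)"
    by (intro AE_I2) (simp add: order_trans[OF _ abs_ge_self])
qed

lemma some_rep_ae_class:
  assumes "f \<in> sq_integrable M"
  shows "some_rep (ae_class M f) \<in> sq_integrable M" "AE x in M. some_rep (ae_class M f) x = f x"
proof -
  have "f \<in> ae_class M f" using assms by (simp add: ae_class_def)
  then have "some_rep (ae_class M f) \<in> ae_class M f" unfolding some_rep_def by (rule someI[where P = "\<lambda>h. h \<in> ae_class M f"])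
  then show "some_rep (ae_class M f) \<in> sq_integrable M" "AE x in M. some_rep (ae_class M f) x = f x"
    by (simp_all add: ae_class_def)
qed

lemma ae_class_cong: "AE x in M. f x = g x \<Longrightarrow> ae_class M f = ae_class M g"
  unfolding ae_class_def by (auto elim!: AE_mp)

lemma ae_class_cong_space: "(\<And>x. x \<in> space M \<Longrightarrow> f x = g x) \<Longrightarrow> ae_class M f = ae_class M g"
  by (intro ae_class_cong AE_I2)

text \<open>The operations of \<open>L2_rep\<close> can be computed on arbitrary representatives.\<close>

lemma L2_vecs: "vecs (L2_rep G M \<alpha>) = ae_class M ` sq_integrable M"
  and L2_zero: "vzero (L2_rep G M \<alpha>) = ae_class M (\<lambda>x. 0)"
  by (simp_all add: L2_rep_def)

lemma L2_add:
  assumes f: "f \<in> sq_integrable M" and g: "g \<in> sq_integrable M"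
  shows "vadd (L2_rep G M \<alpha>) (ae_class M f) (ae_class M g) = ae_class M (\<lambda>x. f x + g x)"
  unfolding L2_rep_def using some_rep_ae_class(2)[OF f] some_rep_ae_class(2)[OF g]
  by simp (rule ae_class_cong, auto elim!: AE_mp)

lemma L2_scale:
  assumes f: "f \<in> sq_integrable M"
  shows "vscale (L2_rep G M \<alpha>) c (ae_class M f) = ae_class M (\<lambda>x. c * f x)"
  unfolding L2_rep_def using some_rep_ae_class(2)[OF f]
  by simp (rule ae_class_cong, auto elim!: AE_mp)

lemma L2_inner:
  assumes f: "f \<in> sq_integrable M" and g: "g \<in> sq_integrable M"
  shows "vinner (L2_rep G M \<alpha>) (ae_class M f) (ae_class M g) = (\<integral>x. f x * cnj (g x) \<partial>M)"
proof -
  have [measurable]: "f \<in> borel_measurable M" "g \<in> borel_measurable M"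
    "some_rep (ae_class M f) \<in> borel_measurable M" "some_rep (ae_class M g) \<in> borel_measurable M"
    using f g some_rep_ae_class(1) by (auto simp: sq_integrable_def)
  show ?thesis
    unfolding L2_rep_def using some_rep_ae_class(2)[OF f] some_rep_ae_class(2)[OF g]
    by simp (rule integral_cong_AE, measurable, auto elim!: AE_mp)
qed

text \<open>Two representatives stay equal almost everywhere after composition with a measure preserving map.\<close>

lemma L2_act:
  assumes f: "f \<in> sq_integrable M" and a: "\<alpha> (inv\<^bsub>G\<^esub> g) \<in> measurable M M" "distr M M (\<alpha> (inv\<^bsub>G\<^esub> g)) = M"
  shows "act (L2_rep G M \<alpha>) g (ae_class M f) = ae_class M (\<lambda>x. f (\<alpha> (inv\<^bsub>G\<^esub> g) x))"
proof -
  have "AE x in distr M M (\<alpha> (inv\<^bsub>G\<^esub> g)). some_rep (ae_class M f) x = f x"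
    unfolding a(2) by (rule some_rep_ae_class(2)[OF f])
  then have "AE x in M. some_rep (ae_class M f) (\<alpha> (inv\<^bsub>G\<^esub> g) x) = f (\<alpha> (inv\<^bsub>G\<^esub> g) x)"
    by (rule AE_distrD[OF a(1)])
  then show ?thesis unfolding L2_rep_def by simp (rule ae_class_cong)
qed

lemma sq_integrable_comp:
  assumes f: "f \<in> sq_integrable M" and a: "a \<in> measurable M M" "distr M M a = M"
  shows "(\<lambda>x. f (a x)) \<in> sq_integrable M"
proof -
  have "f \<in> borel_measurable M" "integrable (distr M M a) (\<lambda>x. (cmod (f x))\<^sup>2)"
    using f a(2) by (auto simp: sq_integrable_def)
  then show ?thesis
    using integrable_distr[OF a(1)] a(1) by (auto simp: sq_integrable_def intro: measurable_compose)
qed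

lemma integral_mult_cnj_self:
  "(\<integral>x. f x * cnj (f x) \<partial>M) = complex_of_real (\<integral>x. (cmod (f x))\<^sup>2 \<partial>M)"
  by (simp only: complex_norm_square[symmetric] integral_complex_of_real)

lemma ip_space_L2:
  fixes M :: "'x measure"
  shows "ip_space (L2_rep G M \<alpha>)"
proof
  let ?H = "L2_rep G M \<alpha>"
  note simps = L2_vecs L2_zero L2_add L2_scale L2_inner sq_integrable_add sq_integrable_scale
    sq_integrable_zero
  fix u v w :: "('x \<Rightarrow> complex) set" and c :: complex
  show "vzero ?H \<in> vecs ?H" by (simp add: simps)
  assume u: "u \<in> vecs ?H"
  then obtain f where f: "f \<in> sq_integrable M" "u = ae_class M f" by (auto simp: simps)
  show "vscale ?H c u \<in> vecs ?H" using f by (simp add: simps)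
  show "vinner ?H (vzero ?H) u = 0" using f by (simp add: simps)
  show "0 \<le> Re (vinner ?H u u)" using f by (simp add: simps integral_mult_cnj_self)
  assume v: "v \<in> vecs ?H"
  then obtain g where g: "g \<in> sq_integrable M" "v = ae_class M g" by (auto simp: simps)
  show "vadd ?H u v \<in> vecs ?H" using f g by (simp add: simps)
  show "vinner ?H (vscale ?H c u) v = c * vinner ?H u v" using f g by (simp add: simps mult.assoc)
  show "vinner ?H v u = cnj (vinner ?H u v)"
  proof -
    have "cnj (\<integral>x. f x * cnj (g x) \<partial>M) = (\<integral>x. cnj (f x * cnj (g x)) \<partial>M)"
      by (rule Bochner_Integration.integral_cnj[symmetric])
    also have "\<dots> = (\<integral>x. g x * cnj (f x) \<partial>M)" by (simp add: mult.commute)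
    finally show ?thesis using f g by (simp add: simps)
  qed
  show "u = v" if "vinner ?H (vadd ?H u (vscale ?H (- 1) v)) (vadd ?H u (vscale ?H (- 1) v)) = 0"
  proof -
    let ?d = "\<lambda>x. f x + (-1) * g x"
    have d: "?d \<in> sq_integrable M" using f g by (intro sq_integrable_add sq_integrable_scale)
    have "vadd ?H u (vscale ?H (- 1) v) = ae_class M ?d"
      unfolding f(2) g(2) L2_scale[OF g(1)] by (rule L2_add[OF f(1) sq_integrable_scale[OF g(1)]])
    then have "complex_of_real (\<integral>x. (cmod (?d x))\<^sup>2 \<partial>M) = 0"
      using that L2_inner[OF d d, of G \<alpha>] unfolding integral_mult_cnj_self by simp
    then have "(\<integral>x. (cmod (?d x))\<^sup>2 \<partial>M) = 0" by (simp only: of_real_eq_0_iff)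
    then have "AE x in M. (cmod (?d x))\<^sup>2 = 0"
      using d by (subst (asm) integral_nonneg_eq_0_iff_AE) (auto simp: sq_integrable_def)
    then have "AE x in M. f x = g x" by (rule AE_mp) auto
    then show ?thesis unfolding f(2) g(2) by (rule ae_class_cong)
  qed
  assume w: "w \<in> vecs ?H"
  then obtain h where h: "h \<in> sq_integrable M" "w = ae_class M h" by (auto simp: simps)
  show "vinner ?H (vadd ?H u v) w = vinner ?H u w + vinner ?H v w"
    using f g h by (simp add: simps distrib_right integrable_mult_cnj)
qed

lemma unitary_rep_L2:
  assumes G: "group G"
    and meas: "\<And>g. g \<in> carrier G \<Longrightarrow> \<alpha> g \<in> measurable M M"
    and pres: "\<And>g. g \<in> carrier G \<Longrightarrow> distr M M (\<alpha> g) = M"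
    and inv: "\<And>g x. \<lbrakk>g \<in> carrier G; x \<in> space M\<rbrakk> \<Longrightarrow> \<alpha> g (\<alpha> (inv\<^bsub>G\<^esub> g) x) = x"
  shows "unitary_rep G (L2_rep G M \<alpha>)"
proof -
  interpret G: group G by fact
  interpret ip_space "L2_rep G M \<alpha>" by (rule ip_space_L2)
  let ?H = "L2_rep G M \<alpha>"
  have act: "act ?H g (ae_class M f) = ae_class M (\<lambda>x. f (\<alpha> (inv\<^bsub>G\<^esub> g) x))"
    and comp: "(\<lambda>x. f (\<alpha> (inv\<^bsub>G\<^esub> g) x)) \<in> sq_integrable M"
    if "g \<in> carrier G" "f \<in> sq_integrable M" for f g
    using that meas[of "inv\<^bsub>G\<^esub> g"] pres[of "inv\<^bsub>G\<^esub> g"] by (simp_all add: L2_act sq_integrable_comp)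
  show ?thesis
  proof
    fix g u v assume g: "g \<in> carrier G" and u: "u \<in> vecs ?H"
    then obtain f where f: "f \<in> sq_integrable M" "u = ae_class M f" by (auto simp: L2_vecs)
    show "act ?H g u \<in> vecs ?H" using f g by (simp add: act comp L2_vecs)
    show "act ?H g (act ?H (inv\<^bsub>G\<^esub> g) u) = u"
      unfolding f(2) using f(1) g comp[of "inv\<^bsub>G\<^esub> g" f] inv by (simp add: act) (rule ae_class_cong_space, simp)
    assume v: "v \<in> vecs ?H"
    then obtain h where h: "h \<in> sq_integrable M" "v = ae_class M h" by (auto simp: L2_vecs)
    let ?a = "\<alpha> (inv\<^bsub>G\<^esub> g)"
    have a: "?a \<in> measurable M M" "distr M M ?a = M" using meas pres g by auto
    have "(\<integral>x. f (?a x) * cnj (h (?a x)) \<partial>M) = (\<integral>x. f x * cnj (h x) \<partial>distr M M ?a)"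
      using integrable_mult_cnj[OF f(1) h(1)] by (intro integral_distr[symmetric] a(1)) auto
    then show "vinner ?H (act ?H g u) (act ?H g v) = vinner ?H u v"
      using f h g a(2) by (simp add: act comp L2_inner)
  qed
qed

lemma unitary_rep_pullback:
  assumes Q: "unitary_rep Q R" and G: "group G" and phi: "\<phi> \<in> hom G Q"
  shows "unitary_rep G (pullback_rep \<phi> R)"
proof -
  interpret Q: unitary_rep Q R by fact
  interpret G: group G by fact
  interpret h: group_hom G Q \<phi>
    using phi by (simp add: group_hom_def group_hom_axioms_def G Q.is_group)
  show ?thesis
    by unfold_locales
      (auto simp: pullback_rep_def Q.ip_simps Q.act_in Q.act_ip Q.act_inv Q.ip_pos
        intro: Q.ip_cnj Q.ip_definite)
qed

section \<open>The odometer, its cylinders and the Haar measure\<close>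

text \<open>The quotient groups are used abstractly; unfolding their product to a product of sets would
  keep the group laws from applying.\<close>

declare mult_FactGroup [simp del] one_FactGroup [simp del]

locale odometer_system = group G for G :: "('a, 'b) monoid_scheme" (structure) +
  fixes \<Gamma> :: "nat \<Rightarrow> 'a set" and \<mu> :: "(nat \<Rightarrow> 'a set) measure"
  assumes seq: "odometer_sequence G \<Gamma>"
    and haar: "haar_probability (odometer G \<Gamma>) (odometer_topology G \<Gamma>) \<mu>"
begin

abbreviation \<Omega> where "\<Omega> \<equiv> carrier (odometer G \<Gamma>)"
abbreviation Q where "Q n \<equiv> G Mod \<Gamma> n"
abbreviation K where "K n \<equiv> carrier (Q n)"
abbreviation coset where "coset n g \<equiv> \<Gamma> n #> g"
abbreviation \<alpha> where "\<alpha> \<equiv> odometer_action G \<Gamma>"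

definition cyl where "cyl n c = {x \<in> \<Omega>. x n = c}"

lemma normal_\<Gamma>: "\<Gamma> n \<lhd> G"
  and K_finite: "finite (K n)"
  and \<Gamma>_Suc: "\<Gamma> (Suc n) \<subseteq> \<Gamma> n"
  and \<Gamma>_Inter: "(\<Inter>n. \<Gamma> n) = {\<one>}"
  using seq by (auto simp: odometer_sequence_def finite_index_normal_def FactGroup_def)

lemma group_Q: "group (Q n)"
  using normal_\<Gamma> by (rule normal.factorgroup_is_group)

lemma coset_hom: "coset n \<in> hom G (Q n)"
  using normal.r_coset_hom_Mod[OF normal_\<Gamma>] .

lemma coset_in: "g \<in> carrier G \<Longrightarrow> coset n g \<in> K n"
  using coset_hom by (auto simp: hom_def)

lemma coset_mult: "\<lbrakk>g \<in> carrier G; h \<in> carrier G\<rbrakk>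
    \<Longrightarrow> coset n (g \<otimes> h) = coset n g \<otimes>\<^bsub>Q n\<^esub> coset n h"
  using coset_hom by (auto simp: hom_def)

lemma coset_inv: "g \<in> carrier G \<Longrightarrow> inv\<^bsub>Q n\<^esub> coset n g = coset n (inv g)"
  using group_hom.hom_inv[of G "Q n" "coset n" g] coset_hom group_Q is_group
  by (simp add: group_hom_def group_hom_axioms_def)

lemma K_cases:
  assumes "c \<in> K n" obtains g where "g \<in> carrier G" "c = coset n g"
  using assms by (auto simp: FactGroup_def RCOSETS_def)

lemma K_nonempty: "K n \<noteq> {}"
  using coset_in[of \<one> n] by auto

lemma \<Omega>_iff: "x \<in> \<Omega> \<longleftrightarrow> (\<forall>n. x n \<in> K n) \<and> (\<forall>n. connecting_map G \<Gamma> n (x (Suc n)) = x n)"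
  by (auto simp: odometer_def PiE_iff)

lemma connecting_coset: "g \<in> carrier G \<Longrightarrow> connecting_map G \<Gamma> n (coset (Suc n) g) = coset n g"
  by (rule connecting_map_coset[OF is_group seq])

text \<open>Coset representatives of a coordinate serve for all earlier coordinates too.\<close>

lemma coord_down:
  assumes x: "x \<in> \<Omega>" and g: "g \<in> carrier G" and n: "x n = coset n g" and "m \<le> n"
  shows "x m = coset m g"
  using \<open>m \<le> n\<close>
proof (induction m rule: inc_induct)
  case (step m)
  have "x m = connecting_map G \<Gamma> m (x (Suc m))" using x by (simp add: \<Omega>_iff)
  then show ?case using step.IH connecting_coset[OF g] by simp
qed (rule n)

lemma coord_determines:
  assumes "x \<in> \<Omega>" "y \<in> \<Omega>" "x n = y n" "m \<le> n" shows "x m = y m"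
proof -
  have "x n \<in> K n" using assms(1) by (simp add: \<Omega>_iff)
  then obtain g where "g \<in> carrier G" "x n = coset n g" by (rule K_cases)
  then show ?thesis using coord_down[of _ g n m] assms by metis
qed

lemma action_apply: "\<alpha> g x n = coset n g \<otimes>\<^bsub>Q n\<^esub> x n"
  by (simp add: odometer_action_def odometer_def)

lemma embed_in: "g \<in> carrier G \<Longrightarrow> (\<lambda>n. coset n g) \<in> \<Omega>"
  by (simp add: \<Omega>_iff coset_in connecting_coset)

lemma action_in:
  assumes g: "g \<in> carrier G" and x: "x \<in> \<Omega>" shows "\<alpha> g x \<in> \<Omega>"
proof -
  have "\<alpha> g x n \<in> K n \<and> connecting_map G \<Gamma> n (\<alpha> g x (Suc n)) = \<alpha> g x n" for n
  proof -
    have "x (Suc n) \<in> K (Suc n)" using x by (simp add: \<Omega>_iff)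
    then obtain h where h: "h \<in> carrier G" "x (Suc n) = coset (Suc n) h" by (rule K_cases)
    have "x n = coset n h" by (rule coord_down[OF x h]) simp
    then show ?thesis
      using g h by (simp add: action_apply connecting_coset coset_in flip: coset_mult)
  qed
  then show ?thesis by (simp add: \<Omega>_iff)
qed

lemma action_inv:
  assumes g: "g \<in> carrier G" and x: "x \<in> \<Omega>"
  shows "\<alpha> g (\<alpha> (inv g) x) = x" "\<alpha> (inv g) (\<alpha> g x) = x"
proof -
  have *: "\<alpha> g (\<alpha> (inv g) x) = x" if "g \<in> carrier G" for g
  proof
    fix n
    interpret Q: group "Q n" by (rule group_Q)
    have xn: "x n \<in> K n" using x by (simp add: \<Omega>_iff)
    have "coset n g \<otimes>\<^bsub>Q n\<^esub> (inv\<^bsub>Q n\<^esub> coset n g \<otimes>\<^bsub>Q n\<^esub> x n) = x n"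
      using coset_in[OF that] xn by (simp flip: Q.m_assoc)
    then show "\<alpha> g (\<alpha> (inv g) x) n = x n"
      using that by (simp add: action_apply coset_inv)
  qed
  show "\<alpha> g (\<alpha> (inv g) x) = x" using * g .
  show "\<alpha> (inv g) (\<alpha> g x) = x" using *[of "inv g"] g by simp
qed

lemma topspace_odometer: "topspace (odometer_topology G \<Gamma>) = \<Omega>"
  by (auto simp: odometer_topology_def odometer_def)

lemma space_\<mu>: "space \<mu> = \<Omega>" and prob: "prob_space \<mu>"
  and sets_\<mu>_open: "sets \<mu> = sigma_sets \<Omega> {S. openin (odometer_topology G \<Gamma>) S}"
  and invariance: "\<lbrakk>a \<in> \<Omega>; A \<in> sets \<mu>\<rbrakk> \<Longrightarrow> emeasure \<mu> ((\<lambda>x. a \<otimes>\<^bsub>odometer G \<Gamma>\<^esub> x) ` A) = emeasure \<mu> A"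
  using haar topspace_odometer by (auto simp: haar_probability_def)

text \<open>The empty set is included to make the family stable under intersection.\<close>

definition cylinders where "cylinders = insert {} {cyl n c | n c. True}"

lemma openin_cyl: "openin (odometer_topology G \<Gamma>) (cyl n c)"
proof (cases "c \<in> K n")
  case True
  have "continuous_map (odometer_topology G \<Gamma>) (discrete_topology (K n)) (\<lambda>x. x n)"
    unfolding odometer_topology_def
    by (intro continuous_map_from_subtopology continuous_map_product_projection) simp
  then have "openin (odometer_topology G \<Gamma>) {x \<in> topspace (odometer_topology G \<Gamma>). x n \<in> {c}}"
    by (rule openin_continuous_map_preimage) (use True in simp)
  then show ?thesis by (simp add: cyl_def topspace_odometer)
next
  case False
  then have "cyl n c = {}" by (auto simp: cyl_def \<Omega>_iff)
  then show ?thesis by simp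
qed

text \<open>A basic open neighbourhood of \<open>x\<close> restricts finitely many coordinates, all of which are determined
  by the last of them.\<close>

lemma open_contains_cyl:
  assumes U: "openin (odometer_topology G \<Gamma>) U" and x: "x \<in> U"
  shows "\<exists>n. cyl n (x n) \<subseteq> U"
proof -
  let ?P = "product_topology (\<lambda>n. discrete_topology (K n)) (UNIV :: nat set)"
  obtain W where W: "openin ?P W" "U = W \<inter> \<Omega>"
    using U by (auto simp: odometer_topology_def openin_subtopology)
  then obtain B where B: "finite {i. B i \<noteq> K i}" "x \<in> Pi\<^sub>E UNIV B" "Pi\<^sub>E UNIV B \<subseteq> W"
    using x by (force simp: openin_product_topology_alt)
  obtain n where n: "\<And>i. B i \<noteq> K i \<Longrightarrow> i \<le> n"
    using finite_nat_set_iff_bounded_le[of "{i. B i \<noteq> K i}"] B(1) by auto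
  have "y \<in> U" if y: "y \<in> cyl n (x n)" for y
  proof -
    have yx: "y \<in> \<Omega>" "x \<in> \<Omega>" "y n = x n" using y x W(2) by (auto simp: cyl_def)
    have "y i \<in> B i" for i
    proof (cases "B i = K i")
      case False
      then have "y i = x i" using coord_determines[OF yx] n by blast
      then show ?thesis using B(2) by auto
    qed (use yx in \<open>auto simp: \<Omega>_iff\<close>)
    then show ?thesis using B(3) yx W(2) by auto
  qed
  then show ?thesis by blast
qed

text \<open>An open set is the union of the cylinders that it contains, and there are countably many cylinders.\<close>

lemma sets_\<mu>: "sets \<mu> = sigma_sets \<Omega> cylinders"
  unfolding sets_\<mu>_open
proof (rule sigma_sets_eqI)
  fix U assume U: "U \<in> {S. openin (odometer_topology G \<Gamma>) S}"
  then have sub: "U \<subseteq> \<Omega>" using openin_subset topspace_odometer by blast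
  have "cylinders \<subseteq> Pow \<Omega>" by (auto simp: cylinders_def cyl_def)
  then interpret s: sigma_algebra \<Omega> "sigma_sets \<Omega> cylinders" by (rule sigma_algebra_sigma_sets)
  have eq: "U = (\<Union>n. \<Union>c\<in>{c\<in>K n. cyl n c \<subseteq> U}. cyl n c)"
  proof
    show "U \<subseteq> (\<Union>n. \<Union>c\<in>{c\<in>K n. cyl n c \<subseteq> U}. cyl n c)"
    proof
      fix x assume x: "x \<in> U"
      then obtain n where "cyl n (x n) \<subseteq> U" using open_contains_cyl U by blast
      moreover have "x n \<in> K n" "x \<in> cyl n (x n)" using x sub by (auto simp: cyl_def \<Omega>_iff)
      ultimately show "x \<in> (\<Union>n. \<Union>c\<in>{c\<in>K n. cyl n c \<subseteq> U}. cyl n c)" by blast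
    qed
  qed blast
  have "(\<Union>n. \<Union>c\<in>{c\<in>K n. cyl n c \<subseteq> U}. cyl n c) \<in> sigma_sets \<Omega> cylinders"
    using K_finite by (intro s.countable_UN s.finite_UN image_subsetI)
      (auto simp: cylinders_def intro: sigma_sets.Basic)
  then show "U \<in> sigma_sets \<Omega> cylinders" using eq by simp
next
  fix U assume "U \<in> cylinders"
  then have "openin (odometer_topology G \<Gamma>) U" using openin_cyl by (auto simp: cylinders_def)
  then show "U \<in> sigma_sets \<Omega> {S. openin (odometer_topology G \<Gamma>) S}" by (simp add: sigma_sets.Basic)
qed

lemma cyl_sets [measurable]: "cyl n c \<in> sets \<mu>"
  unfolding sets_\<mu> by (rule sigma_sets.Basic) (auto simp: cylinders_def)

lemma coset_translate_iff:
  assumes "g \<in> carrier G" "c \<in> K n" "d \<in> K n"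
  shows "coset n g \<otimes>\<^bsub>Q n\<^esub> d = c \<longleftrightarrow> d = coset n (inv g) \<otimes>\<^bsub>Q n\<^esub> c"
proof -
  interpret Q: group "Q n" by (rule group_Q)
  show ?thesis
    using Q.inv_solve_left[of "coset n g" c d] assms coset_in[of g n]
    by (metis Q.inv_closed Q.inv_inv Q.inv_solve_left coset_inv)
qed

lemma action_vimage_cyl:
  assumes g: "g \<in> carrier G" and c: "c \<in> K n"
  shows "\<alpha> g -` cyl n c \<inter> space \<mu> = cyl n (coset n (inv g) \<otimes>\<^bsub>Q n\<^esub> c)"
proof -
  have "\<alpha> g x \<in> cyl n c \<longleftrightarrow> x \<in> cyl n (coset n (inv g) \<otimes>\<^bsub>Q n\<^esub> c)" if x: "x \<in> \<Omega>" for x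
  proof -
    have "x n \<in> K n" using x by (simp add: \<Omega>_iff)
    then show ?thesis
      unfolding cyl_def mem_Collect_eq action_apply[of g x n]
      using x action_in[OF g x] coset_translate_iff[OF g c] by blast
  qed
  moreover have "cyl n (coset n (inv g) \<otimes>\<^bsub>Q n\<^esub> c) \<subseteq> \<Omega>" by (simp add: cyl_def)
  ultimately show ?thesis unfolding space_\<mu> by blast
qed

lemma measurable_action: "g \<in> carrier G \<Longrightarrow> \<alpha> g \<in> measurable \<mu> \<mu>"
proof (rule measurable_sigma_sets[OF sets_\<mu>])
  assume g: "g \<in> carrier G"
  show "cylinders \<subseteq> Pow \<Omega>" by (auto simp: cylinders_def cyl_def)
  show "\<alpha> g \<in> space \<mu> \<rightarrow> \<Omega>" using action_in g by (auto simp: space_\<mu>)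
  fix U assume "U \<in> cylinders"
  then consider "U = {}" | n c where "U = cyl n c" by (auto simp: cylinders_def)
  then show "\<alpha> g -` U \<inter> space \<mu> \<in> sets \<mu>"
  proof cases
    case 2
    show ?thesis
    proof (cases "c \<in> K n")
      case True
      then show ?thesis using action_vimage_cyl[OF g True] 2 by simp
    next
      case False
      then have "U = {}" unfolding 2 cyl_def \<Omega>_iff by blast
      then show ?thesis by simp
    qed
  qed simp
qed

text \<open>The element \<open>g\<close> acts as the translation by the point \<open>(\<Gamma> n #> g)\<^sub>n\<close> of the odometer.\<close>

lemma distr_action:
  assumes g: "g \<in> carrier G" shows "distr \<mu> \<mu> (\<alpha> g) = \<mu>"
proof (rule measure_eqI)
  fix A assume "A \<in> sets (distr \<mu> \<mu> (\<alpha> g))"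
  then have A: "A \<in> sets \<mu>" by simp
  then have sub: "A \<subseteq> \<Omega>" using sets.sets_into_space space_\<mu> by blast
  have "\<alpha> g -` A \<inter> space \<mu> = \<alpha> (inv g) ` A"
  proof
    show "\<alpha> g -` A \<inter> space \<mu> \<subseteq> \<alpha> (inv g) ` A"
      using action_inv(2)[OF g] by (force simp: space_\<mu>)
    show "\<alpha> (inv g) ` A \<subseteq> \<alpha> g -` A \<inter> space \<mu>"
      using action_inv(1)[OF g] action_in[of "inv g"] g sub by (auto simp: space_\<mu>)
  qed
  also have "\<alpha> (inv g) ` A = (\<lambda>x. (\<lambda>n. coset n (inv g)) \<otimes>\<^bsub>odometer G \<Gamma>\<^esub> x) ` A"
    by (simp add: odometer_action_def)
  finally have "emeasure \<mu> (\<alpha> g -` A \<inter> space \<mu>) = emeasure \<mu> A"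
    using invariance[OF embed_in A] g by simp
  then show "emeasure (distr \<mu> \<mu> (\<alpha> g)) A = emeasure \<mu> A"
    using emeasure_distr[OF measurable_action[OF g] A] by simp
qed simp

sublocale prob_space \<mu> by (rule prob)

text \<open>The action permutes the cylinders of level \<open>n\<close> transitively, so they share the total mass equally.\<close>

lemma cyl_measure:
  assumes c: "c \<in> K n" shows "measure \<mu> (cyl n c) = 1 / card (K n)"
proof -
  have same: "measure \<mu> (cyl n d) = measure \<mu> (cyl n c)" if d: "d \<in> K n" for d
  proof -
    obtain g h where gh: "g \<in> carrier G" "c = coset n g" "h \<in> carrier G" "d = coset n h"
      using c d K_cases by metis
    define t where "t = h \<otimes> inv g"
    have t: "t \<in> carrier G" using gh by (simp add: t_def)
    have "coset n t \<otimes>\<^bsub>Q n\<^esub> c = d"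
      unfolding gh(2,4) t_def using gh(1,3) by (simp add: m_assoc flip: coset_mult)
    then have "c = coset n (inv t) \<otimes>\<^bsub>Q n\<^esub> d" using coset_translate_iff[OF t d c] by blast
    then have "\<alpha> t -` cyl n d \<inter> space \<mu> = cyl n c" using action_vimage_cyl[OF t d] by simp
    then show ?thesis
      using measure_distr[OF measurable_action[OF t], of "cyl n d"] distr_action[OF t] by simp
  qed
  have "\<Omega> = (\<Union>d\<in>K n. cyl n d)" by (auto simp: cyl_def \<Omega>_iff)
  then have "1 = measure \<mu> (\<Union>d\<in>K n. cyl n d)" using prob_space space_\<mu> by simp
  also have "\<dots> = (\<Sum>d\<in>K n. measure \<mu> (cyl n d))"
  proof (rule finite_measure_finite_Union[OF K_finite])
    show "disjoint_family_on (cyl n) (K n)"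
      by (simp add: disjoint_family_on_def disjoint_iff cyl_def)
  qed (simp add: image_subset_iff)
  also have "\<dots> = card (K n) * measure \<mu> (cyl n c)" using same by simp
  finally show ?thesis using K_finite K_nonempty by (simp add: field_simps)
qed

section \<open>Density of the functions of a single coordinate\<close>

lemma
  fixes F :: "'a set \<Rightarrow> 'c :: {banach, second_countable_topology}"
  shows integrable_coord: "integrable \<mu> (\<lambda>x. F (x n))"
    and integral_coord: "(\<integral>x. F (x n) \<partial>\<mu>) = (\<Sum>c\<in>K n. F c /\<^sub>R card (K n))"
proof -
  let ?g = "\<lambda>x. \<Sum>c\<in>K n. indicat_real (cyl n c) x *\<^sub>R F c"
  have eq: "F (x n) = ?g x" if "x \<in> space \<mu>" for x
  proof -
    have "?g x = (\<Sum>c\<in>K n. if c = x n then F c else 0)"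
      using that by (intro sum.cong) (auto simp: cyl_def space_\<mu> indicator_def)
    also have "\<dots> = F (x n)" using that K_finite by (simp add: space_\<mu> \<Omega>_iff)
    finally show ?thesis ..
  qed
  have int: "integrable \<mu> (\<lambda>x. indicat_real (cyl n c) x *\<^sub>R F c)" for c
    by (intro integrable_scaleR_left integrable_real_indicator) (auto simp: emeasure_eq_measure)
  have "integrable \<mu> ?g" using int by (rule Bochner_Integration.integrable_sum)
  moreover have "integrable \<mu> (\<lambda>x. F (x n)) \<longleftrightarrow> integrable \<mu> ?g"
    by (intro Bochner_Integration.integrable_cong refl eq)
  ultimately show "integrable \<mu> (\<lambda>x. F (x n))" by simp
  have "(\<integral>x. F (x n) \<partial>\<mu>) = (\<integral>x. ?g x \<partial>\<mu>)"
    by (intro Bochner_Integration.integral_cong refl eq)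
  also have "\<dots> = (\<Sum>c\<in>K n. measure \<mu> (cyl n c) *\<^sub>R F c)"
  proof -
    have "(\<integral>x. indicat_real (cyl n c) x *\<^sub>R F c \<partial>\<mu>) = measure \<mu> (cyl n c) *\<^sub>R F c" for c
    proof -
      have "integrable \<mu> (indicat_real (cyl n c))"
        by (rule integrable_real_indicator) (simp_all add: emeasure_eq_measure)
      moreover have "cyl n c \<inter> space \<mu> = cyl n c" by (auto simp: cyl_def space_\<mu>)
      ultimately show ?thesis by simp
    qed
    then show ?thesis using int by (simp add: Bochner_Integration.integral_sum)
  qed
  also have "\<dots> = (\<Sum>c\<in>K n. F c /\<^sub>R card (K n))"
    by (intro sum.cong) (auto simp: cyl_measure divide_inverse)
  finally show "(\<integral>x. F (x n) \<partial>\<mu>) = (\<Sum>c\<in>K n. F c /\<^sub>R card (K n))" .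
qed

lemma sq_integrable_coord: "(\<lambda>x. p (x n)) \<in> sq_integrable \<mu>"
  using borel_measurable_integrable[OF integrable_coord[of p n]]
    integrable_coord[of "\<lambda>c. (cmod (p c))\<^sup>2" n] by (simp add: sq_integrable_def)

text \<open>A function of one coordinate is a function of any later coordinate: a coset of \<open>\<Gamma> n\<close> is contained in
  a unique coset of \<open>\<Gamma> m\<close>.\<close>

lemma coord_raise:
  assumes "m \<le> n" shows "\<exists>q. \<forall>x\<in>\<Omega>. p (x m) = q (x n)"
proof -
  define q where "q c = p (coset m (SOME g. g \<in> carrier G \<and> c = coset n g))" for c
  have "p (x m) = q (x n)" if x: "x \<in> \<Omega>" for x
  proof -
    have "\<exists>g. g \<in> carrier G \<and> x n = coset n g" using x K_cases by (metis \<Omega>_iff)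
    then have "(SOME g. g \<in> carrier G \<and> x n = coset n g) \<in> carrier G \<and>
      x n = coset n (SOME g. g \<in> carrier G \<and> x n = coset n g)" by (rule someI_ex)
    then have "x m = coset m (SOME g. g \<in> carrier G \<and> x n = coset n g)"
      using coord_down[OF x] assms by blast
    then show ?thesis by (simp add: q_def)
  qed
  then show ?thesis by blast
qed

text \<open>The functions that are limits in mean square of functions of a single coordinate.\<close>

definition approximable :: "((nat \<Rightarrow> 'a set) \<Rightarrow> complex) set" where
  "approximable = {f \<in> sq_integrable \<mu>. \<forall>e>0. \<exists>n p. (\<integral>x. (cmod (f x - p (x n)))\<^sup>2 \<partial>\<mu>) < e}"

lemma sq_dist_triangle:
  assumes "f \<in> sq_integrable \<mu>" "g \<in> sq_integrable \<mu>" "h \<in> sq_integrable \<mu>"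
  shows "(\<integral>x. (cmod (f x - h x))\<^sup>2 \<partial>\<mu>)
    \<le> 2 * (\<integral>x. (cmod (f x - g x))\<^sup>2 \<partial>\<mu>) + 2 * (\<integral>x. (cmod (g x - h x))\<^sup>2 \<partial>\<mu>)"
proof -
  have int: "integrable \<mu> (\<lambda>x. (cmod (a x - b x))\<^sup>2)"
    if "a \<in> sq_integrable \<mu>" "b \<in> sq_integrable \<mu>" for a b
    using sq_integrable_add[OF that(1) sq_integrable_scale[OF that(2), of "-1"]]
    by (simp add: sq_integrable_def)
  have "(\<integral>x. (cmod (f x - h x))\<^sup>2 \<partial>\<mu>)
      \<le> (\<integral>x. 2 * (cmod (f x - g x))\<^sup>2 + 2 * (cmod (g x - h x))\<^sup>2 \<partial>\<mu>)"
  proof (rule integral_mono)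
    fix x show "(cmod (f x - h x))\<^sup>2 \<le> 2 * (cmod (f x - g x))\<^sup>2 + 2 * (cmod (g x - h x))\<^sup>2"
      using cmod_add_sq[of "f x - g x" "g x - h x"] by simp
  qed (use int assms in auto)
  then show ?thesis using int assms by simp
qed

lemma approximable_coord: "(\<lambda>x. p (x n)) \<in> approximable"
  using sq_integrable_coord by (auto simp: approximable_def intro!: exI[of _ n] exI[of _ p])

lemma approximable_cong:
  assumes f: "f \<in> approximable" and g: "g \<in> borel_measurable \<mu>" and eq: "\<And>x. x \<in> \<Omega> \<Longrightarrow> f x = g x"
  shows "g \<in> approximable"
proof -
  have "integrable \<mu> (\<lambda>x. (cmod (g x))\<^sup>2) \<longleftrightarrow> integrable \<mu> (\<lambda>x. (cmod (f x))\<^sup>2)"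
    by (rule Bochner_Integration.integrable_cong) (simp_all add: eq space_\<mu>)
  moreover have "(\<integral>x. (cmod (g x - p (x n)))\<^sup>2 \<partial>\<mu>) = (\<integral>x. (cmod (f x - p (x n)))\<^sup>2 \<partial>\<mu>)" for p n
    by (rule Bochner_Integration.integral_cong) (simp_all add: eq space_\<mu>)
  ultimately show ?thesis using f g by (simp add: approximable_def sq_integrable_def)
qed

lemma approximable_closed:
  assumes f: "f \<in> sq_integrable \<mu>"
    and ap: "\<And>e. e > 0 \<Longrightarrow> \<exists>h\<in>approximable. (\<integral>x. (cmod (f x - h x))\<^sup>2 \<partial>\<mu>) < e"
  shows "f \<in> approximable"
  unfolding approximable_def
proof (intro CollectI conjI allI impI f)
  fix e :: real assume e: "e > 0"
  then obtain h where h: "h \<in> approximable" "(\<integral>x. (cmod (f x - h x))\<^sup>2 \<partial>\<mu>) < e / 4"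
    using ap[of "e / 4"] by auto
  then obtain n p where p: "(\<integral>x. (cmod (h x - p (x n)))\<^sup>2 \<partial>\<mu>) < e / 4"
    using e unfolding approximable_def by (auto dest: spec[of _ "e / 4"])
  have "(\<integral>x. (cmod (f x - p (x n)))\<^sup>2 \<partial>\<mu>) < e"
    using sq_dist_triangle[OF f _ sq_integrable_coord, of h p n] h p by (auto simp: approximable_def)
  then show "\<exists>n p. (\<integral>x. (cmod (f x - p (x n)))\<^sup>2 \<partial>\<mu>) < e" by blast
qed

lemma approximable_scale:
  assumes f: "f \<in> approximable" shows "(\<lambda>x. c * f x) \<in> approximable"
proof (cases "c = 0")
  case True
  then show ?thesis using approximable_coord[of "\<lambda>_. 0"] by simp
next
  case False
  have f': "f \<in> sq_integrable \<mu>" using f by (simp add: approximable_def)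
  show ?thesis
  proof (rule approximable_closed)
    show "(\<lambda>x. c * f x) \<in> sq_integrable \<mu>" using f' by (rule sq_integrable_scale)
    fix e :: real assume "e > 0"
    then have "e / (cmod c)\<^sup>2 > 0" using False by simp
    then obtain n p where p: "(\<integral>x. (cmod (f x - p (x n)))\<^sup>2 \<partial>\<mu>) < e / (cmod c)\<^sup>2"
      using f unfolding approximable_def by blast
    have "(cmod (c * f x - c * p (x n)))\<^sup>2 = (cmod c)\<^sup>2 * (cmod (f x - p (x n)))\<^sup>2" for x
      by (simp add: norm_mult power_mult_distrib flip: right_diff_distrib)
    then have "(\<integral>x. (cmod (c * f x - c * p (x n)))\<^sup>2 \<partial>\<mu>) < e"
      using p False by (simp add: field_simps)
    then show "\<exists>h\<in>approximable. (\<integral>x. (cmod (c * f x - h x))\<^sup>2 \<partial>\<mu>) < e"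
      using approximable_coord[of "\<lambda>y. c * p y" n] by (intro bexI[of _ "\<lambda>x. c * p (x n)"])
  qed
qed

lemma approximable_add:
  assumes f: "f \<in> approximable" and g: "g \<in> approximable"
  shows "(\<lambda>x. f x + g x) \<in> approximable"
proof (rule approximable_closed)
  have f': "f \<in> sq_integrable \<mu>" and g': "g \<in> sq_integrable \<mu>" using f g by (auto simp: approximable_def)
  then show "(\<lambda>x. f x + g x) \<in> sq_integrable \<mu>" by (rule sq_integrable_add)
  fix e :: real assume e: "e > 0"
  obtain n p where p: "(\<integral>x. (cmod (f x - p (x n)))\<^sup>2 \<partial>\<mu>) < e / 4"
    using f e unfolding approximable_def by (auto dest: spec[of _ "e / 4"])
  obtain m q where q: "(\<integral>x. (cmod (g x - q (x m)))\<^sup>2 \<partial>\<mu>) < e / 4"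
    using g e unfolding approximable_def by (auto dest: spec[of _ "e / 4"])
  obtain p' q' where pq: "\<forall>x\<in>\<Omega>. p (x n) = p' (x (max n m))" "\<forall>x\<in>\<Omega>. q (x m) = q' (x (max n m))"
    using coord_raise[of n "max n m" p] coord_raise[of m "max n m" q] by auto
  let ?h = "\<lambda>x. p (x n) + q (x m)"
  have h: "?h \<in> approximable"
    by (rule approximable_cong[OF approximable_coord[of "\<lambda>c. p' c + q' c" "max n m"]])
      (use pq sq_integrable_add[OF sq_integrable_coord sq_integrable_coord] in
        \<open>auto simp: sq_integrable_def\<close>)
  have h': "?h \<in> sq_integrable \<mu>" using h by (simp add: approximable_def)
  have m: "(\<lambda>x. p (x n) + g x) \<in> sq_integrable \<mu>"
    by (rule sq_integrable_add[OF sq_integrable_coord g'])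
  have "(\<integral>x. (cmod (f x + g x - ?h x))\<^sup>2 \<partial>\<mu>)
    \<le> 2 * (\<integral>x. (cmod (f x + g x - (p (x n) + g x)))\<^sup>2 \<partial>\<mu>)
      + 2 * (\<integral>x. (cmod (p (x n) + g x - ?h x))\<^sup>2 \<partial>\<mu>)"
    by (rule sq_dist_triangle[OF sq_integrable_add[OF f' g'] m h'])
  then have "(\<integral>x. (cmod (f x + g x - ?h x))\<^sup>2 \<partial>\<mu>) < e" using p q by simp
  then show "\<exists>h\<in>approximable. (\<integral>x. (cmod (f x + g x - h x))\<^sup>2 \<partial>\<mu>) < e" by (rule bexI[OF _ h])
qed

lemma approximable_sum:
  assumes "finite I" "\<And>i. i \<in> I \<Longrightarrow> f i \<in> approximable"
  shows "(\<lambda>x. \<Sum>i\<in>I. f i x) \<in> approximable"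
  using assms
proof (induction I rule: finite_induct)
  case empty
  then show ?case using approximable_coord[of "\<lambda>_. 0"] by simp
qed (simp add: approximable_add)

text \<open>Pointwise limits are mean square limits by dominated convergence.\<close>

lemma approximable_limit:
  assumes h: "\<And>k. h k \<in> approximable" and f: "f \<in> borel_measurable \<mu>"
    and lim: "\<And>x. x \<in> \<Omega> \<Longrightarrow> (\<lambda>k. h k x) \<longlonglongrightarrow> f x"
    and w: "integrable \<mu> w" "\<And>k x. x \<in> \<Omega> \<Longrightarrow> (cmod (h k x))\<^sup>2 \<le> w x"
  shows "f \<in> approximable"
proof (rule approximable_closed)
  have h': "h k \<in> sq_integrable \<mu>" for k using h by (simp add: approximable_def)
  have [measurable]: "f \<in> borel_measurable \<mu>" "h k \<in> borel_measurable \<mu>" for k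
    using f h' by (auto simp: sq_integrable_def)
  have fw: "(cmod (f x))\<^sup>2 \<le> w x" if "x \<in> \<Omega>" for x
    by (rule LIMSEQ_le_const2[of "\<lambda>k. (cmod (h k x))\<^sup>2"])
      (use lim[OF that] w(2)[OF that] in \<open>auto intro!: tendsto_intros\<close>)
  show "f \<in> sq_integrable \<mu>"
    by (rule sq_integrable_dominated[OF f w(1)]) (simp add: fw space_\<mu>)
  have "(\<lambda>k. \<integral>x. (cmod (f x - h k x))\<^sup>2 \<partial>\<mu>) \<longlonglongrightarrow> (\<integral>x. 0 \<partial>\<mu>)"
  proof (rule integral_dominated_convergence[where w = "\<lambda>x. 4 * w x"])
    show "AE x in \<mu>. (\<lambda>k. (cmod (f x - h k x))\<^sup>2) \<longlonglongrightarrow> 0"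
    proof (rule AE_I2)
      fix x assume "x \<in> space \<mu>"
      then have "(\<lambda>k. (cmod (f x - h k x))\<^sup>2) \<longlonglongrightarrow> (cmod (f x - f x))\<^sup>2"
        using lim by (intro tendsto_intros) (simp add: space_\<mu>)
      then show "(\<lambda>k. (cmod (f x - h k x))\<^sup>2) \<longlonglongrightarrow> 0" by simp
    qed
    show "AE x in \<mu>. norm ((cmod (f x - h k x))\<^sup>2) \<le> 4 * w x" for k
    proof (rule AE_I2)
      fix x assume "x \<in> space \<mu>"
      then have "x \<in> \<Omega>" by (simp add: space_\<mu>)
      then show "norm ((cmod (f x - h k x))\<^sup>2) \<le> 4 * w x"
        using cmod_add_sq[of "f x" "- h k x"] fw w(2)[of x k] by fastforce
    qed
  qed (use w(1) in auto)
  then have lim0: "(\<lambda>k. \<integral>x. (cmod (f x - h k x))\<^sup>2 \<partial>\<mu>) \<longlonglongrightarrow> 0" by simp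
  fix e :: real assume "e > 0"
  then have "eventually (\<lambda>k. (\<integral>x. (cmod (f x - h k x))\<^sup>2 \<partial>\<mu>) < e) sequentially"
    by (rule order_tendstoD(2)[OF lim0])
  then obtain k where "(\<integral>x. (cmod (f x - h k x))\<^sup>2 \<partial>\<mu>) < e"
    by (auto simp: eventually_sequentially)
  then show "\<exists>g\<in>approximable. (\<integral>x. (cmod (f x - g x))\<^sup>2 \<partial>\<mu>) < e" using h by blast
qed

text \<open>Two cylinders are nested or disjoint.\<close>

lemma Int_stable_cylinders: "Int_stable cylinders"
proof -
  have *: "cyl n c \<inter> cyl m d \<in> cylinders" if "n \<le> m" for n m c d
  proof (cases "cyl n c \<inter> cyl m d = {}")
    case False
    then obtain x where x: "x \<in> \<Omega>" "x n = c" "x m = d" by (auto simp: cyl_def)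
    have "cyl m d \<subseteq> cyl n c"
      using coord_determines[OF _ x(1) _ that] x by (auto simp: cyl_def)
    then have "cyl n c \<inter> cyl m d = cyl m d" by blast
    then show ?thesis by (auto simp: cylinders_def)
  qed (simp add: cylinders_def)
  have "cyl n c \<inter> cyl m d \<in> cylinders" for n m c d
    using *[of n m c d] *[of m n d c] by (cases "n \<le> m") (auto simp: Int_commute)
  moreover have "a = {} \<or> (\<exists>n c. a = cyl n c)" if "a \<in> cylinders" for a
    using that by (auto simp: cylinders_def)
  moreover have "{} \<in> cylinders" by (simp add: cylinders_def)
  ultimately show ?thesis by (intro Int_stableI) (metis Int_empty_left Int_empty_right)
qed

text \<open>Dynkin's theorem applies: the indicator function of a cylinder depends on one coordinate, and
  complements and disjoint unions correspond to differences and dominated limits of finite sums.\<close>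

lemma approximable_indicator:
  assumes "A \<in> sets \<mu>" shows "(\<lambda>x. complex_of_real (indicator A x)) \<in> approximable"
proof -
  have "cylinders \<subseteq> Pow \<Omega>" by (auto simp: cylinders_def cyl_def)
  with Int_stable_cylinders show ?thesis
    using assms[unfolded sets_\<mu>]
  proof (induction rule: sigma_sets_induct_disjoint)
    case (basic A)
    then consider "A = {}" | n c where "A = cyl n c" by (auto simp: cylinders_def)
    then show ?case
    proof cases
      case 1
      then show ?thesis using approximable_coord[of "\<lambda>_. 0"] by simp
    next
      case 2
      show ?thesis
      proof (rule approximable_cong[OF approximable_coord[of "\<lambda>d. if d = c then 1 else 0" n]])
        show "(\<lambda>x. complex_of_real (indicator A x)) \<in> borel_measurable \<mu>" unfolding 2 by measurable
      qed (simp add: 2 cyl_def indicator_def)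
    qed
  next
    case empty
    then show ?case using approximable_coord[of "\<lambda>_. 0"] by simp
  next
    case (compl A)
    have A[measurable]: "A \<in> sets \<mu>" using compl(1) by (simp add: sets_\<mu>)
    have [measurable]: "\<Omega> \<in> sets \<mu>" using sets.top[of \<mu>] by (simp add: space_\<mu>)
    have "(\<lambda>x. 1 + (-1) * complex_of_real (indicator A x)) \<in> approximable"
      using approximable_coord[of "\<lambda>_. 1"] compl(2) by (intro approximable_add approximable_scale) auto
    then show ?case
    proof (rule approximable_cong)
      show "(\<lambda>x. complex_of_real (indicator (\<Omega> - A) x)) \<in> borel_measurable \<mu>" by measurable
    qed (simp add: indicator_def)
  next
    case (union A)
    have [measurable]: "A i \<in> sets \<mu>" for i using union(2) by (auto simp: sets_\<mu>)
    let ?h = "\<lambda>k x. \<Sum>i<k. complex_of_real (indicator (A i) x)"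
    have h: "?h k x = complex_of_real (indicator (\<Union>i<k. A i) x)" for k x
    proof -
      have "disjoint_family_on A {..<k}" using union(1) by (auto simp: disjoint_family_on_def)
      then have "indicat_real (\<Union>i<k. A i) x = (\<Sum>i<k. indicat_real (A i) x)"
        by (intro indicator_UN_disjoint) auto
      then show ?thesis by simp
    qed
    show ?case
    proof (rule approximable_limit[of ?h _ "\<lambda>_. 1"])
      show "?h k \<in> approximable" for k using union(3) by (intro approximable_sum) auto
      show "(\<lambda>x. complex_of_real (indicator (\<Union>i. A i) x)) \<in> borel_measurable \<mu>" by measurable
      show "(\<lambda>k. ?h k x) \<longlonglongrightarrow> complex_of_real (indicator (\<Union>i. A i) x)" for x
        unfolding h by (intro tendsto_of_real LIMSEQ_indicator_UN)
      show "(cmod (?h k x))\<^sup>2 \<le> 1" for k x unfolding h by (simp add: indicator_def)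
    qed simp
  qed
qed

text \<open>Every measurable function is the pointwise limit of simple functions that it dominates up to a
  factor of two.\<close>

lemma approximable_all:
  assumes f: "f \<in> sq_integrable \<mu>" shows "f \<in> approximable"
proof -
  have fm: "f \<in> borel_measurable \<mu>" using f by (simp add: sq_integrable_def)
  obtain F where F: "\<And>i. simple_function \<mu> (F i)"
    "\<And>x. x \<in> space \<mu> \<Longrightarrow> (\<lambda>i. F i x) \<longlonglongrightarrow> f x"
    "\<And>i x. x \<in> space \<mu> \<Longrightarrow> dist (F i x) 0 \<le> 2 * dist (f x) 0"
    using borel_measurable_implies_sequence_metric[OF fm, of 0] by blast
  show ?thesis
  proof (rule approximable_limit[of F _ "\<lambda>x. 4 * (cmod (f x))\<^sup>2"])
    show "F k \<in> approximable" for k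
    proof -
      let ?A = "\<lambda>y. F k -` {y} \<inter> space \<mu>"
      have A: "?A y \<in> sets \<mu>" for y using F(1) by (rule simple_functionD)
      have "(\<lambda>x. \<Sum>y\<in>F k ` space \<mu>. y * complex_of_real (indicator (?A y) x)) \<in> approximable"
        using simple_functionD(1)[OF F(1)] approximable_indicator[OF A]
        by (intro approximable_sum approximable_scale) auto
      then show ?thesis
      proof (rule approximable_cong)
        show "F k \<in> borel_measurable \<mu>" using F(1) by (rule borel_measurable_simple_function)
        fix x assume x: "x \<in> \<Omega>"
        have "(\<Sum>y\<in>F k ` space \<mu>. y * complex_of_real (indicator (?A y) x))
          = (\<Sum>y\<in>F k ` space \<mu>. if y = F k x then y else 0)"
          using x by (intro sum.cong) (auto simp: space_\<mu> indicator_def)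
        then show "(\<Sum>y\<in>F k ` space \<mu>. y * complex_of_real (indicator (?A y) x)) = F k x"
          using x simple_functionD(1)[OF F(1)] by (simp add: space_\<mu>)
      qed
    qed
    show "(cmod (F k x))\<^sup>2 \<le> 4 * (cmod (f x))\<^sup>2" if "x \<in> \<Omega>" for k x
      using power_mono[OF F(3)[of x k], of 2] that by (simp add: space_\<mu> power_mult_distrib)
  qed (use F(2) fm f in \<open>auto simp: space_\<mu> sq_integrable_def\<close>)
qed

end

section \<open>The finite levels and the regular representations of the quotients\<close>

context odometer_system
begin

abbreviation U where "U \<equiv> odometer_rep G \<Gamma> \<mu>"

lemma unitary_rep_odometer: "unitary_rep G U"
  unfolding odometer_rep_def
  by (rule unitary_rep_L2[OF is_group measurable_action distr_action])
    (auto simp: space_\<mu> action_inv)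

lemma translation_bij:
  assumes a: "a \<in> K n" shows "bij_betw (\<lambda>x. a \<otimes>\<^bsub>Q n\<^esub> x) (K n) (K n)"
proof -
  interpret Q: group "Q n" by (rule group_Q)
  show ?thesis
    using a by (intro bij_betw_byWitness[where f' = "\<lambda>x. inv\<^bsub>Q n\<^esub> a \<otimes>\<^bsub>Q n\<^esub> x"])
      (auto simp: Q.m_assoc[symmetric])
qed

lemma unitary_rep_quotient: "unitary_rep G (quotient_regular_rep G (\<Gamma> n))"
proof -
  interpret Q: group "Q n" by (rule group_Q)
  have "unitary_rep (Q n) (left_regular_rep (Q n))"
    unfolding left_regular_rep_def
    by (rule unitary_rep_L2[OF group_Q])
      (auto simp: Q.m_assoc[symmetric] intro!: distr_bij_count_space translation_bij)
  then show ?thesis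
    unfolding quotient_regular_rep_def using is_group coset_hom by (rule unitary_rep_pullback)
qed

definition J where "J n p = ae_class \<mu> (\<lambda>x. p (x n))"
text \<open>The functions of the \<open>n\<close>-th coordinate form the \<open>n\<close>-th step of the exhaustion of the space of
  square-integrable functions.\<close>

definition E where "E n = range (J n)"

lemma J_in: "J n p \<in> vecs U"
  using sq_integrable_coord by (simp add: odometer_rep_def J_def L2_vecs)

lemma J_add: "vadd U (J n p) (J n q) = J n (\<lambda>c. p c + q c)"
  unfolding odometer_rep_def J_def by (rule L2_add[OF sq_integrable_coord sq_integrable_coord])

lemma J_scale: "vscale U a (J n p) = J n (\<lambda>c. a * p c)"
  unfolding odometer_rep_def J_def by (rule L2_scale[OF sq_integrable_coord])

lemma J_zero: "vzero U = J n (\<lambda>_. 0)"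
  by (simp add: odometer_rep_def J_def L2_zero)

lemma J_inner: "vinner U (J n p) (J n q) = (\<Sum>c\<in>K n. p c * cnj (q c)) / card (K n)"
proof -
  have "vinner U (J n p) (J n q) = (\<integral>x. p (x n) * cnj (q (x n)) \<partial>\<mu>)"
    unfolding odometer_rep_def J_def by (rule L2_inner[OF sq_integrable_coord sq_integrable_coord])
  also have "\<dots> = (\<Sum>c\<in>K n. (p c * cnj (q c)) /\<^sub>R card (K n))" by (rule integral_coord)
  also have "\<dots> = (\<Sum>c\<in>K n. p c * cnj (q c)) / card (K n)"
    by (simp add: scaleR_conv_of_real sum_distrib_left divide_inverse mult.commute)
  finally show ?thesis .
qed

lemma J_act:
  assumes g: "g \<in> carrier G"
  shows "act U g (J n p) = J n (\<lambda>c. p (coset n (inv g) \<otimes>\<^bsub>Q n\<^esub> c))"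
proof -
  have "act U g (J n p) = ae_class \<mu> (\<lambda>x. p (\<alpha> (inv g) x n))"
    unfolding odometer_rep_def J_def using g
    by (intro L2_act[OF sq_integrable_coord measurable_action distr_action]) auto
  then show ?thesis by (simp add: J_def action_apply)
qed

lemma J_raise: "J n p = J (Suc n) (\<lambda>c. p (connecting_map G \<Gamma> n c))"
  unfolding J_def by (rule ae_class_cong_space) (simp add: space_\<mu> \<Omega>_iff)

lemma E_subspace: "lin_subspace U (E n)"
  unfolding lin_subspace_def E_def using J_in J_zero[of n] by (auto simp: J_add J_scale)

lemma E_invariant: "invariant G U (E n)"
  by (auto simp: invariant_def E_def J_act)

lemma E_mono: "E n \<subseteq> E (Suc n)"
  unfolding E_def by (metis J_raise image_subset_iff rangeI)

text \<open>The indicator functions of the cylinders of level \<open>n\<close>, normalized by \<open>sqrt [G : \<Gamma> n]\<close>, are a complete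
  orthonormal set.\<close>

lemma E_fin_dim: "fin_dim_subspace U (E n)"
proof -
  interpret unitary_rep G U by (rule unitary_rep_odometer)
  let ?N = "card (K n)"
  have N: "?N > 0" using K_finite K_nonempty by (simp add: card_gt_0_iff)
  define b where "b c = J n (\<lambda>d. if d = c then complex_of_real (sqrt ?N) else 0)" for c
  have coeff: "vinner U (J n p) (b c) = p c * sqrt ?N / ?N" if "c \<in> K n" for p c
  proof -
    have "(\<Sum>d\<in>K n. p d * cnj (if d = c then complex_of_real (sqrt ?N) else 0))
      = (\<Sum>d\<in>K n. if d = c then p c * sqrt ?N else 0)"
      by (rule sum.cong) auto
    also have "\<dots> = p c * sqrt ?N" using that K_finite by simp
    finally show ?thesis unfolding b_def J_inner by simp
  qed
  have bb: "vinner U (b c) (b d) = (if c = d then 1 else 0)" if "c \<in> K n" "d \<in> K n" for c d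
  proof -
    have "complex_of_real (sqrt ?N) * complex_of_real (sqrt ?N) = of_nat ?N"
      by (simp flip: of_real_mult)
    then show ?thesis
      using coeff[OF that(2), of "\<lambda>d. if d = c then complex_of_real (sqrt ?N) else 0"] N
      by (auto simp: b_def)
  qed
  show ?thesis
  proof (rule fin_dim_if_onb[OF E_subspace])
    have "c = d" if "c \<in> K n" "d \<in> K n" "b c = b d" for c d
      using bb[OF that(1,2)] bb[OF that(1,1)] that(3) by (auto split: if_splits)
    then show "orthonormal U (b ` K n)"
      using K_finite bb J_in by (auto simp: orthonormal_def b_def)
    show "b ` K n \<subseteq> E n" by (auto simp: b_def E_def)
    show "total_in U (E n) (b ` K n)"
      unfolding total_in_def
    proof (intro ballI impI)
      fix u assume u: "u \<in> E n" "\<forall>s\<in>b ` K n. vinner U u s = 0"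
      then obtain p where p: "u = J n p" by (auto simp: E_def)
      have "p c = 0" if "c \<in> K n" for c
        using u(2) that coeff[OF that, of p] N by (auto simp: p)
      then have "vinner U u u = 0" by (simp add: p J_inner)
      then show "u = vzero U" using zero_iff J_in p by simp
    qed
  qed
qed

text \<open>If \<open>g\<close> lies in \<open>\<Gamma> n\<close> but not in \<open>\<Gamma> (Suc n)\<close>, the cosets \<open>c\<close> and \<open>d\<close> of \<open>1\<close> and \<open>g\<close> differ at level
  \<open>Suc n\<close> and agree at level \<open>n\<close>. The difference of the indicator functions of their cylinders is then a
  nonzero element of \<open>E (Suc n)\<close> that is orthogonal to \<open>E n\<close>.\<close>

lemma E_grows:
  assumes ne: "\<Gamma> (Suc n) \<noteq> \<Gamma> n" shows "E (Suc n) \<noteq> E n"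
proof
  assume eq: "E (Suc n) = E n"
  obtain g where g: "g \<in> \<Gamma> n" "g \<notin> \<Gamma> (Suc n)" using ne \<Gamma>_Suc by blast
  have sub: "subgroup (\<Gamma> k) G" for k using normal_\<Gamma> by (simp add: normal_def)
  have gG: "g \<in> carrier G" using g(1) subgroup.mem_carrier[OF sub] by blast
  define c where "c = coset (Suc n) \<one>"
  define d where "d = coset (Suc n) g"
  have cd: "c \<in> K (Suc n)" "d \<in> K (Suc n)" using gG coset_in by (auto simp: c_def d_def)
  have "c = \<Gamma> (Suc n)" using coset_mult_one[OF subgroup.subset[OF sub]] by (simp add: c_def)
  moreover have "g \<in> d" using rcos_self[OF gG sub] by (simp add: d_def)
  ultimately have "c \<noteq> d" using g(2) by auto
  have same: "connecting_map G \<Gamma> n c = connecting_map G \<Gamma> n d"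
  proof -
    have "coset n g = coset n \<one>"
      using coset_join2[OF gG sub g(1)] coset_mult_one[OF subgroup.subset[OF sub]] by simp
    then show ?thesis using gG by (simp add: c_def d_def connecting_coset)
  qed
  define r where "r e = (if e = c then 1 else 0) - (if e = d then 1 else (0::complex))" for e
  have inner: "vinner U (J (Suc n) r) (J (Suc n) q) = (cnj (q c) - cnj (q d)) / card (K (Suc n))" for q
  proof -
    have "(\<Sum>e\<in>K (Suc n). r e * cnj (q e))
      = (\<Sum>e\<in>K (Suc n). (if e = c then cnj (q c) else 0) - (if e = d then cnj (q d) else 0))"
      by (rule sum.cong) (auto simp: r_def)
    also have "\<dots> = cnj (q c) - cnj (q d)" using cd K_finite by (simp add: sum_subtractf)
    finally show ?thesis by (simp add: J_inner)
  qed
  have "J (Suc n) r \<in> E n" using eq by (auto simp: E_def)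
  then obtain p where p: "J (Suc n) r = J n p" by (auto simp: E_def)
  have "vinner U (J (Suc n) r) (J n p) = 0"
    unfolding J_raise[of n p] inner same by simp
  then have "vinner U (J (Suc n) r) (J (Suc n) r) = 0" using p by simp
  then have "2 / of_nat (card (K (Suc n))) = (0::complex)"
    unfolding inner using \<open>c \<noteq> d\<close> by (simp add: r_def)
  then show False using K_finite K_nonempty by (simp add: card_gt_0_iff)
qed

text \<open>If \<open>\<Gamma>\<close> were constant from \<open>N\<close> on, then \<open>\<Gamma> N\<close> would be the trivial group, which has infinite index.\<close>

lemma \<Gamma>_not_stationary:
  assumes inf: "infinite (carrier G)" shows "\<exists>n\<ge>N. \<Gamma> (Suc n) \<noteq> \<Gamma> n"
proof (rule ccontr)
  assume "\<not> ?thesis"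
  then have eq: "\<Gamma> (Suc n) = \<Gamma> n" if "N \<le> n" for n using that by blast
  have const: "\<Gamma> n = \<Gamma> N" if "N \<le> n" for n
    using that by (induction n rule: dec_induct) (auto simp: eq)
  have dec: "\<Gamma> N \<subseteq> \<Gamma> n" for n
  proof (cases "N \<le> n")
    case False
    then have "n \<le> N" by simp
    then show ?thesis
    proof (induction n rule: inc_induct)
      case (step k)
      then show ?case using \<Gamma>_Suc[of k] by blast
    qed simp
  next
    case True
    from const[OF this] show ?thesis by (rule equalityD2)
  qed
  then have "\<Gamma> N = {\<one>}" using \<Gamma>_Inter by blast
  then have "coset N g = {g}" if "g \<in> carrier G" for g using that by (simp add: r_coset_def)
  then have "inj_on (coset N) (carrier G)" by (auto simp: inj_on_def)
  moreover have "finite (coset N ` carrier G)"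
    by (rule finite_subset[OF _ K_finite[of N]]) (auto intro: coset_in)
  ultimately show False using inf finite_imageD by blast
qed

lemma E_dense: "norm_closure U (\<Union>n. E n) = vecs U"
proof
  show "norm_closure U (\<Union>n. E n) \<subseteq> vecs U" by (auto simp: norm_closure_def)
  show "vecs U \<subseteq> norm_closure U (\<Union>n. E n)"
  proof
    fix v assume v: "v \<in> vecs U"
    then obtain f where f: "f \<in> sq_integrable \<mu>" "v = ae_class \<mu> f"
      by (auto simp: odometer_rep_def L2_vecs)
    have "\<exists>w\<in>\<Union>n. E n. vdist U v w < e" if e: "e > 0" for e
    proof -
      have "e\<^sup>2 > 0" using e by simp
      then obtain n p where p: "(\<integral>x. (cmod (f x - p (x n)))\<^sup>2 \<partial>\<mu>) < e\<^sup>2"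
        using approximable_all[OF f(1)] unfolding approximable_def by blast
      let ?d = "\<lambda>x. f x + (-1) * p (x n)"
      have d: "?d \<in> sq_integrable \<mu>"
        by (intro sq_integrable_add sq_integrable_scale sq_integrable_coord f)
      have diff: "vadd U v (vscale U (-1) (J n p)) = ae_class \<mu> ?d"
        unfolding J_scale unfolding J_def f(2) odometer_rep_def
        by (rule L2_add[OF f(1) sq_integrable_coord[of "\<lambda>c. -1 * p c"]])
      have "vinner U (ae_class \<mu> ?d) (ae_class \<mu> ?d) = complex_of_real (\<integral>x. (cmod (?d x))\<^sup>2 \<partial>\<mu>)"
        unfolding odometer_rep_def L2_inner[OF d d] by (rule integral_mult_cnj_self)
      then have "vdist U v (J n p) = sqrt (\<integral>x. (cmod (f x - p (x n)))\<^sup>2 \<partial>\<mu>)"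
        unfolding vdist_def Let_def diff by simp
      also have "\<dots> < e" using p e by (simp add: real_less_lsqrt)
      finally show ?thesis by (auto simp: E_def)
    qed
    then show "v \<in> norm_closure U (\<Union>n. E n)" using v by (simp add: norm_closure_def)
  qed
qed

text \<open>The factor \<open>1 / sqrt [G : \<Gamma> n]\<close> accounts for the difference between Haar measure, which gives every
  cylinder of level \<open>n\<close> the mass \<open>1 / [G : \<Gamma> n]\<close>, and counting measure on \<open>G/\<Gamma> n\<close>.\<close>

lemma E_equivalent: "unitarily_equivalent G (subrep U (E n)) (quotient_regular_rep G (\<Gamma> n))"
proof -
  let ?S = "quotient_regular_rep G (\<Gamma> n)" and ?M = "count_space (K n)"
  let ?s = "complex_of_real (1 / sqrt (card (K n)))"
  interpret R: unitary_rep G U by (rule unitary_rep_odometer)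
  interpret S: unitary_rep G ?S by (rule unitary_rep_quotient)
  interpret Q: group "Q n" by (rule group_Q)
  have N: "card (K n) > 0" using K_finite K_nonempty by (simp add: card_gt_0_iff)
  have sq: "f \<in> sq_integrable ?M" for f
    using K_finite by (simp add: sq_integrable_def integrable_count_space)
  define J' where "J' p = ae_class ?M (\<lambda>c. ?s * p c)" for p
  have S_simps: "vecs ?S = ae_class ?M ` sq_integrable ?M"
    "vadd ?S = vadd (left_regular_rep (Q n))" "vscale ?S = vscale (left_regular_rep (Q n))"
    "vinner ?S = vinner (left_regular_rep (Q n))"
    "act ?S g = act (left_regular_rep (Q n)) (coset n g)" for g
    by (simp_all add: quotient_regular_rep_def pullback_rep_def left_regular_rep_def L2_vecs)
  show ?thesis
  proof (rule unitarily_equivalent_parametrized[where J = "J n" and J' = J' and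
        padd = "\<lambda>p q c. p c + q c" and pscale = "\<lambda>a p c. a * p c" and
        \<tau> = "\<lambda>g p c. p (coset n (inv g) \<otimes>\<^bsub>Q n\<^esub> c)"])
    show "range (J n) = E n" by (simp add: E_def)
    show "E n \<subseteq> vecs U" using E_subspace by (simp add: lin_subspace_def)
    have "ae_class ?M f \<in> range J'" for f
    proof -
      have "?s * (sqrt (card (K n)) * f c) = f c" for c using N by (simp flip: of_real_mult mult.assoc)
      then have "ae_class ?M f = J' (\<lambda>c. sqrt (card (K n)) * f c)" by (simp only: J'_def)
      then show ?thesis by simp
    qed
    then show "range J' = vecs ?S" by (auto simp: S_simps J'_def intro: sq)
    show "J n (\<lambda>c. p c + q c) = vadd U (J n p) (J n q)" for p q by (simp add: J_add)
    show "J n (\<lambda>c. a * p c) = vscale U a (J n p)" for a p by (simp add: J_scale)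
    show "J' (\<lambda>c. p c + q c) = vadd ?S (J' p) (J' q)" for p q
      unfolding S_simps left_regular_rep_def J'_def L2_add[OF sq sq] by (simp add: distrib_left)
    show "J' (\<lambda>c. a * p c) = vscale ?S a (J' p)" for a p
      unfolding S_simps left_regular_rep_def J'_def L2_scale[OF sq] by (simp add: mult.left_commute)
    show "J n (\<lambda>c. p (coset n (inv g) \<otimes>\<^bsub>Q n\<^esub> c)) = act U g (J n p)" if "g \<in> carrier G" for g p
      using J_act[OF that] by simp
    show "J' (\<lambda>c. p (coset n (inv g) \<otimes>\<^bsub>Q n\<^esub> c)) = act ?S g (J' p)" if g: "g \<in> carrier G" for g p
    proof -
      have ig: "coset n (inv g) \<in> K n" using g by (simp add: coset_in)
      then have "bij_betw (\<lambda>x. coset n (inv g) \<otimes>\<^bsub>Q n\<^esub> x) (K n) (K n)" by (rule translation_bij)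
      then have "distr ?M ?M (\<lambda>x. coset n (inv g) \<otimes>\<^bsub>Q n\<^esub> x) = ?M" by (rule distr_bij_count_space)
      then have "act (left_regular_rep (Q n)) (coset n g) (J' p)
          = ae_class ?M (\<lambda>c. ?s * p (inv\<^bsub>Q n\<^esub> coset n g \<otimes>\<^bsub>Q n\<^esub> c))"
        unfolding left_regular_rep_def J'_def using g ig
        by (intro L2_act[OF sq]) (simp_all add: coset_inv)
      then show ?thesis using g by (simp add: S_simps J'_def coset_inv)
    qed
    show "vinner ?S (J' p) (J' q) = vinner U (J n p) (J n q)" for p q
    proof -
      have ss: "?s * ?s = 1 / of_nat (card (K n))"
        by (simp flip: of_real_mult) 
      have "vinner ?S (J' p) (J' q) = (\<Sum>c\<in>K n. ?s * p c * cnj (?s * q c))"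
        unfolding S_simps left_regular_rep_def J'_def L2_inner[OF sq sq]
        by (rule lebesgue_integral_count_space_finite[OF K_finite])
      also have "\<dots> = (\<Sum>c\<in>K n. (?s * ?s) * (p c * cnj (q c)))" by (simp add: mult_ac)
      also have "\<dots> = vinner U (J n p) (J n q)"
        unfolding ss J_inner by (simp add: sum_divide_distrib)
      finally show ?thesis .
    qed
  qed (rule R.ip_space_axioms S.ip_space_axioms)+
qed

lemma decomposition_matches:
  assumes V: "orthogonal_irreducibles G U (E n) {..<k} V"
    and W: "irreducible_decomposition G (quotient_regular_rep G (\<Gamma> n)) {..<m::nat} W"
  shows "\<exists>\<sigma>. bij_betw \<sigma> {..<k} {..<m} \<and>
    (\<forall>i<k. unitarily_equivalent G (subrep U (V i)) (subrep (quotient_regular_rep G (\<Gamma> n)) (W (\<sigma> i))))"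
proof -
  let ?S = "quotient_regular_rep G (\<Gamma> n)"
  interpret S: unitary_rep G ?S by (rule unitary_rep_quotient)
  have "fin_dim_subspace ?S (vecs ?S)"
    by (rule fin_dim_transfer[OF S.ip_space_axioms E_fin_dim E_equivalent])
  then have W': "orthogonal_irreducibles G ?S (vecs ?S) {..<m} W"
    using W by (rule S.orthogonal_irreducibles_if_decomposition) simp
  obtain T where "bij_betw T (E n) (vecs ?S)" "intertwiner G U (E n) ?S (vecs ?S) T"
    using E_equivalent[of n] by (auto simp: unitarily_equivalent_def intertwiner_def bij_betw_def)
  then show ?thesis
    using decomposition_unique[OF unitary_rep_odometer unitary_rep_quotient V W'] by (metis lessThan_iff)
qed

end

theorem theorem5p1:
  fixes G :: "('a, 'b) monoid_scheme"
    and \<Gamma> :: "nat \<Rightarrow> 'a set"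
    and \<mu> :: "(nat \<Rightarrow> 'a set) measure"
  assumes "group G"
    and "infinite (carrier G)"
    and "finitely_generated_group G"
    and "residually_finite_group G"
    and "odometer_sequence G \<Gamma>"
    and "haar_probability (odometer G \<Gamma>) (odometer_topology G \<Gamma>) \<mu>"
  shows "\<exists>(V :: nat \<Rightarrow> ((nat \<Rightarrow> 'a set) \<Rightarrow> complex) set set) (k :: nat \<Rightarrow> nat).
     irreducible_decomposition G (odometer_rep G \<Gamma> \<mu>) UNIV V \<and>
     (\<forall>i. finite_dim (subrep (odometer_rep G \<Gamma> \<mu>) (V i))) \<and>
     mono k \<and> filterlim k at_top sequentially \<and>
     (\<forall>n. \<Gamma> (Suc n) \<noteq> \<Gamma> n \<longrightarrow> k n < k (Suc n)) \<and>
     (\<forall>n. unitarily_equivalent G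
            (subrep (odometer_rep G \<Gamma> \<mu>) (hilbert_sum (odometer_rep G \<Gamma> \<mu>) {..<k n} V))
            (quotient_regular_rep G (\<Gamma> n)) \<and>
          (\<forall>m W. irreducible_decomposition G (quotient_regular_rep G (\<Gamma> n)) {..<m::nat} W \<longrightarrow>
             (\<exists>\<sigma>. bij_betw \<sigma> {..<k n} {..<m} \<and>
                (\<forall>i<k n. unitarily_equivalent G (subrep (odometer_rep G \<Gamma> \<mu>) (V i))
                             (subrep (quotient_regular_rep G (\<Gamma> n)) (W (\<sigma> i)))))))"
proof -
  interpret group G by fact
  interpret odometer_system G \<Gamma> \<mu> by unfold_locales (fact assms)+
  interpret R: unitary_rep G U by (rule unitary_rep_odometer)
  have "\<exists>n\<ge>N. E (Suc n) \<noteq> E n" for N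
    using \<Gamma>_not_stationary[OF assms(2), of N] E_grows by blast
  then obtain V k where V: "irreducible_decomposition G U (UNIV :: nat set) V"
    "\<And>i. finite_dim (subrep U (V i))" "mono k" "filterlim k at_top sequentially"
    "\<And>n. E (Suc n) \<noteq> E n \<Longrightarrow> k n < k (Suc n)"
    "\<And>n. orthogonal_irreducibles G U (E n) {..<k n} V"
    using R.decomposition_along_exhaustion[OF E_fin_dim E_invariant E_mono E_dense] by blast
  have "hilbert_sum U {..<k n} V = E n" for n
    using V(6)[of n] by (intro R.hilbert_sum_total E_fin_dim) (auto simp: orthogonal_irreducibles_def)
  then show ?thesis
    using V E_grows E_equivalent decomposition_matches[OF V(6)]
    by (intro exI[of _ V] exI[of _ k]) auto
qed

end
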